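(* Let $n\ge 2$ and let $q:[0,\infty)\to[0,\infty)$ be continuous on $[0,\infty)$ and $C^\infty$ on $(0,\infty)$, with $q(0)=0$ and $q(r)>0$ for $r>0$. Then the associated generalized cone Radon transform $R$ is an elliptic Fourier integral operator of order $\frac{1-n}{2}$. Let $g=q'/q$ on $(0,\infty)$ and assume $g:(0,\infty)\to(0,\infty)$ (i.e. $g(r)>0$ for all $r>0$). Then $R$ satisfies the semi-global Bolker assumption if and only if $g'(r)\neq 0$ for all $r\in(0,\infty)$ (i.e. $g$ is an immersion). Moreover, the condition that $g'(r)\ne 0$ for all $r\in(0,\infty)$ is equivalent to $q(r)q''(r)-(q'(r))^2\neq 0$ for all $r\in(0,\infty)$.
   Context: Notation. Write $\mathbf{x}=(\mathbf{x}',x_n)\in\mathbb{R}^n$ with $\mathbf{x}'\in\mathbb{R}^{n-1}$. Let $X=\{(\mathbf{x}',x_n):\mathbf{x}'\in\mathbb{R}^{n-1},\ x_n>0\}$ and $Y=(0,\infty)\times\mathbb{R}^{n-1}$, with points of $Y$ written $(E,\mathbf{x}_0)$. For $(E,\mathbf{x}_0)\in Y$ let $$S(E,\mathbf{x}_0)=\{(\mathbf{x}',x_n): x_n=Eq(\|\mathbf{x}'-\mathbf{x}_0\|),\ \mathbf{x}'\in\mathbb{R}^{n-1}\setminus\{\mathbf{x}_0\}\},\qquad \Psi(E,\mathbf{x}_0,\mathbf{x})=x_n-Eq(\|\mathbf{x}'-\mathbf{x}_0\|).$$ The generalized cone Radon transform associated with $q$ is, for compactly supported $f\in L^2(X)$,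 $$Rf(E,\mathbf{x}_0)=\int_{S(E,\mathbf{x}_0)} f\,\mathrm{d}S=\int_X f(\mathbf{x})\,\|\nabla_{\mathbf{x}}\Psi\|\,\delta(\Psi(E,\mathbf{x}_0,\mathbf{x}))\,\mathrm{d}\mathbf{x},$$ where $\mathrm{d}S$ is surface area measure. Fourier integral operators. A function $a\in C^\infty(Y\times X\times\mathbb{R}^N)$ is a symbol of order $m$ if for every compact $K\subset Y\times X$ and all multi-indices $\alpha,\beta,\gamma$ there is $C$ with $|\partial_{\mathbf{y}}^\gamma\partial_{\mathbf{x}}^\beta\partial_{\boldsymbol\sigma}^\alpha a|\le C(1+\|\boldsymbol\sigma\|)^{m-|\alpha|}$ for $(\mathbf y,\mathbf x)\in K$, $\boldsymbol\sigma\in\mathbb{R}^N$; it is elliptic if for each compact $K$ there are $C_K,M>0$ with $|a|\ge C_K(1+\|\boldsymbol\sigma\|)^m$ for $(\mathbf y,\mathbf x)\in K$, $\|\boldsymbol\sigma\|\ge M$. A phase function is $\phi\in C^\infty(Y\times X\times(\mathbb{R}^N\setminus 0))$, positively homogeneous of degree 1 in $\boldsymbol\sigma$, with $\mathrm{d}\phi$ nowhere zero. It is clean if $\Sigma_\phi=\{\mathrm{d}_{\boldsymbol\sigma}\phi=0\}$ is a smooth manifold with tangent space defined by $\mathrm{d}(\mathrm{d}_{\boldsymbol\sigma}\phi)=0$, and nondegenerate if $\mathrm{d}_{\mathbf y,\boldsymbol\sigma}\phi$ and $\mathrm{d}_{\mathbf x,\boldsymbol\sigma}\phi$ are never zero.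 An FIO of order $m+\frac N2-\frac n2$ is an operator with Schwartz kernel $\int_{\mathbb{R}^N}e^{i\phi(\mathbf y,\mathbf x,\boldsymbol\sigma)}a(\mathbf y,\mathbf x,\boldsymbol\sigma)\,\mathrm{d}\boldsymbol\sigma$, where $\phi$ is a clean nondegenerate phase function and $a$ is a symbol of order $m$; it is elliptic if $a$ is elliptic. Its canonical relation is $$\mathcal{C}=\{((\mathbf y,\mathrm{d}_{\mathbf y}\phi);(\mathbf x,-\mathrm{d}_{\mathbf x}\phi)):(\mathbf y,\mathbf x,\boldsymbol\sigma)\in\Sigma_\phi\}\subset T^*(Y)\times T^*(X).$$ For $R$ one uses the phase $\Phi(E,\mathbf{x}_0,\mathbf{x},\sigma)=\sigma\Psi(E,\mathbf{x}_0,\mathbf{x})$, $\sigma\in\mathbb{R}\setminus\{0\}$. Since $x_n>0$ on $X$ and $q(0)=0$, the kernel of $R$ vanishes near $\{\mathbf{x}'=\mathbf{x}_0\}$, so phase and symbol need only be considered on the open subset of $Y\times X$ where $\mathbf{x}'\ne\mathbf{x}_0$. Bolker assumption. An FIO with canonical relation $\mathcal{C}$ satisfies the semi-global Bolker assumption if the natural projection $\Pi_L:\mathcal{C}\to T^*(Y)$ is an injective immersion. *)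

theory Defs
  imports "HOL-Analysis.Analysis"
begin

section \<open>Smooth functions, submanifolds, immersions\<close>

primrec iter_deriv ::
  "'a::real_normed_vector list \<Rightarrow> ('a \<Rightarrow> 'b::real_normed_vector) \<Rightarrow> 'a \<Rightarrow> 'b" where
  "iter_deriv [] f = f"
| "iter_deriv (v # vs) f = (\<lambda>x. frechet_derivative (iter_deriv vs f) (at x) v)"

text \<open>
  Multi-indices are encoded as lists of basis vectors (repetitions allowed, length = order). The
  definition is meant for open \<open>S\<close>, where it is the usual notion: all partial derivatives of all
  orders exist and are again differentiable. Values of \<open>f\<close> outside \<open>S\<close> play no role.
\<close>

definition smooth_on :: "'a::euclidean_space set \<Rightarrow> ('a \<Rightarrow> 'b::real_normed_vector) \<Rightarrow> bool" where
  "smooth_on S f \<longleftrightarrow> (\<forall>vs\<in>lists Basis. \<forall>x\<in>S. iter_deriv vs f differentiable (at x))"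

definition grad :: "('a::real_inner \<Rightarrow> real) \<Rightarrow> 'a \<Rightarrow> 'a" where
  "grad f x = (THE D. GDERIV f x :> D)"

definition smooth_submanifold :: "nat \<Rightarrow> 'a::euclidean_space set \<Rightarrow> bool" where
  "smooth_submanifold d M \<longleftrightarrow>
    (\<forall>p\<in>M. \<exists>U V \<psi> \<theta> (L :: 'a set).
       open U \<and> p \<in> U \<and> open V \<and> homeomorphism U V \<psi> \<theta> \<and> smooth_on U \<psi> \<and> smooth_on V \<theta> \<and>
       subspace L \<and> dim L = d \<and> \<psi> ` (M \<inter> U) = V \<inter> L)"

definition tangent_space :: "'a::euclidean_space set \<Rightarrow> 'a \<Rightarrow> 'a set" where
  "tangent_space M p =
    {v. \<exists>\<gamma> e. e > 0 \<and> smooth_on {-e<..<e} \<gamma> \<and> \<gamma> ` {-e<..<e} \<subseteq> M \<and> \<gamma> 0 = p \<and>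
         (\<gamma> has_vector_derivative v) (at (0::real))}"

text \<open>Immersions of an embedded submanifold, for maps that are smooth on an ambient open set.\<close>

definition immersion_on ::
  "'a::euclidean_space set \<Rightarrow> ('a \<Rightarrow> 'b::euclidean_space) \<Rightarrow> bool" where
  "immersion_on M f \<longleftrightarrow>
    (\<exists>d. smooth_submanifold d M) \<and> (\<exists>U. open U \<and> M \<subseteq> U \<and> smooth_on U f) \<and>
    (\<forall>p\<in>M. \<forall>v\<in>tangent_space M p. frechet_derivative f (at p) v = 0 \<longrightarrow> v = 0)"


section \<open>Test functions, distributions and Schwartz kernels\<close>

definition test_functions :: "'a::euclidean_space set \<Rightarrow> ('a \<Rightarrow> complex) set" where
  "test_functions \<Omega> =
    {u. smooth_on UNIV u \<and> (\<exists>K. compact K \<and> K \<subseteq> \<Omega> \<and> (\<forall>x. x \<notin> K \<longrightarrow> u x = 0))}"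

definition distribution_on :: "'a::euclidean_space set \<Rightarrow> (('a \<Rightarrow> complex) \<Rightarrow> complex) \<Rightarrow> bool" where
  "distribution_on \<Omega> T \<longleftrightarrow>
    (\<forall>u\<in>test_functions \<Omega>. \<forall>v\<in>test_functions \<Omega>. T (\<lambda>x. u x + v x) = T u + T v) \<and>
    (\<forall>u\<in>test_functions \<Omega>. \<forall>c. T (\<lambda>x. c * u x) = c * T u) \<and>
    (\<forall>K. compact K \<and> K \<subseteq> \<Omega> \<longrightarrow>
      (\<exists>C k. \<forall>u\<in>test_functions \<Omega>. \<forall>B.
         (\<forall>x. x \<notin> K \<longrightarrow> u x = 0) \<and>
         (\<forall>vs\<in>lists Basis. length vs \<le> k \<longrightarrow> (\<forall>x. cmod (iter_deriv vs u x) \<le> B)) \<longrightarrow>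
         cmod (T u) \<le> C * B))"

definition schwartz_kernel ::
  "'y::euclidean_space set \<Rightarrow> 'x::euclidean_space set \<Rightarrow> (('x \<Rightarrow> complex) \<Rightarrow> 'y \<Rightarrow> complex) \<Rightarrow>
   (('y \<times> 'x \<Rightarrow> complex) \<Rightarrow> complex) \<Rightarrow> bool" where
  "schwartz_kernel Y X A T \<longleftrightarrow>
    distribution_on (Y \<times> X) T \<and>
    (\<forall>f\<in>test_functions X. \<forall>v\<in>test_functions Y.
       set_integrable lebesgue Y (\<lambda>y. A f y * v y) \<and>
       (LINT y:Y|lebesgue. A f y * v y) = T (\<lambda>(y, x). v y * f x))"


section \<open>Symbols and phase functions\<close>

text \<open>
  Base points \<open>(y, x)\<close> range over an open set \<open>W\<close>; frequencies \<open>\<sigma>\<close> range over a Euclidean space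
  \<open>'s\<close>, whose dimension is the number of phase variables. Differentials are identified with
  gradients, so the cotangent bundle of an open set of \<open>'y\<close> is a subset of \<open>'y \<times> 'y\<close>.
\<close>

definition symbol ::
  "('y::euclidean_space \<times> 'x::euclidean_space) set \<Rightarrow> real \<Rightarrow>
   ('y \<times> 'x \<times> 's::euclidean_space \<Rightarrow> complex) \<Rightarrow> bool" where
  "symbol W m a \<longleftrightarrow>
    smooth_on {(y, x, \<sigma>). (y, x) \<in> W} a \<and>
    (\<forall>K. compact K \<and> K \<subseteq> W \<longrightarrow>
      (\<forall>\<alpha>\<in>lists Basis. \<forall>\<beta>\<in>lists Basis. \<forall>\<gamma>\<in>lists Basis. \<exists>C. \<forall>y x \<sigma>. (y, x) \<in> K \<longrightarrow>
         cmod (iter_deriv (map (\<lambda>b. (b, 0, 0)) \<gamma> @ map (\<lambda>b. (0, b, 0)) \<beta> @ map (\<lambda>b. (0, 0, b)) \<alpha>)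
                 a (y, x, \<sigma>))
           \<le> C * (1 + norm \<sigma>) powr (m - real (length \<alpha>))))"

definition elliptic_symbol ::
  "('y::euclidean_space \<times> 'x::euclidean_space) set \<Rightarrow> real \<Rightarrow>
   ('y \<times> 'x \<times> 's::euclidean_space \<Rightarrow> complex) \<Rightarrow> bool" where
  "elliptic_symbol W m a \<longleftrightarrow>
    symbol W m a \<and>
    (\<forall>K. compact K \<and> K \<subseteq> W \<longrightarrow>
      (\<exists>C>0. \<exists>M>0. \<forall>y x \<sigma>. (y, x) \<in> K \<and> norm \<sigma> \<ge> M \<longrightarrow>
         cmod (a (y, x, \<sigma>)) \<ge> C * (1 + norm \<sigma>) powr m))"

definition phase_domain ::
  "('y::euclidean_space \<times> 'x::euclidean_space) set \<Rightarrow> ('y \<times> 'x \<times> 's::euclidean_space) set" where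
  "phase_domain W = {(y, x, \<sigma>). (y, x) \<in> W \<and> \<sigma> \<noteq> 0}"

definition phase_function ::
  "('y::euclidean_space \<times> 'x::euclidean_space) set \<Rightarrow>
   ('y \<times> 'x \<times> 's::euclidean_space \<Rightarrow> real) \<Rightarrow> bool" where
  "phase_function W \<phi> \<longleftrightarrow>
    smooth_on (phase_domain W) \<phi> \<and>
    (\<forall>(y, x, \<sigma>)\<in>phase_domain W. \<forall>t>0. \<phi> (y, x, t *\<^sub>R \<sigma>) = t * \<phi> (y, x, \<sigma>)) \<and>
    (\<forall>p\<in>phase_domain W. grad \<phi> p \<noteq> 0)"

definition d_y :: "('y::euclidean_space \<times> 'x \<times> 's \<Rightarrow> real) \<Rightarrow> 'y \<times> 'x \<times> 's \<Rightarrow> 'y" where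
  "d_y \<phi> = (\<lambda>(y, x, \<sigma>). grad (\<lambda>y'. \<phi> (y', x, \<sigma>)) y)"

definition d_x :: "('y \<times> 'x::euclidean_space \<times> 's \<Rightarrow> real) \<Rightarrow> 'y \<times> 'x \<times> 's \<Rightarrow> 'x" where
  "d_x \<phi> = (\<lambda>(y, x, \<sigma>). grad (\<lambda>x'. \<phi> (y, x', \<sigma>)) x)"

definition d_\<sigma> :: "('y \<times> 'x \<times> 's::euclidean_space \<Rightarrow> real) \<Rightarrow> 'y \<times> 'x \<times> 's \<Rightarrow> 's" where
  "d_\<sigma> \<phi> = (\<lambda>(y, x, \<sigma>). grad (\<lambda>\<sigma>'. \<phi> (y, x, \<sigma>')) \<sigma>)"

definition critical_set ::
  "('y::euclidean_space \<times> 'x::euclidean_space) set \<Rightarrow>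
   ('y \<times> 'x \<times> 's::euclidean_space \<Rightarrow> real) \<Rightarrow> ('y \<times> 'x \<times> 's) set" where
  "critical_set W \<phi> = {p \<in> phase_domain W. d_\<sigma> \<phi> p = 0}"

definition clean_phase ::
  "('y::euclidean_space \<times> 'x::euclidean_space) set \<Rightarrow>
   ('y \<times> 'x \<times> 's::euclidean_space \<Rightarrow> real) \<Rightarrow> bool" where
  "clean_phase W \<phi> \<longleftrightarrow>
    (\<exists>d. smooth_submanifold d (critical_set W \<phi>)) \<and>
    (\<forall>p\<in>critical_set W \<phi>.
       tangent_space (critical_set W \<phi>) p = {v. frechet_derivative (d_\<sigma> \<phi>) (at p) v = 0})"

definition nondegenerate_phase ::
  "('y::euclidean_space \<times> 'x::euclidean_space) set \<Rightarrow>
   ('y \<times> 'x \<times> 's::euclidean_space \<Rightarrow> real) \<Rightarrow> bool" where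
  "nondegenerate_phase W \<phi> \<longleftrightarrow>
    (\<forall>p\<in>phase_domain W. (d_y \<phi> p, d_\<sigma> \<phi> p) \<noteq> 0 \<and> (d_x \<phi> p, d_\<sigma> \<phi> p) \<noteq> 0)"

definition canonical_relation ::
  "('y::euclidean_space \<times> 'x::euclidean_space) set \<Rightarrow>
   ('y \<times> 'x \<times> 's::euclidean_space \<Rightarrow> real) \<Rightarrow> (('y \<times> 'y) \<times> ('x \<times> 'x)) set" where
  "canonical_relation W \<phi> =
    {((y, d_y \<phi> (y, x, \<sigma>)), (x, - d_x \<phi> (y, x, \<sigma>))) | y x \<sigma>. (y, x, \<sigma>) \<in> critical_set W \<phi>}"


section \<open>Fourier integral operators\<close>

text \<open>
  The kernel \<open>\<integral> e\<^sup>i\<^sup>\<phi> a d\<sigma>\<close> is in general only an oscillatory integral: its pairing with a test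
  function \<open>u\<close> is the limit, as \<open>\<epsilon> \<rightarrow> 0\<close>, of the absolutely convergent integrals with cutoff
  \<open>\<rho>(\<epsilon>\<sigma>)\<close>, for every \<open>\<rho>\<close> of compact support that equals 1 near the origin.
\<close>

definition oscillatory_integral ::
  "('y::euclidean_space \<times> 'x::euclidean_space) set \<Rightarrow>
   ('y \<times> 'x \<times> 's::euclidean_space \<Rightarrow> real) \<Rightarrow> ('y \<times> 'x \<times> 's \<Rightarrow> complex) \<Rightarrow>
   ('y \<times> 'x \<Rightarrow> complex) \<Rightarrow> complex \<Rightarrow> bool" where
  "oscillatory_integral W \<phi> a u l \<longleftrightarrow>
    (\<forall>\<rho>\<in>test_functions (UNIV :: 's set). (\<exists>U. open U \<and> 0 \<in> U \<and> (\<forall>\<sigma>\<in>U. \<rho> \<sigma> = 1)) \<longrightarrow>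
      ((\<lambda>\<epsilon>. LINT p:phase_domain W|lebesgue.
          (case p of (y, x, \<sigma>) \<Rightarrow>
             exp (\<i> * complex_of_real (\<phi> p)) * a p * \<rho> (\<epsilon> *\<^sub>R \<sigma>) * u (y, x)))
        \<longlongrightarrow> l) (at_right 0))"

text \<open>
  \<open>fourier_integral_operator Y X W \<phi> a m A\<close>: the operator \<open>A\<close>, from functions on \<open>X\<close> to functions
  on \<open>Y\<close>, has the Schwartz kernel \<open>\<integral> e\<^sup>i\<^sup>\<phi> a d\<sigma>\<close> with a clean nondegenerate phase \<open>\<phi>\<close> and a symbol
  \<open>a\<close> of order \<open>m\<close>. Phase and symbol are only required on \<open>W\<close>, provided that the kernel of \<open>A\<close>
  vanishes in a neighbourhood of the rest of \<open>Y \<times> X\<close>; by a partition of unity, the kernel is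
  then determined on all of \<open>Y \<times> X\<close>. The last condition is void if \<open>W = Y \<times> X\<close>.
\<close>

definition fourier_integral_operator ::
  "'y::euclidean_space set \<Rightarrow> 'x::euclidean_space set \<Rightarrow> ('y \<times> 'x) set \<Rightarrow>
   ('y \<times> 'x \<times> 's::euclidean_space \<Rightarrow> real) \<Rightarrow> ('y \<times> 'x \<times> 's \<Rightarrow> complex) \<Rightarrow> real \<Rightarrow>
   (('x \<Rightarrow> complex) \<Rightarrow> 'y \<Rightarrow> complex) \<Rightarrow> bool" where
  "fourier_integral_operator Y X W \<phi> a m A \<longleftrightarrow>
    open Y \<and> open X \<and> open W \<and> W \<subseteq> Y \<times> X \<and>
    phase_function W \<phi> \<and> clean_phase W \<phi> \<and> nondegenerate_phase W \<phi> \<and> symbol W m a \<and>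
    (\<exists>T. schwartz_kernel Y X A T \<and>
      (\<forall>u\<in>test_functions W. oscillatory_integral W \<phi> a u (T u)) \<and>
      (\<exists>V. open V \<and> Y \<times> X - W \<subseteq> V \<and> (\<forall>u\<in>test_functions (V \<inter> (Y \<times> X)). T u = 0)))"

definition elliptic_FIO ::
  "'y::euclidean_space set \<Rightarrow> 'x::euclidean_space set \<Rightarrow> ('y \<times> 'x) set \<Rightarrow>
   ('y \<times> 'x \<times> 's::euclidean_space \<Rightarrow> real) \<Rightarrow> real \<Rightarrow>
   (('x \<Rightarrow> complex) \<Rightarrow> 'y \<Rightarrow> complex) \<Rightarrow> bool" where
  "elliptic_FIO Y X W \<phi> \<mu> A \<longleftrightarrow>
    (\<exists>m a. fourier_integral_operator Y X W \<phi> a m A \<and> elliptic_symbol W m a \<and>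
       \<mu> = m + real DIM('s) / 2 - real DIM('x) / 2)"

definition semi_global_Bolker ::
  "(('y::euclidean_space \<times> 'y) \<times> ('x::euclidean_space \<times> 'x)) set \<Rightarrow> bool" where
  "semi_global_Bolker \<C> \<longleftrightarrow> inj_on fst \<C> \<and> immersion_on \<C> fst"


section \<open>The generalized cone Radon transform\<close>

text \<open>
  \<open>\<real>\<^sup>n\<close> is \<open>real^'m \<times> real\<close> with \<open>CARD('m) = n - 1\<close>, points \<open>(x', x\<^sub>n)\<close>; likewise
  \<open>Y \<subseteq> real \<times> real^'m\<close> with points \<open>(E, x\<^sub>0)\<close>.
\<close>

definition X_dom :: "((real^'m) \<times> real) set" where
  "X_dom = {(x', x\<^sub>n). x\<^sub>n > 0}"

definition Y_dom :: "(real \<times> (real^'m)) set" where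
  "Y_dom = {(E, x\<^sub>0). E > 0}"

definition W_dom :: "((real \<times> (real^'m)) \<times> ((real^'m) \<times> real)) set" where
  "W_dom = {((E, x\<^sub>0), (x', x\<^sub>n)). E > 0 \<and> x\<^sub>n > 0 \<and> x' \<noteq> x\<^sub>0}"

text \<open>
  Integral with respect to surface area measure over the graph \<open>{(x', h x') | x' \<in> U}\<close>,
  whose area element is \<open>sqrt (1 + \<parallel>\<nabla>h\<parallel>\<^sup>2) dx'\<close>.
\<close>

definition graph_surface_integral ::
  "'a::euclidean_space set \<Rightarrow> ('a \<Rightarrow> real) \<Rightarrow> ('a \<times> real \<Rightarrow> complex) \<Rightarrow> complex" where
  "graph_surface_integral U h f =
    (LINT x':U|lebesgue. complex_of_real (sqrt (1 + (norm (grad h x'))\<^sup>2)) * f (x', h x'))"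

definition cone_radon ::
  "(real \<Rightarrow> real) \<Rightarrow> ((real^'m) \<times> real \<Rightarrow> complex) \<Rightarrow> real \<times> (real^'m) \<Rightarrow> complex" where
  "cone_radon q f = (\<lambda>(E, x\<^sub>0). graph_surface_integral (- {x\<^sub>0}) (\<lambda>x'. E * q (norm (x' - x\<^sub>0))) f)"

definition cone_\<Psi> ::
  "(real \<Rightarrow> real) \<Rightarrow> real \<times> (real^'m) \<Rightarrow> (real^'m) \<times> real \<Rightarrow> real" where
  "cone_\<Psi> q = (\<lambda>(E, x\<^sub>0) (x', x\<^sub>n). x\<^sub>n - E * q (norm (x' - x\<^sub>0)))"

definition cone_phase ::
  "(real \<Rightarrow> real) \<Rightarrow> (real \<times> (real^'m)) \<times> ((real^'m) \<times> real) \<times> real \<Rightarrow> real" where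
  "cone_phase q = (\<lambda>(y, x, \<sigma>). \<sigma> * cone_\<Psi> q y x)"

end

theory Submission
  imports Defs "HOL-Probability.Sinc_Integral"
begin

text \<open>
  The kernel of \<open>R\<close> is \<open>\<delta>(\<Psi>)\<close> times the surface density, so its amplitude \<open>(1 + (E q')\<^sup>2)\<^sup>1\<^sup>/\<^sup>2 / 2\<pi>\<close> does
  not depend on \<open>\<sigma>\<close> and has order 0. In the regularised oscillatory integral one shifts \<open>x\<^sub>n\<close> by
  \<open>E q\<close> and rescales it by \<open>\<epsilon>\<close>; what is left is a convolution with the integrable Fourier transform
  of the cutoff \<open>\<rho>\<close>, which tends to the integral over the surface because that transform integrates to
  \<open>2\<pi> \<rho>(0)\<close>. The latter follows by writing the truncated integral as one of \<open>\<rho>'\<close> against the sine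
  integral.

  For the Bolker condition, put \<open>r = \<parallel>x' - x\<^sub>0\<parallel>\<close>. On the canonical relation the covector \<open>(a, b)\<close> at
  \<open>y\<close> satisfies \<open>\<parallel>b\<parallel> = \<bar>a\<bar> E g(r)\<close>, and \<open>y\<close>, \<open>a\<close>, \<open>b\<close>, \<open>r\<close> determine the point smoothly. Hence
  \<open>g' \<noteq> 0\<close> makes \<open>\<Pi>\<^sub>L\<close> injective (by Rolle's theorem) and immersive, whereas at a zero of \<open>g'\<close> one can
  vary \<open>r\<close> with \<open>\<sigma> q(r)\<close> fixed, and the covector is then stationary.
\<close>

section \<open>Calculus of smooth functions\<close>

text \<open>The obstacle is the vertex \<open>x' = x\<^sub>0\<close>: \<open>q\<close> is merely
  continuous at 0, nothing is known about \<open>deriv q\<close> there, and the surface may have no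
  tangent plane. Over the vertex the surface has height \<open>q 0 = 0\<close>, whereas test
  functions on \<open>X_dom\<close> have compact support inside \<open>x\<^sub>n > 0\<close>. Hence
  every support that meets the surface does so at a positive distance from the vertex, and all
  densities are smooth where they are used.

  The order is 0 + 1/2 - n/2: the amplitude has order 0, there is one phase variable, and X has
  dimension n. The factor 1/(2 pi) undoes the constant of Fourier inversion.

  Submanifolds and tangent vectors are defined by charts and curves. The critical set and the
  canonical relation are both global graphs over coordinate subspaces, so a single shear is a chart
  for each, and immersivity can be tested by differentiating identities along curves.

  Positivity of \<open>g\<close> gives \<open>q' > 0\<close>. This selects the root when
  \<open>g(r)\<close> is known only through its square, and it lets the direction of
  \<open>x' - x\<^sub>0\<close> be read off from \<open>b\<close>.\<close>

lemma frechet_derivative_cong_on: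
  assumes "open S" "x \<in> S" "\<And>y. y \<in> S \<Longrightarrow> f y = g y"
  shows "frechet_derivative f (at x) = frechet_derivative g (at x)"
proof -
  have "(f has_derivative D) (at x) \<longleftrightarrow> (g has_derivative D) (at x)" for D
    using has_derivative_transform_within_open[of f D x UNIV S g]
      has_derivative_transform_within_open[of g D x UNIV S f] assms by auto
  then show ?thesis by (simp add: frechet_derivative_def)
qed

lemma differentiable_cong_on:
  assumes "open S" "x \<in> S" "\<And>y. y \<in> S \<Longrightarrow> f y = g y" "f differentiable (at x)"
  shows "g differentiable (at x)"
  using assms has_derivative_transform_within_open[of f _ x UNIV S g]
  unfolding differentiable_def by blast

lemma iter_deriv_cong_on:
  assumes "open S" "\<And>y. y \<in> S \<Longrightarrow> f y = g y" "x \<in> S"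
  shows "iter_deriv vs f x = iter_deriv vs g x"
  using assms(3)
proof (induction vs arbitrary: x)
  case (Cons v vs)
  then show ?case using frechet_derivative_cong_on[OF assms(1) Cons.prems Cons.IH] by simp
qed (use assms in auto)

section \<open>Finite orders of differentiability\<close>

lemma iter_deriv_snoc: "iter_deriv (vs @ [v]) f = iter_deriv vs (\<lambda>x. frechet_derivative f (at x) v)"
  by (induction vs) auto

text \<open>In \<open>iter_deriv\<close> the recursion adds a derivative on the outside, which does
  not suit product and chain rules. Here the first derivative is split off on the inside: order
  \<open>Suc k\<close> of \<open>f\<close> is order \<open>k\<close> of its first partial
  derivatives, so a rule is applied once and the induction hypothesis, for arbitrary functions, does
  the rest.\<close>

primrec times_differentiable_on ::
  "nat \<Rightarrow> 'a::euclidean_space set \<Rightarrow> ('a \<Rightarrow> 'b::real_normed_vector) \<Rightarrow> bool" where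
  "times_differentiable_on 0 S f \<longleftrightarrow> True"
| "times_differentiable_on (Suc k) S f \<longleftrightarrow> (\<forall>x\<in>S. f differentiable (at x)) \<and>
     (\<forall>b\<in>Basis. times_differentiable_on k S (\<lambda>x. frechet_derivative f (at x) b))"

lemma times_differentiable_on_iff:
  "times_differentiable_on k S f \<longleftrightarrow>
    (\<forall>vs\<in>lists Basis. length vs < k \<longrightarrow> (\<forall>x\<in>S. iter_deriv vs f differentiable (at x)))"
proof (induction k arbitrary: f)
  case (Suc k)
  show ?case (is "?l \<longleftrightarrow> ?r")
  proof
    assume l: ?l
    show ?r
    proof (intro ballI impI)
      fix vs :: "'a list" and x assume vs: "vs \<in> lists Basis" "length vs < Suc k" "x \<in> S"
      show "iter_deriv vs f differentiable (at x)"
      proof (cases vs rule: rev_cases)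
        case (snoc ws b)
        then show ?thesis using l vs by (auto simp: Suc iter_deriv_snoc)
      qed (use l vs in auto)
    qed
  next
    assume r: ?r
    have "times_differentiable_on k S (\<lambda>x. frechet_derivative f (at x) b)" if "b \<in> Basis" for b
      unfolding Suc
    proof (intro ballI impI)
      fix vs :: "'a list" and x assume "vs \<in> lists Basis" "length vs < k" "x \<in> S"
      then show "iter_deriv vs (\<lambda>x. frechet_derivative f (at x) b) differentiable (at x)"
        using r[rule_format, of "vs @ [b]" x] that by (simp add: iter_deriv_snoc)
    qed
    moreover have "\<forall>x\<in>S. f differentiable (at x)"
      using r[rule_format, of "[]"] by auto
    ultimately show ?l by simp
  qed
qed auto

lemma smooth_on_iff: "smooth_on S f \<longleftrightarrow> (\<forall>k. times_differentiable_on k S f)"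
  unfolding smooth_on_def times_differentiable_on_iff by blast

lemma smooth_on_differentiable: "smooth_on S f \<Longrightarrow> x \<in> S \<Longrightarrow> f differentiable (at x)"
  unfolding smooth_on_def by (metis iter_deriv.simps(1) lists.Nil)

lemma smooth_on_frechet_derivative:
  assumes "smooth_on S f" "b \<in> Basis"
  shows "smooth_on S (\<lambda>x. frechet_derivative f (at x) b)"
  using assms unfolding smooth_on_iff by (metis times_differentiable_on.simps(2))

lemma smooth_on_iter_deriv:
  assumes "smooth_on S f" "vs \<in> lists Basis"
  shows "smooth_on S (iter_deriv vs f)"
  using assms(2,1)
  by (induction vs) (auto intro: smooth_on_frechet_derivative)

lemma smooth_on_imp_continuous_on: "smooth_on S f \<Longrightarrow> continuous_on S f"
  by (meson continuous_at_imp_continuous_on differentiable_imp_continuous_within smooth_on_differentiable)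

lemma times_differentiable_on_cong:
  fixes f :: "'a::euclidean_space \<Rightarrow> 'b::real_normed_vector"
  assumes "open S" "\<And>x. x \<in> S \<Longrightarrow> f x = g x" "times_differentiable_on k S f"
  shows "times_differentiable_on k S g"
  using assms(2,3)
proof (induction k arbitrary: f g)
  case (Suc k)
  have "times_differentiable_on k S (\<lambda>x. frechet_derivative g (at x) b)" if "b \<in> Basis" for b
  proof (rule Suc.IH)
    show "frechet_derivative f (at x) b = frechet_derivative g (at x) b" if "x \<in> S" for x
      using frechet_derivative_cong_on[OF assms(1) that Suc.prems(1)] by simp
  qed (use Suc.prems that in auto)
  moreover have "g differentiable (at x)" if "x \<in> S" for x
    by (rule differentiable_cong_on[OF assms(1) that, of f]) (use Suc.prems that in auto)
  ultimately show ?case by simp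
qed auto

text \<open>Any explicit derivative may stand in for \<open>frechet_derivative\<close>: the two
  agree on the open set, so they can be exchanged under further differentiation. All closure rules
  go through this form.\<close>

lemma times_differentiable_on_SucI:
  assumes "open S" "\<And>x. x \<in> S \<Longrightarrow> (f has_derivative F x) (at x)"
    and "\<And>b. b \<in> Basis \<Longrightarrow> times_differentiable_on k S (\<lambda>x. F x b)"
  shows "times_differentiable_on (Suc k) S f"
proof -
  have "times_differentiable_on k S (\<lambda>x. frechet_derivative f (at x) b)" if "b \<in> Basis" for b
    using assms(2) frechet_derivative_at[of f]
    by (intro times_differentiable_on_cong[OF assms(1) _ assms(3)[OF that]]) metis
  then show ?thesis using assms(2) by (auto simp: differentiable_def)
qed

lemma times_differentiable_on_SucD:
  "times_differentiable_on (Suc k) S f \<Longrightarrow> times_differentiable_on k S f"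
  by (simp add: times_differentiable_on_iff)

lemma times_differentiable_on_derivative:
  assumes "times_differentiable_on (Suc k) S f" "x \<in> S"
  shows "(f has_derivative frechet_derivative f (at x)) (at x)"
  using assms frechet_derivative_works by auto

lemma times_differentiable_on_const: "open S \<Longrightarrow> times_differentiable_on k S (\<lambda>x. c)"
proof (induction k arbitrary: c)
  case (Suc k)
  then show ?case by (auto intro!: times_differentiable_on_SucI[where F = "\<lambda>_ _. 0"])
qed auto

lemma times_differentiable_on_bounded_linear:
  fixes f :: "'a::euclidean_space \<Rightarrow> 'b::real_normed_vector"
  assumes "bounded_linear L" "open S" "times_differentiable_on k S f"
  shows "times_differentiable_on k S (\<lambda>x. L (f x))"
  using assms(3)
proof (induction k arbitrary: f)
  case (Suc k)
  show ?case
  proof (rule times_differentiable_on_SucI[OF assms(2)])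
    fix x assume "x \<in> S"
    then show "((\<lambda>x. L (f x)) has_derivative (\<lambda>h. L (frechet_derivative f (at x) h))) (at x)"
      using times_differentiable_on_derivative[OF Suc.prems]
      by (auto intro: bounded_linear.has_derivative[OF assms(1)])
  qed (use Suc in auto)
qed auto

lemma times_differentiable_on_id: "open S \<Longrightarrow> times_differentiable_on k S (\<lambda>x. x)"
proof (cases k)
  case (Suc m)
  assume "open S"
  then show ?thesis unfolding Suc
    by (auto intro!: times_differentiable_on_SucI[where F = "\<lambda>_ h. h"] times_differentiable_on_const
        derivative_eq_intros)
qed auto

lemma times_differentiable_on_add:
  fixes f :: "'a::euclidean_space \<Rightarrow> 'b::real_normed_vector"
  assumes "open S" "times_differentiable_on k S f" "times_differentiable_on k S g"
  shows "times_differentiable_on k S (\<lambda>x. f x + g x)"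
  using assms(2,3)
proof (induction k arbitrary: f g)
  case (Suc k)
  show ?case
  proof (rule times_differentiable_on_SucI[OF assms(1)])
    fix x assume "x \<in> S"
    then show "((\<lambda>x. f x + g x) has_derivative
        (\<lambda>h. frechet_derivative f (at x) h + frechet_derivative g (at x) h)) (at x)"
      using times_differentiable_on_derivative[OF Suc.prems(1)]
        times_differentiable_on_derivative[OF Suc.prems(2)]
      by (intro has_derivative_add) auto
  qed (use Suc in auto)
qed auto

lemma times_differentiable_on_sum:
  assumes "open S" "\<And>i. i \<in> I \<Longrightarrow> times_differentiable_on k S (f i)"
  shows "times_differentiable_on k S (\<lambda>x. \<Sum>i\<in>I. f i x)"
  using assms(2)
  by (induction I rule: infinite_finite_induct)
    (auto intro: times_differentiable_on_add times_differentiable_on_const assms(1))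

text \<open>Serves scalar multiples, products and inner products at once. In the product rule one
  factor stays undifferentiated, so both functions are also used at the lower order.\<close>

lemma times_differentiable_on_bilinear:
  fixes f :: "'a::euclidean_space \<Rightarrow> 'b::real_normed_vector"
  assumes "bounded_bilinear B" "open S" "times_differentiable_on k S f" "times_differentiable_on k S g"
  shows "times_differentiable_on k S (\<lambda>x. B (f x) (g x))"
  using assms(3,4)
proof (induction k arbitrary: f g)
  case (Suc k)
  show ?case
  proof (rule times_differentiable_on_SucI[OF assms(2)])
    fix x assume "x \<in> S"
    then show "((\<lambda>x. B (f x) (g x)) has_derivative
        (\<lambda>h. B (f x) (frechet_derivative g (at x) h) + B (frechet_derivative f (at x) h) (g x))) (at x)"
      using times_differentiable_on_derivative[OF Suc.prems(1)]
        times_differentiable_on_derivative[OF Suc.prems(2)]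
      by (intro bounded_bilinear.FDERIV[OF assms(1)]) auto
  next
    fix b :: 'a assume "b \<in> Basis"
    then show "times_differentiable_on k S (\<lambda>x. B (f x) (frechet_derivative g (at x) b) +
         B (frechet_derivative f (at x) b) (g x))"
      using Suc.prems times_differentiable_on_SucD[OF Suc.prems(1)]
        times_differentiable_on_SucD[OF Suc.prems(2)]
      by (intro times_differentiable_on_add Suc.IH assms) auto
  qed
qed auto

text \<open>The chain rule is expanded over \<open>Basis\<close>, because differentiability is
  recorded only for partial derivatives of \<open>f\<close> in basis directions. Each summand is a
  component of the derivative of \<open>g\<close> times a partial derivative of \<open>f\<close>
  composed with \<open>g\<close>; the induction varies \<open>f\<close> and keeps
  \<open>g\<close>.\<close>

lemma times_differentiable_on_compose:
  fixes g :: "'a::euclidean_space \<Rightarrow> 'b::euclidean_space" and f :: "'b \<Rightarrow> 'c::real_normed_vector"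
  assumes "open S" "times_differentiable_on k T f" "times_differentiable_on k S g"
    and "\<And>x. x \<in> S \<Longrightarrow> g x \<in> T"
  shows "times_differentiable_on k S (\<lambda>x. f (g x))"
  using assms(2,3)
proof (induction k arbitrary: f)
  case (Suc k)
  let ?F = "\<lambda>x h. \<Sum>c\<in>Basis. (frechet_derivative g (at x) h \<bullet> c) *\<^sub>R frechet_derivative f (at (g x)) c"
  show ?case
  proof (rule times_differentiable_on_SucI[OF assms(1)])
    fix x assume x: "x \<in> S"
    have df: "(f has_derivative frechet_derivative f (at (g x))) (at (g x))"
      using times_differentiable_on_derivative[OF Suc.prems(1)] assms(4)[OF x] .
    have dg: "(g has_derivative frechet_derivative g (at x)) (at x)"
      using times_differentiable_on_derivative[OF Suc.prems(2)] x .
    have lin: "linear (frechet_derivative f (at (g x)))"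
      using df has_derivative_linear by blast
    have "frechet_derivative f (at (g x)) v = (\<Sum>c\<in>Basis. (v \<bullet> c) *\<^sub>R frechet_derivative f (at (g x)) c)" for v
      by (subst euclidean_representation[of v, symmetric])
        (simp only: linear_sum[OF lin] linear_cmul[OF lin])
    then show "((\<lambda>x. f (g x)) has_derivative ?F x) (at x)"
      by (intro has_derivative_eq_rhs[OF has_derivative_compose[OF dg df]] ext)
  next
    fix b :: 'a assume b: "b \<in> Basis"
    have "times_differentiable_on k S (\<lambda>x. (frechet_derivative g (at x) b \<bullet> c) *\<^sub>R frechet_derivative f (at (g x)) c)"
      if c: "c \<in> Basis" for c
      by (intro times_differentiable_on_bilinear[OF bounded_bilinear_scaleR assms(1)]
          times_differentiable_on_bounded_linear[OF bounded_linear_inner_left assms(1)]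
          Suc.IH times_differentiable_on_SucD[OF Suc.prems(2)])
        (use Suc.prems b c in auto)
    then show "times_differentiable_on k S (\<lambda>x. ?F x b)"
      by (intro times_differentiable_on_sum assms(1))
  qed
qed auto

lemma smooth_on_cong:
  "open S \<Longrightarrow> (\<And>x. x \<in> S \<Longrightarrow> f x = g x) \<Longrightarrow> smooth_on S f \<Longrightarrow> smooth_on S g"
  unfolding smooth_on_iff using times_differentiable_on_cong by metis

lemma smooth_on_const: "open S \<Longrightarrow> smooth_on S (\<lambda>x. c)"
  unfolding smooth_on_iff by (simp add: times_differentiable_on_const)

lemma smooth_on_bounded_linear:
  "bounded_linear L \<Longrightarrow> open S \<Longrightarrow> smooth_on S f \<Longrightarrow> smooth_on S (\<lambda>x. L (f x))"
  unfolding smooth_on_iff by (simp add: times_differentiable_on_bounded_linear)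

lemma smooth_on_linear: "bounded_linear L \<Longrightarrow> open S \<Longrightarrow> smooth_on S L"
  unfolding smooth_on_iff
  using times_differentiable_on_bounded_linear[of L S _ "\<lambda>x. x"] times_differentiable_on_id by blast

lemma smooth_on_bilinear:
  "bounded_bilinear B \<Longrightarrow> open S \<Longrightarrow> smooth_on S f \<Longrightarrow> smooth_on S g \<Longrightarrow> smooth_on S (\<lambda>x. B (f x) (g x))"
  unfolding smooth_on_iff by (simp add: times_differentiable_on_bilinear)

lemma smooth_on_compose:
  fixes g :: "'a::euclidean_space \<Rightarrow> 'b::euclidean_space" and f :: "'b \<Rightarrow> 'c::real_normed_vector"
  assumes "smooth_on T f" "open S" "smooth_on S g" "\<And>x. x \<in> S \<Longrightarrow> g x \<in> T"
  shows "smooth_on S (\<lambda>x. f (g x))"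
  using assms unfolding smooth_on_iff by (metis times_differentiable_on_compose)

lemma smooth_on_add:
  "open S \<Longrightarrow> smooth_on S f \<Longrightarrow> smooth_on S g \<Longrightarrow> smooth_on S (\<lambda>x. f x + g x)"
  unfolding smooth_on_iff by (simp add: times_differentiable_on_add)

lemma smooth_on_minus: "open S \<Longrightarrow> smooth_on S f \<Longrightarrow> smooth_on S (\<lambda>x. - f x)"
  by (rule smooth_on_bounded_linear[OF bounded_linear_minus[OF bounded_linear_ident]])

lemma smooth_on_diff:
  "open S \<Longrightarrow> smooth_on S f \<Longrightarrow> smooth_on S g \<Longrightarrow> smooth_on S (\<lambda>x. f x - g x)"
  using smooth_on_add[of S f "\<lambda>x. - g x"] smooth_on_minus[of S g] by simp

lemma smooth_on_Pair:
  assumes "open S" "smooth_on S f" "smooth_on S g"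
  shows "smooth_on S (\<lambda>x. (f x, g x))"
proof -
  have "smooth_on S (\<lambda>x. (f x, 0) + (0, g x))"
    by (intro smooth_on_add assms
        smooth_on_bounded_linear[OF bounded_linear_Pair[OF bounded_linear_ident bounded_linear_zero]]
        smooth_on_bounded_linear[OF bounded_linear_Pair[OF bounded_linear_zero bounded_linear_ident]])
  then show ?thesis by simp
qed

lemmas smooth_on_scaleR = smooth_on_bilinear[OF bounded_bilinear_scaleR]
lemmas smooth_on_mult = smooth_on_bilinear[OF bounded_bilinear_mult]
lemmas smooth_on_inner = smooth_on_bilinear[OF bounded_bilinear_inner]
lemmas smooth_on_fst = smooth_on_bounded_linear[OF bounded_linear_fst]
lemmas smooth_on_snd = smooth_on_bounded_linear[OF bounded_linear_snd]
lemmas smooth_on_of_real = smooth_on_bounded_linear[OF bounded_linear_of_real]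
lemmas smooth_on_id = smooth_on_linear[OF bounded_linear_ident]

section \<open>Reciprocals, roots and norms as smooth functions\<close>

lemma smooth_on_inverse: "smooth_on {x::real. x \<noteq> 0} inverse"
proof -
  have o: "open {x::real. x \<noteq> 0}" by (auto simp: open_Collect_neq)
  have "times_differentiable_on k {x::real. x \<noteq> 0} inverse" for k
  proof (induction k)
    case (Suc k)
    show ?case
    proof (rule times_differentiable_on_SucI[OF o])
      fix x :: real assume "x \<in> {x. x \<noteq> 0}"
      then show "(inverse has_derivative (\<lambda>h. - (inverse x * h * inverse x))) (at x)"
        by (auto intro: has_derivative_inverse')
    next
      fix b :: real assume "b \<in> Basis"
      show "times_differentiable_on k {x. x \<noteq> 0} (\<lambda>x::real. - (inverse x * b * inverse x))"
        by (intro times_differentiable_on_bounded_linear[OF bounded_linear_minus[OF bounded_linear_ident]]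
            times_differentiable_on_bilinear[OF bounded_bilinear_mult] times_differentiable_on_const Suc o)
    qed
  qed auto
  then show ?thesis by (simp add: smooth_on_iff)
qed

lemma smooth_on_divide:
  fixes f g :: "'a::euclidean_space \<Rightarrow> real"
  assumes "open S" "smooth_on S f" "smooth_on S g" "\<And>x. x \<in> S \<Longrightarrow> g x \<noteq> 0"
  shows "smooth_on S (\<lambda>x. f x / g x)"
  unfolding divide_inverse
  by (intro smooth_on_mult smooth_on_compose[OF smooth_on_inverse] assms) (use assms in auto)

text \<open>As with the reciprocal, the derivative is an expression in the function itself, here
  \<open>inverse (sqrt x) / 2\<close>, so order \<open>k\<close> of the function yields order
  \<open>k\<close> of its derivative and the induction closes.\<close>

lemma smooth_on_sqrt: "smooth_on {0<..} sqrt"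
proof -
  have "times_differentiable_on k {0<..} sqrt" for k
  proof (induction k)
    case (Suc k)
    show ?case
    proof (rule times_differentiable_on_SucI[OF open_greaterThan])
      fix x :: real assume "x \<in> {0<..}"
      then have "(sqrt has_real_derivative inverse (sqrt x) / 2) (at x)"
        by (auto intro: DERIV_real_sqrt)
      then show "(sqrt has_derivative (\<lambda>h. (inverse (sqrt x) / 2) * h)) (at x)"
        unfolding has_field_derivative_def .
    next
      fix b :: real assume "b \<in> Basis"
      have "times_differentiable_on k {0<..} (\<lambda>x. inverse (sqrt x))"
        by (rule times_differentiable_on_compose[OF _ _ Suc, where T = "{x. x \<noteq> 0}"])
          (use smooth_on_inverse in \<open>simp_all add: smooth_on_iff\<close>)
      then have "times_differentiable_on k {0<..} (\<lambda>x::real. (inverse (sqrt x) * (1/2)) * b)"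
        by (intro times_differentiable_on_bilinear[OF bounded_bilinear_mult] times_differentiable_on_const) auto
      then show "times_differentiable_on k {0<..} (\<lambda>x::real. (inverse (sqrt x) / 2) * b)"
        by simp
    qed
  qed auto
  then show ?thesis by (simp add: smooth_on_iff)
qed

lemma smooth_on_norm:
  fixes f :: "'a::euclidean_space \<Rightarrow> 'b::real_inner"
  assumes "open S" "smooth_on S f" "\<And>x. x \<in> S \<Longrightarrow> f x \<noteq> 0"
  shows "smooth_on S (\<lambda>x. norm (f x))"
  unfolding norm_eq_sqrt_inner
  by (intro smooth_on_compose[OF smooth_on_sqrt] smooth_on_inner assms) (use assms in auto)

lemma smooth_on_power:
  fixes f :: "'a::euclidean_space \<Rightarrow> 'b::real_normed_algebra_1"
  assumes "open S" "smooth_on S f"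
  shows "smooth_on S (\<lambda>x. f x ^ m)"
  by (induction m) (auto intro: smooth_on_const smooth_on_mult assms)

lemma smooth_on_deriv:
  fixes f :: "real \<Rightarrow> real"
  assumes "open S" "smooth_on S f"
  shows "smooth_on S (deriv f)"
proof (rule smooth_on_cong[OF assms(1) _ smooth_on_frechet_derivative[OF assms(2)]])
  fix x assume "x \<in> S"
  then show "frechet_derivative f (at x) 1 = deriv f x"
    using smooth_on_differentiable[OF assms(2)] real_differentiable_def DERIV_deriv_iff_real_differentiable
      frechet_derivative_at[of f "\<lambda>h. deriv f x * h" x] by (metis has_field_derivative_def mult.right_neutral)
qed auto

section \<open>Submanifolds given as graphs\<close>

text \<open>The map \<open>\<pi>\<close> keeps the free coordinates and sets the others to 0, while
  \<open>G\<close> computes the others from the free ones. By \<open>D_proj\<close> the domain is a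
  union of fibres of \<open>\<pi>\<close>, hence invariant under moving a point by its value of
  \<open>G\<close>.\<close>

locale smooth_graph =
  fixes \<pi> G :: "'a::euclidean_space \<Rightarrow> 'a" and D :: "'a set"
  assumes linear_proj: "bounded_linear \<pi>" and proj_idem: "\<And>p. \<pi> (\<pi> p) = \<pi> p"
    and open_D: "open D" and D_proj: "\<And>p. p \<in> D \<longleftrightarrow> \<pi> p \<in> D"
    and smooth_G: "smooth_on D G" and G_proj: "\<And>p. G (\<pi> p) = G p" and proj_G: "\<And>p. \<pi> (G p) = 0"
begin

definition graph :: "'a set" where "graph = {p \<in> D. p = \<pi> p + G p}"

lemma proj_add: "\<pi> (p + q) = \<pi> p + \<pi> q" and proj_diff: "\<pi> (p - q) = \<pi> p - \<pi> q"
  and proj_scale: "\<pi> (t *\<^sub>R p) = t *\<^sub>R \<pi> p"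
  using bounded_linear.linear[OF linear_proj] by (simp_all add: linear_add linear_diff linear_scale)

lemma G_add_G: "G (p + G p) = G p" "G (p - G p) = G p"
  using G_proj[of "p + G p"] G_proj[of "p - G p"] G_proj[of p] by (simp_all add: proj_add proj_diff proj_G)

lemma D_add_G: "p + G p \<in> D \<longleftrightarrow> p \<in> D" "p - G p \<in> D \<longleftrightarrow> p \<in> D"
  using D_proj by (metis add_0_right proj_add proj_G) (metis diff_zero proj_diff proj_G D_proj)

text \<open>One global chart suffices. The shear subtracting \<open>G p\<close> maps
  \<open>D\<close> onto itself and flattens the graph to \<open>D \<inter> range \<pi>\<close>;
  adding \<open>G p\<close> inverts it, since \<open>G\<close> sees only \<open>\<pi> p\<close> and
  takes values in the kernel of \<open>\<pi>\<close>.\<close>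

lemma smooth_submanifold_graph: "smooth_submanifold (dim (range \<pi>)) graph"
proof -
  let ?f = "\<lambda>p. p - G p" and ?g = "\<lambda>p. p + G p"
  have c: "continuous_on D G"
    by (rule smooth_on_imp_continuous_on[OF smooth_G])
  have h: "homeomorphism D D ?f ?g"
  proof (rule homeomorphismI)
    show "continuous_on D ?f" "continuous_on D ?g"
      by (intro continuous_intros c)+
  qed (auto simp: G_add_G D_add_G)
  have s: "smooth_on D ?f" "smooth_on D ?g"
    by (intro smooth_on_diff smooth_on_add smooth_on_id open_D smooth_G)+
  have L: "subspace (range \<pi>)"
    using linear_proj by (simp add: bounded_linear.linear linear_subspace_image)
  have fixed: "x \<in> range \<pi> \<longleftrightarrow> \<pi> x = x" for x
    using proj_idem by (metis rangeE rangeI)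
  have im: "?f ` (graph \<inter> D) = D \<inter> range \<pi>"
  proof
    show "?f ` (graph \<inter> D) \<subseteq> D \<inter> range \<pi>"
      by (auto simp: D_add_G) (auto simp: fixed proj_diff proj_G graph_def algebra_simps)
    show "D \<inter> range \<pi> \<subseteq> ?f ` (graph \<inter> D)"
    proof
      fix p assume p: "p \<in> D \<inter> range \<pi>"
      then have "?g p \<in> graph \<inter> D" "?f (?g p) = p"
        by (auto simp: graph_def D_add_G G_add_G proj_add proj_G proj_idem)
      then show "p \<in> ?f ` (graph \<inter> D)" by (metis (no_types, lifting) image_eqI)
    qed
  qed
  show ?thesis
    unfolding smooth_submanifold_def
  proof
    fix p assume "p \<in> graph"
    then have "p \<in> D" by (simp add: graph_def)
    then show "\<exists>U V \<psi> \<theta> (L :: 'a set). open U \<and> p \<in> U \<and> open V \<and> homeomorphism U V \<psi> \<theta> \<and>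
       smooth_on U \<psi> \<and> smooth_on V \<theta> \<and> subspace L \<and> dim L = dim (range \<pi>) \<and> \<psi> ` (graph \<inter> U) = V \<inter> L"
      using h s L im open_D by blast
  qed
qed

lemma has_derivative_G:
  "p \<in> D \<Longrightarrow> (G has_derivative frechet_derivative G (at p)) (at p)"
  using smooth_on_differentiable[OF smooth_G] frechet_derivative_works by blast

text \<open>For a curve in the graph, differentiate the equation that defines the graph. Conversely,
  lift a straight line in \<open>range \<pi>\<close> to the graph.\<close>

lemma tangent_space_graph:
  assumes p: "p \<in> graph"
  shows "tangent_space graph p = {v. v = \<pi> v + frechet_derivative G (at p) v}"
proof (intro set_eqI iffI; unfold mem_Collect_eq)
  let ?G' = "\<lambda>p. frechet_derivative G (at p)"
  have pD: "p \<in> D" and peq: "p = \<pi> p + G p" using p by (auto simp: graph_def)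
  note dG = has_derivative_G[OF pD]
  {
    fix v assume "v \<in> tangent_space graph p"
    then obtain \<gamma> e where e: "e > 0" and im: "\<gamma> ` {-e<..<e} \<subseteq> graph" and g0: "\<gamma> 0 = p"
      and d: "(\<gamma> has_vector_derivative v) (at (0::real))"
      unfolding tangent_space_def by blast
    have "((\<lambda>t. \<pi> (\<gamma> t) + G (\<gamma> t)) has_vector_derivative \<pi> v + ?G' p v) (at 0)"
      using has_derivative_compose[OF d[unfolded has_vector_derivative_def], of G "?G' p"] dG
      by (intro has_vector_derivative_add bounded_linear.has_vector_derivative[OF linear_proj d])
        (simp add: g0 has_vector_derivative_def linear_cmul[OF has_derivative_linear[OF dG]])
    moreover have "((\<lambda>t. \<pi> (\<gamma> t) + G (\<gamma> t)) has_vector_derivative v) (at 0)"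
    proof (rule has_vector_derivative_transform_within_open[OF d, of "{-e<..<e}"])
      fix t assume "t \<in> {-e<..<e}"
      then show "\<gamma> t = \<pi> (\<gamma> t) + G (\<gamma> t)" using im unfolding graph_def by blast
    qed (use e in auto)
    ultimately show "v = \<pi> v + ?G' p v" by (metis vector_derivative_at)
  next
    fix v assume v: "v = \<pi> v + ?G' p v"
    \<comment> \<open>The line passes through \<open>\<pi> p\<close>, not through \<open>p\<close>.
      Since \<open>G\<close> factors through \<open>\<pi>\<close>, its derivative at
      \<open>p\<close> is the one at \<open>\<pi> p\<close> applied to \<open>\<pi> h\<close>, which
      reconciles the two base points below.\<close>
    define c where "c = (\<lambda>t. \<pi> p + t *\<^sub>R \<pi> v)"
    have "\<pi> p \<in> D" using D_proj pD by blast
    moreover have "isCont c 0" unfolding c_def by (intro continuous_intros)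
    ultimately have "\<forall>\<^sub>F t in nhds 0. c t \<in> D"
      using open_D by (intro isContD topological_tendstoD[of c "c 0"] tendsto_at_iff_tendsto_nhds[THEN iffD1])
        (auto simp: c_def)
    then obtain e where e: "e > 0" and cD: "\<And>t. t \<in> {-e<..<e} \<Longrightarrow> c t \<in> D"
      unfolding eventually_nhds_metric by (auto simp: dist_real_def abs_less_iff)
    have pc: "\<pi> (c t) = c t" for t by (simp add: c_def proj_add proj_scale proj_idem)
    let ?\<gamma> = "\<lambda>t. c t + G (c t)"
    have dc: "(c has_vector_derivative \<pi> v) (at 0)"
      unfolding c_def by (auto intro!: derivative_eq_intros)
    have sc: "smooth_on {-e<..<e} c"
      unfolding c_def by (intro smooth_on_add smooth_on_const smooth_on_scaleR smooth_on_id) auto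
    have dG': "(G has_derivative ?G' (\<pi> p)) (at (\<pi> p))"
      using D_proj pD by (intro has_derivative_G) blast
    have "((\<lambda>x. G (\<pi> x)) has_derivative (\<lambda>h. ?G' (\<pi> p) (\<pi> h))) (at p)"
      by (rule has_derivative_compose[OF bounded_linear_imp_has_derivative[OF linear_proj] dG'])
    then have G'eq: "?G' p = (\<lambda>h. ?G' (\<pi> p) (\<pi> h))"
      using dG by (simp add: G_proj has_derivative_unique)
    have "(?\<gamma> has_vector_derivative \<pi> v + ?G' (\<pi> p) (\<pi> v)) (at 0)"
      using has_derivative_compose[OF dc[unfolded has_vector_derivative_def], of G "?G' (\<pi> p)"] dG'
      by (intro has_vector_derivative_add dc)
        (simp add: c_def has_vector_derivative_def linear_cmul[OF has_derivative_linear[OF dG']])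
    then have "(?\<gamma> has_vector_derivative v) (at 0)" using v by (simp add: G'eq)
    moreover have "smooth_on {-e<..<e} ?\<gamma>"
      by (intro smooth_on_add sc smooth_on_compose[OF smooth_G]) (use cD in auto)
    moreover have "?\<gamma> t \<in> graph" if "t \<in> {-e<..<e}" for t
      using cD[OF that] by (simp add: graph_def D_add_G G_add_G proj_add proj_G pc)
    moreover have "?\<gamma> 0 = p" using peq by (simp add: c_def G_proj)
    ultimately show "v \<in> tangent_space graph p"
      unfolding tangent_space_def using e by blast
  }
qed

end


section \<open>Phase function and canonical relation of the cone transform\<close>

lemma gderiv_unique:
  assumes "GDERIV f x :> D" "GDERIV f x :> D'"
  shows "D = D'"
proof -
  have "(\<lambda>h. h \<bullet> D) = (\<lambda>h. h \<bullet> D')"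
    using assms unfolding gderiv_def by (rule has_derivative_unique)
  then have "(D - D') \<bullet> D = (D - D') \<bullet> D'" by metis
  then have "(D - D') \<bullet> (D - D') = 0" by (simp only: inner_diff_right)
  then show ?thesis by simp
qed

lemma grad_eq: "GDERIV f x :> D \<Longrightarrow> grad f x = D"
  unfolding grad_def using gderiv_unique by blast

lemma frechet_derivative_eq_inner_grad:
  fixes f :: "'a::euclidean_space \<Rightarrow> real"
  assumes "f differentiable (at x)"
  shows "frechet_derivative f (at x) v = v \<bullet> grad f x"
proof -
  let ?F = "frechet_derivative f (at x)"
  have F: "(f has_derivative ?F) (at x)" using assms frechet_derivative_works by blast
  have lin: "linear ?F" using F has_derivative_linear by blast
  let ?D = "\<Sum>b\<in>Basis. ?F b *\<^sub>R b"
  have "?F h = h \<bullet> ?D" for h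
    by (subst euclidean_representation[of h, symmetric])
      (simp only: linear_sum[OF lin] linear_cmul[OF lin], simp add: inner_sum_right mult.commute)
  then have eq: "?F = (\<lambda>h. h \<bullet> ?D)" by (rule ext)
  then have "GDERIV f x :> ?D" unfolding gderiv_def using F by simp
  then show ?thesis using fun_cong[OF eq, of v] by (simp only: grad_eq)
qed

locale cone_profile =
  fixes q :: "real \<Rightarrow> real"
  assumes continuous_q: "continuous_on {0..} q" and smooth_q: "smooth_on {0<..} q"
    and q_0: "q 0 = 0" and q_pos: "\<And>r. r > 0 \<Longrightarrow> q r > 0"
begin

text \<open>The surface \<open>S(E, x\<^sub>0)\<close> is the graph of this function off the vertex.
  It is kept total: with \<open>y\<close> and \<open>x'\<close> as arguments it is continuous
  wherever it is used, but smooth only where \<open>x'\<close> differs from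
  \<open>snd y\<close>.\<close>

definition height :: "real \<times> 'v::euclidean_space \<Rightarrow> 'v \<Rightarrow> real" where
  "height y x' = fst y * q (norm (x' - snd y))"

lemma q_DERIV: "r > 0 \<Longrightarrow> (q has_real_derivative deriv q r) (at r)"
  using smooth_on_differentiable[OF smooth_q]
  by (simp add: DERIV_deriv_iff_real_differentiable)

lemma height_GDERIV_snd:
  fixes x' :: "'v::euclidean_space"
  assumes "x' \<noteq> snd y"
  shows "GDERIV (height y) x' :> (fst y * deriv q (norm (x' - snd y))) *\<^sub>R sgn (x' - snd y)"
proof -
  have "GDERIV (\<lambda>x'. norm (x' - snd y)) x' :> sgn (x' - snd y)"
    unfolding gderiv_def
    by (rule has_derivative_compose[of "\<lambda>x'. x' - snd y" "\<lambda>h. h" x' UNIV norm "\<lambda>h. h \<bullet> sgn (x' - snd y)"])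
      (use assms in \<open>auto intro!: derivative_eq_intros has_derivative_norm\<close>)
  moreover have "((\<lambda>r. fst y * q r) has_real_derivative fst y * deriv q (norm (x' - snd y))) (at (norm (x' - snd y)))"
    using assms by (intro DERIV_cmult q_DERIV) auto
  ultimately show ?thesis
    unfolding height_def by (rule GDERIV_DERIV_compose)
qed

lemma height_GDERIV_fst:
  fixes x' :: "'v::euclidean_space"
  assumes "x' \<noteq> snd y"
  shows "GDERIV (\<lambda>y. height y x') y :>
    (q (norm (x' - snd y)), - (fst y * deriv q (norm (x' - snd y))) *\<^sub>R sgn (x' - snd y))"
proof -
  have "GDERIV (\<lambda>y. norm (x' - snd y)) y :> (0, - sgn (x' - snd y))"
    unfolding gderiv_def
    by (rule has_derivative_eq_rhs, rule has_derivative_compose[of "\<lambda>y. x' - snd y" "\<lambda>h. - snd h" y UNIV norm "\<lambda>h. h \<bullet> sgn (x' - snd y)"])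
      (use assms in \<open>auto intro!: derivative_eq_intros has_derivative_norm\<close>)
  moreover have "(q has_real_derivative deriv q (norm (x' - snd y))) (at (norm (x' - snd y)))"
    using assms by (intro q_DERIV) auto
  ultimately have "GDERIV (\<lambda>y. q (norm (x' - snd y))) y :> deriv q (norm (x' - snd y)) *\<^sub>R (0, - sgn (x' - snd y))"
    by (rule GDERIV_DERIV_compose)
  moreover have "GDERIV fst y :> (1::real, 0::'v)"
    unfolding gderiv_def by (auto intro!: derivative_eq_intros)
  ultimately show ?thesis
    unfolding height_def using GDERIV_mult by fastforce
qed

lemma smooth_on_height:
  fixes f :: "'a::euclidean_space \<Rightarrow> real \<times> 'v::euclidean_space"
  assumes "open S" "smooth_on S f" "smooth_on S g" "\<And>p. p \<in> S \<Longrightarrow> g p \<noteq> snd (f p)"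
  shows "smooth_on S (\<lambda>p. height (f p) (g p))"
  unfolding height_def
  by (intro smooth_on_mult smooth_on_fst smooth_on_compose[OF smooth_q] smooth_on_norm
      smooth_on_diff smooth_on_snd assms) (use assms in auto)

lemma cone_\<Psi>_eq: "cone_\<Psi> q y x = snd x - height y (fst x)"
  by (cases y; cases x) (simp add: cone_\<Psi>_def height_def)

lemma cone_phase_eq: "cone_phase q p = snd (snd p) * (snd (fst (snd p)) - height (fst p) (fst (fst (snd p))))"
  by (cases p) (simp add: cone_phase_def cone_\<Psi>_eq split: prod.splits)

lemma W_dom_iff: "(y, x) \<in> W_dom \<longleftrightarrow> fst y > 0 \<and> snd x > 0 \<and> fst x \<noteq> snd y"
  by (cases y; cases x) (simp add: W_dom_def)

lemma phase_domain_W: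
  "phase_domain W_dom = {p. fst (fst p) > 0 \<and> snd (fst (snd p)) > 0 \<and> fst (fst (snd p)) \<noteq> snd (fst p) \<and> snd (snd p) \<noteq> 0}"
  unfolding phase_domain_def by (auto simp: W_dom_iff)

lemma d_\<sigma>_cone: "d_\<sigma> (cone_phase q) p = snd (fst (snd p)) - height (fst p) (fst (fst (snd p)))"
proof -
  obtain y x \<sigma> where p: "p = (y, x, \<sigma>)" by (cases p)
  have "GDERIV (\<lambda>\<sigma>'. \<sigma>' * (snd x - height y (fst x))) \<sigma> :> snd x - height y (fst x)"
    unfolding gderiv_deriv by (auto intro!: derivative_eq_intros)
  then show ?thesis
    by (simp add: d_\<sigma>_def p cone_phase_eq grad_eq)
qed

lemma d_y_cone:
  assumes "fst x \<noteq> snd y"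
  shows "d_y (cone_phase q) (y, x, \<sigma>) = (- \<sigma> * q (norm (fst x - snd y)),
      (\<sigma> * fst y * deriv q (norm (fst x - snd y))) *\<^sub>R sgn (fst x - snd y))"
proof -
  have "GDERIV (\<lambda>y. \<sigma> * (snd x - height y (fst x))) y :>
      \<sigma> *\<^sub>R (0 - (q (norm (fst x - snd y)), - (fst y * deriv q (norm (fst x - snd y))) *\<^sub>R sgn (fst x - snd y)))
       + (snd x - height y (fst x)) *\<^sub>R 0"
    by (intro GDERIV_mult GDERIV_diff height_GDERIV_fst assms GDERIV_const)
  then show ?thesis by (simp add: d_y_def cone_phase_eq grad_eq)
qed

lemma d_x_cone:
  fixes x :: "(real^'m) \<times> real"
  assumes "fst x \<noteq> snd y"
  shows "d_x (cone_phase q) (y, x, \<sigma>) =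
      (- (\<sigma> * fst y * deriv q (norm (fst x - snd y))) *\<^sub>R sgn (fst x - snd y), \<sigma>)"
proof -
  have "GDERIV (\<lambda>x. height y (fst x)) x :> ((fst y * deriv q (norm (fst x - snd y))) *\<^sub>R sgn (fst x - snd y), 0)"
    unfolding gderiv_def
    by (rule has_derivative_eq_rhs, rule has_derivative_compose[of fst fst x UNIV "height y",
          OF _ height_GDERIV_snd[OF assms, unfolded gderiv_def]])
      (auto intro!: derivative_eq_intros)
  moreover have "GDERIV snd x :> (0::real^'m, 1::real)" for x :: "(real^'m) \<times> real"
    unfolding gderiv_def by (auto intro!: derivative_eq_intros)
  ultimately have "GDERIV (\<lambda>x. \<sigma> * (snd x - height y (fst x))) x :>
      \<sigma> *\<^sub>R ((0, 1) - ((fst y * deriv q (norm (fst x - snd y))) *\<^sub>R sgn (fst x - snd y), 0))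
       + (snd x - height y (fst x)) *\<^sub>R 0"
    by (intro GDERIV_mult GDERIV_diff GDERIV_const)
  then show ?thesis by (simp add: d_x_def cone_phase_eq grad_eq)
qed

section \<open>Phase function, nondegeneracy and cleanness\<close>

lemma open_phase_domain_W:
  "open (phase_domain (W_dom :: ((real \<times> (real^'m)) \<times> (real^'m) \<times> real) set) ::
     ((real \<times> (real^'m)) \<times> ((real^'m) \<times> real) \<times> real) set)"
  unfolding phase_domain_W
  by (intro open_Collect_conj open_Collect_less open_Collect_neq continuous_intros)

lemma smooth_cone_phase: "smooth_on (phase_domain (W_dom :: ((real \<times> (real^'m)) \<times> (real^'m) \<times> real) set)) (cone_phase q)"
proof -
  have "smooth_on (phase_domain W_dom) (\<lambda>p :: (real \<times> (real^'m)) \<times> ((real^'m) \<times> real) \<times> real.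
     snd (snd p) * (snd (fst (snd p)) - height (fst p) (fst (fst (snd p)))))"
    by (intro smooth_on_mult smooth_on_diff smooth_on_height smooth_on_fst smooth_on_snd
        smooth_on_id open_phase_domain_W)
      (simp add: phase_domain_W)
  then show ?thesis by (simp add: cone_phase_eq[abs_def])
qed

lemma phase_function_cone: "phase_function (W_dom :: ((real \<times> (real^'m)) \<times> (real^'m) \<times> real) set) (cone_phase q)"
  unfolding phase_function_def
proof (intro conjI ballI)
  show "smooth_on (phase_domain W_dom) (cone_phase q)" by (rule smooth_cone_phase)
next
  fix p :: "(real \<times> (real^'m)) \<times> ((real^'m) \<times> real) \<times> real"
  show "case p of (y, x, \<sigma>) \<Rightarrow> \<forall>t>0. cone_phase q (y, x, t *\<^sub>R \<sigma>) = t * cone_phase q (y, x, \<sigma>)"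
    by (auto simp: cone_phase_eq)
next
  fix p :: "(real \<times> (real^'m)) \<times> ((real^'m) \<times> real) \<times> real"
  assume p: "p \<in> phase_domain W_dom"
  \<comment> \<open>The \<open>x\<^sub>n\<close> direction: along it the phase is affine with slope
    \<sigma>, which is nonzero on the phase domain, so the full gradient cannot vanish.\<close>
  let ?v = "(0, (0, 1), 0) :: (real \<times> (real^'m)) \<times> ((real^'m) \<times> real) \<times> real"
  have diff: "cone_phase q differentiable (at p)"
    by (rule smooth_on_differentiable[OF smooth_cone_phase p])
  have "((\<lambda>t. cone_phase q (p + t *\<^sub>R ?v)) has_derivative (\<lambda>t. frechet_derivative (cone_phase q) (at p) (t *\<^sub>R ?v))) (at 0)"
    by (rule has_derivative_compose[where g = "cone_phase q"])
      (use diff frechet_derivative_works in \<open>auto intro!: derivative_eq_intros simp: prod_eq_iff zero_prod_def[symmetric]\<close>)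
  moreover have "((\<lambda>t. cone_phase q (p + t *\<^sub>R ?v)) has_derivative (\<lambda>t. snd (snd p) * t)) (at 0)"
    by (simp add: cone_phase_eq) (auto intro!: derivative_eq_intros)
  ultimately have "(\<lambda>t::real. frechet_derivative (cone_phase q) (at p) (t *\<^sub>R ?v)) = (\<lambda>t. snd (snd p) * t)"
    by (rule has_derivative_unique)
  then have "frechet_derivative (cone_phase q) (at p) ?v = snd (snd p)"
    using fun_cong[of _ _ 1] by fastforce
  then show "grad (cone_phase q) p \<noteq> 0"
    using p by (auto simp: frechet_derivative_eq_inner_grad[OF diff] phase_domain_W)
qed

text \<open>One component of each differential is enough: the \<open>E\<close> component of
  \<open>d_y\<close> is -\<sigma> q(r) and the \<open>x\<^sub>n\<close> component of
  \<open>d_x\<close> is \<sigma>, both nonzero.\<close>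

lemma nondegenerate_cone: "nondegenerate_phase (W_dom :: ((real \<times> (real^'m)) \<times> (real^'m) \<times> real) set) (cone_phase q)"
  unfolding nondegenerate_phase_def
proof
  fix p :: "(real \<times> (real^'m)) \<times> ((real^'m) \<times> real) \<times> real"
  assume p: "p \<in> phase_domain W_dom"
  obtain y x \<sigma> where eq: "p = (y, x, \<sigma>)" by (cases p)
  have "fst x \<noteq> snd y" "\<sigma> \<noteq> 0" using p by (auto simp: phase_domain_W eq)
  moreover from this have "q (norm (fst x - snd y)) \<noteq> 0"
    using q_pos[of "norm (fst x - snd y)"] by simp
  ultimately show "(d_y (cone_phase q) p, d_\<sigma> (cone_phase q) p) \<noteq> 0 \<and> (d_x (cone_phase q) p, d_\<sigma> (cone_phase q) p) \<noteq> 0"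
    unfolding eq by (simp add: d_y_cone d_x_cone prod_eq_iff)
qed

text \<open>The condition \<open>x\<^sub>n > 0\<close> is left out of the domain, which has to be a
  union of fibres in the \<open>x\<^sub>n\<close> direction. On the graph it holds automatically
  because E q(r) is positive.\<close>

lemma smooth_graph_critical:
  "smooth_graph (\<lambda>p. (fst p, (fst (fst (snd p)), 0), snd (snd p)))
    (\<lambda>p. (0, (0, height (fst p) (fst (fst (snd p)))), 0))
    {p :: (real \<times> (real^'m)) \<times> ((real^'m) \<times> real) \<times> real.
      fst (fst p) > 0 \<and> fst (fst (snd p)) \<noteq> snd (fst p) \<and> snd (snd p) \<noteq> 0}"
proof (rule smooth_graph.intro)
  show o: "open {p :: (real \<times> (real^'m)) \<times> ((real^'m) \<times> real) \<times> real.
      fst (fst p) > 0 \<and> fst (fst (snd p)) \<noteq> snd (fst p) \<and> snd (snd p) \<noteq> 0}"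
    by (intro open_Collect_conj open_Collect_less open_Collect_neq continuous_intros)
  show "smooth_on {p :: (real \<times> (real^'m)) \<times> ((real^'m) \<times> real) \<times> real.
      fst (fst p) > 0 \<and> fst (fst (snd p)) \<noteq> snd (fst p) \<and> snd (snd p) \<noteq> 0}
     (\<lambda>p. (0, (0, height (fst p) (fst (fst (snd p)))), 0) :: (real \<times> (real^'m)) \<times> ((real^'m) \<times> real) \<times> real)"
    by (intro smooth_on_Pair smooth_on_const smooth_on_height smooth_on_fst smooth_on_snd smooth_on_id o) auto
  show "bounded_linear (\<lambda>p :: (real \<times> (real^'m)) \<times> ((real^'m) \<times> real) \<times> real. (fst p, (fst (fst (snd p)), 0::real), snd (snd p)))"
    by (intro linear_conv_bounded_linear[THEN iffD1] linearI) (auto simp: prod_eq_iff)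
qed (auto simp: zero_prod_def)

text \<open>Both descriptions of the tangent space reduce to the same scalar equation: the graph
  condition on a vector is nontrivial only in its \<open>x\<^sub>n\<close> slot, and there it says
  that the derivative of \<open>d_\<sigma>\<close>, which is \<open>x\<^sub>n\<close> minus the
  height, annihilates the vector.\<close>

lemma clean_cone: "clean_phase (W_dom :: ((real \<times> (real^'m)) \<times> (real^'m) \<times> real) set) (cone_phase q)"
proof -
  interpret smooth_graph "\<lambda>p. (fst p, (fst (fst (snd p)), 0), snd (snd p))"
    "\<lambda>p. (0, (0, height (fst p) (fst (fst (snd p)))), 0)"
    "{p :: (real \<times> (real^'m)) \<times> ((real^'m) \<times> real) \<times> real.
      fst (fst p) > 0 \<and> fst (fst (snd p)) \<noteq> snd (fst p) \<and> snd (snd p) \<noteq> 0}"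
    by (rule smooth_graph_critical)
  let ?G = "\<lambda>p :: (real \<times> (real^'m)) \<times> ((real^'m) \<times> real) \<times> real. (0, (0, height (fst p) (fst (fst (snd p)))), 0)
     :: (real \<times> (real^'m)) \<times> ((real^'m) \<times> real) \<times> real"
  have pos: "height y x' > 0" if "fst y > 0" "x' \<noteq> snd y" for y :: "real \<times> (real^'m)" and x'
    using that q_pos[of "norm (x' - snd y)"] by (simp add: height_def)
  have crit: "critical_set W_dom (cone_phase q) = graph"
    unfolding critical_set_def graph_def phase_domain_W d_\<sigma>_cone
    using pos by (auto simp: prod_eq_iff)
  have "tangent_space graph p = {v. frechet_derivative (d_\<sigma> (cone_phase q)) (at p) v = 0}" if p: "p \<in> graph" for p
  proof -
    have pD: "fst (fst p) > 0 \<and> fst (fst (snd p)) \<noteq> snd (fst p) \<and> snd (snd p) \<noteq> 0"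
      using p by (simp add: graph_def)
    define G' where "G' = frechet_derivative ?G (at p)"
    have G': "(?G has_derivative G') (at p)"
      unfolding G'_def using has_derivative_G pD by simp
    have h': "((\<lambda>p. height (fst p) (fst (fst (snd p)))) has_derivative (\<lambda>v. snd (fst (snd (G' v))))) (at p)"
      using has_derivative_snd[OF has_derivative_fst[OF has_derivative_snd[OF G']]] by simp
    have "(?G has_derivative (\<lambda>v. (0, (0, snd (fst (snd (G' v)))), 0))) (at p)"
      by (intro has_derivative_Pair has_derivative_const h')
    then have "G' = (\<lambda>v. (0, (0, snd (fst (snd (G' v)))), 0))"
      using G' has_derivative_unique by blast
    then have eq: "G' v = (0, (0, snd (fst (snd (G' v)))), 0)" for v by (rule fun_cong)
    have tangent_iff: "v = (fst v, (fst (fst (snd v)), 0), snd (snd v)) + G' v \<longleftrightarrow>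
        snd (fst (snd v)) - snd (fst (snd (G' v))) = 0" for v
      by (subst eq) (auto simp: prod_eq_iff)
    have "(d_\<sigma> (cone_phase q) has_derivative (\<lambda>v. snd (fst (snd v)) - snd (fst (snd (G' v))))) (at p)"
      unfolding d_\<sigma>_cone[abs_def]
      by (intro has_derivative_diff h') (auto intro!: derivative_eq_intros)
    then have fd: "frechet_derivative (d_\<sigma> (cone_phase q)) (at p) = (\<lambda>v. snd (fst (snd v)) - snd (fst (snd (G' v))))"
      by (rule frechet_derivative_at[symmetric])
    show ?thesis
      unfolding tangent_space_graph[OF p] fd G'_def[symmetric]
      by (simp only: tangent_iff)
  qed
  then show ?thesis
    unfolding clean_phase_def crit using smooth_submanifold_graph by blast
qed


section \<open>The canonical relation and its parametrisation\<close>

type_synonym 'm cotangent_pair = "((real \<times> (real^'m)) \<times> (real \<times> (real^'m))) \<times> (((real^'m) \<times> real) \<times> ((real^'m) \<times> real))"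

text \<open>
  The canonical relation is a graph over \<open>(E, x\<^sub>0, x', s)\<close>, where \<open>s = - \<sigma>\<close> is the last cotangent
  component at \<open>x\<close>.
\<close>

definition canonical_domain :: "'m::finite cotangent_pair set" where
  "canonical_domain = {p. fst (fst (fst p)) > 0 \<and> fst (fst (snd p)) \<noteq> snd (fst (fst p)) \<and> snd (snd (snd p)) \<noteq> 0}"

definition canonical_proj :: "'m::finite cotangent_pair \<Rightarrow> 'm cotangent_pair" where
  "canonical_proj p = ((fst (fst p), 0), ((fst (fst (snd p)), 0), (0, snd (snd (snd p)))))"

text \<open>The \<open>x'\<close> component of the covector at \<open>x\<close>, with \<sigma> = -s
  inserted. It equals the \<open>x\<^sub>0\<close> component of the covector at \<open>y\<close>,
  because the phase depends on \<open>x'\<close> and \<open>x\<^sub>0\<close> only through their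
  difference and one of the two differentials carries a minus sign. Hence it occurs twice in
  \<open>canonical_map\<close>.\<close>

definition conormal_x' :: "'m::finite cotangent_pair \<Rightarrow> real^'m" where
  "conormal_x' p = - ((snd (snd (snd p)) * fst (fst (fst p)) * deriv q (norm (fst (fst (snd p)) - snd (fst (fst p)))))
     *\<^sub>R sgn (fst (fst (snd p)) - snd (fst (fst p))))"

definition canonical_map :: "'m::finite cotangent_pair \<Rightarrow> 'm cotangent_pair" where
  "canonical_map p =
    ((0, (snd (snd (snd p)) * q (norm (fst (fst (snd p)) - snd (fst (fst p)))), conormal_x' p)),
     ((0, height (fst (fst p)) (fst (fst (snd p)))), (conormal_x' p, 0)))"

lemma open_canonical_domain: "open canonical_domain"
  unfolding canonical_domain_def
  by (intro open_Collect_conj open_Collect_less open_Collect_neq continuous_intros)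

lemma smooth_graph_canonical: "smooth_graph canonical_proj canonical_map (canonical_domain :: 'm::finite cotangent_pair set)"
proof (rule smooth_graph.intro)
  show "open (canonical_domain :: 'm cotangent_pair set)" by (rule open_canonical_domain)
  show "bounded_linear (canonical_proj :: 'm cotangent_pair \<Rightarrow> _)"
    unfolding canonical_proj_def[abs_def]
    by (intro linear_conv_bounded_linear[THEN iffD1] linearI) (auto simp: prod_eq_iff)
  show "smooth_on (canonical_domain :: 'm cotangent_pair set) canonical_map"
    unfolding canonical_map_def[abs_def] conormal_x'_def sgn_div_norm divide_inverse_commute
    by (intro smooth_on_Pair smooth_on_const smooth_on_height smooth_on_fst smooth_on_snd smooth_on_id
      smooth_on_minus smooth_on_scaleR smooth_on_mult smooth_on_compose[OF smooth_on_inverse]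
      smooth_on_compose[OF smooth_on_deriv[OF open_greaterThan smooth_q]] smooth_on_compose[OF smooth_q]
      smooth_on_norm smooth_on_diff open_canonical_domain) (auto simp: canonical_domain_def)
qed (auto simp: canonical_domain_def canonical_proj_def canonical_map_def conormal_x'_def zero_prod_def)

lemma canonical_relation_eq:
  "canonical_relation (W_dom :: ((real \<times> (real^'m)) \<times> (real^'m) \<times> real) set) (cone_phase q) =
    smooth_graph.graph canonical_proj canonical_map canonical_domain" (is "?C = _")
proof -
  interpret smooth_graph canonical_proj canonical_map "canonical_domain :: 'm cotangent_pair set"
    by (rule smooth_graph_canonical)
  have pos: "height y x' > 0" if "fst y > 0" "x' \<noteq> snd y" for y :: "real \<times> (real^'m)" and x'
    using that q_pos[of "norm (x' - snd y)"] by (simp add: height_def)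
  have "p \<in> ?C \<longleftrightarrow> p \<in> graph" for p
  proof
    assume "p \<in> ?C"
    then obtain y x \<sigma> where p: "p = ((y, d_y (cone_phase q) (y, x, \<sigma>)), (x, - d_x (cone_phase q) (y, x, \<sigma>)))"
      and c: "(y, x, \<sigma>) \<in> critical_set W_dom (cone_phase q)"
      unfolding canonical_relation_def by blast
    show "p \<in> graph"
      using c unfolding critical_set_def phase_domain_W d_\<sigma>_cone graph_def p
      by (simp add: d_y_cone d_x_cone canonical_domain_def canonical_proj_def canonical_map_def
          conormal_x'_def prod_eq_iff)
  next
    assume "p \<in> graph"
    then have D: "p \<in> canonical_domain" and eq: "p = canonical_proj p + canonical_map p" by (auto simp: graph_def)
    obtain E x\<^sub>0 a b x' xn c s where p: "p = (((E, x\<^sub>0), (a, b)), ((x', xn), (c, s)))"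
      by (metis prod.collapse)
    \<comment> \<open>The frequency is recovered from the last covector component: -d_x has
      \<open>x\<^sub>n\<close> entry -\<sigma>, so \<sigma> = -s.\<close>
    have "((E, x\<^sub>0), (x', xn), - s) \<in> critical_set W_dom (cone_phase q)"
      using D eq pos[of "(E, x\<^sub>0)" x'] unfolding critical_set_def phase_domain_W d_\<sigma>_cone p
      by (simp add: canonical_domain_def canonical_proj_def canonical_map_def)
    moreover have "p = (((E, x\<^sub>0), d_y (cone_phase q) ((E, x\<^sub>0), (x', xn), - s)),
       ((x', xn), - d_x (cone_phase q) ((E, x\<^sub>0), (x', xn), - s)))"
      using D eq unfolding p by (simp add: d_y_cone d_x_cone canonical_domain_def canonical_proj_def canonical_map_def
          conormal_x'_def)
    ultimately show "p \<in> ?C" unfolding canonical_relation_def by blast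
  qed
  then show ?thesis by blast
qed

lemma mem_canonical_relation:
  "(((E, x\<^sub>0), (a, b)), ((x', xn), (c, s))) \<in> canonical_relation (W_dom :: ((real \<times> (real^'m)) \<times> (real^'m) \<times> real) set) (cone_phase q) \<longleftrightarrow>
    E > 0 \<and> x' \<noteq> x\<^sub>0 \<and> s \<noteq> 0 \<and> a = s * q (norm (x' - x\<^sub>0)) \<and>
    b = - ((s * E * deriv q (norm (x' - x\<^sub>0))) *\<^sub>R sgn (x' - x\<^sub>0)) \<and>
    xn = E * q (norm (x' - x\<^sub>0)) \<and> c = b"
proof -
  interpret smooth_graph canonical_proj canonical_map "canonical_domain :: 'm cotangent_pair set"
    by (rule smooth_graph_canonical)
  show ?thesis unfolding canonical_relation_eq graph_def
    by (auto simp: canonical_domain_def canonical_proj_def canonical_map_def conormal_x'_def height_def)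
qed

text \<open>
  On the canonical relation, the covector at \<open>y\<close> determines \<open>g r\<close>, and together with \<open>r\<close> it
  determines everything else.
\<close>

definition slope_sq :: "(real \<times> (real^'m)) \<times> (real \<times> (real^'m)) \<Rightarrow> real" where
  "slope_sq u = (snd (snd u) \<bullet> snd (snd u)) / (fst (snd u) * fst (fst u))\<^sup>2"

text \<open>With a = s q(r) and b = -(s E q'(r)) times the unit vector of
  \<open>x' - x\<^sub>0\<close>, the vector (r q(r) / (a E q'(r))) b is the negative of
  \<open>x' - x\<^sub>0\<close>; this explains the first slot. The last slot solves a = s q(r) for
  s.\<close>

definition recover :: "(real \<times> (real^'m)) \<times> (real \<times> (real^'m)) \<Rightarrow> real \<Rightarrow> ((real^'m) \<times> real) \<times> ((real^'m) \<times> real)" where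
  "recover u r =
    ((snd (fst u) - (r * q r / (fst (snd u) * fst (fst u) * deriv q r)) *\<^sub>R snd (snd u), fst (fst u) * q r),
     (snd (snd u), fst (snd u) / q r))"

text \<open>Squaring turns the quotient of \<open>norm b\<close> by \<open>\<bar>a\<bar> E\<close>
  into a rational expression, so smoothness asks only for \<open>a\<close> and \<open>E\<close> to
  be nonzero.\<close>

lemma smooth_on_slope_sq: "smooth_on {u. fst (snd u) \<noteq> 0 \<and> fst (fst u) \<noteq> 0} slope_sq"
  unfolding slope_sq_def[abs_def]
  by (intro smooth_on_divide smooth_on_inner smooth_on_power smooth_on_mult smooth_on_fst smooth_on_snd
      smooth_on_id open_Collect_conj open_Collect_neq continuous_intros) auto

lemma smooth_on_recover:
  "smooth_on {z :: ((real \<times> (real^'m)) \<times> (real \<times> (real^'m))) \<times> real. fst (snd (fst z)) \<noteq> 0 \<and> fst (fst (fst z)) \<noteq> 0 \<and> snd z \<in> {r. 0 < r \<and> deriv q r \<noteq> 0}}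
     (\<lambda>z. recover (fst z) (snd z))"
proof -
  \<comment> \<open>Smoothness is tested on open sets; continuity of \<open>deriv q\<close> makes
    the set of admissible radii open.\<close>
  have "continuous_on {0<..} (deriv q)"
    by (intro smooth_on_imp_continuous_on smooth_on_deriv smooth_q open_greaterThan)
  then have "open ({0<..} \<inter> deriv q -` (- {0}))"
    by (rule continuous_open_preimage) auto
  also have "{0<..} \<inter> deriv q -` (- {0}) = {r. 0 < r \<and> deriv q r \<noteq> 0}" by auto
  finally have "open (snd -` {r. 0 < r \<and> deriv q r \<noteq> 0})" by (rule open_vimage_snd)
  then have o_r: "open {z :: ((real \<times> (real^'m)) \<times> (real \<times> (real^'m))) \<times> real. snd z \<in> {r. 0 < r \<and> deriv q r \<noteq> 0}}" by (simp add: vimage_def)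
  have o: "open {z :: ((real \<times> (real^'m)) \<times> (real \<times> (real^'m))) \<times> real. fst (snd (fst z)) \<noteq> 0 \<and> fst (fst (fst z)) \<noteq> 0 \<and> snd z \<in> {r. 0 < r \<and> deriv q r \<noteq> 0}}"
    by (intro open_Collect_conj open_Collect_neq continuous_intros o_r)
  show ?thesis
    unfolding recover_def
    by (intro smooth_on_Pair smooth_on_diff smooth_on_scaleR smooth_on_divide smooth_on_mult smooth_on_fst smooth_on_snd
        smooth_on_id smooth_on_compose[OF smooth_on_deriv[OF open_greaterThan smooth_q]] smooth_on_compose[OF smooth_q] o)
      (auto simp: q_pos less_imp_neq[symmetric])
qed

text \<open>Splits the inverse of the projection in two: the covector yields the square of
  \<open>g r\<close>, and covector and radius together yield the rest. Both halves serve twice, as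
  equations between points for injectivity and as equations along curves for immersivity.\<close>

lemma canonical_relation_recover:
  fixes p :: "'m::finite cotangent_pair"
  assumes p: "p \<in> canonical_relation W_dom (cone_phase q)"
    and q': "\<forall>r>0. deriv q r > 0"
    and r: "r = norm (fst (fst (snd p)) - snd (fst (fst p)))"
  shows "r > 0" "fst (snd (fst p)) \<noteq> 0" "fst (fst (fst p)) > 0"
    "(deriv q r / q r)\<^sup>2 = slope_sq (fst p)" "snd p = recover (fst p) r"
proof -
  obtain E x\<^sub>0 a b x' xn c s where eq: "p = (((E, x\<^sub>0), (a, b)), ((x', xn), (c, s)))"
    by (metis prod.collapse)
  note m = p[unfolded eq mem_canonical_relation]
  have r': "r = norm (x' - x\<^sub>0)" using r eq by simp
  have *: "r > 0" "q r > 0" "deriv q r > 0" "E > 0" "s \<noteq> 0" "norm (sgn (x' - x\<^sub>0)) = 1" "r *\<^sub>R sgn (x' - x\<^sub>0) = x' - x\<^sub>0"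
    using m q_pos q' r' by (auto simp: norm_sgn sgn_div_norm)
  show "r > 0" "fst (snd (fst p)) \<noteq> 0" "fst (fst (fst p)) > 0" using * m by (auto simp: eq r')
  have "sgn (x' - x\<^sub>0) \<bullet> sgn (x' - x\<^sub>0) = 1" using * by (simp add: norm_eq_1)
  then have "slope_sq (fst p) = (s * E * deriv q r)\<^sup>2 / (s * q r * E)\<^sup>2"
    using m by (simp add: slope_sq_def eq r' power2_eq_square)
  then show "(deriv q r / q r)\<^sup>2 = slope_sq (fst p)"
    using * by (simp add: power_divide power_mult_distrib)
  have "(r * q r / (a * E * deriv q r)) *\<^sub>R b = - (r *\<^sub>R sgn (x' - x\<^sub>0))"
    using m * by (simp add: r')
  then show "snd p = recover (fst p) r"
    using m * by (simp add: recover_def eq r')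
qed

section \<open>The Bolker condition and the derivative of g\<close>

lemma Bolker_imp_deriv_nonzero:
  assumes B: "semi_global_Bolker (canonical_relation (W_dom :: ((real \<times> (real^'m)) \<times> (real^'m) \<times> real) set) (cone_phase q))"
    and r: "r > 0"
  shows "deriv (\<lambda>r. deriv q r / q r) r \<noteq> 0"
proof
  let ?g = "\<lambda>r. deriv q r / q r"
  let ?C = "canonical_relation (W_dom :: ((real \<times> (real^'m)) \<times> (real^'m) \<times> real) set) (cone_phase q)"
  assume zero: "deriv ?g r = 0"
  obtain \<theta> :: "real^'m" where \<theta>: "norm \<theta> = 1" using vector_choose_size[of 1] by auto
  \<comment> \<open>Here E = 1, \<open>x\<^sub>0\<close> = 0 and x' = (r + t) \<theta>. The choice s
    = 1 / q(r + t) normalises \<open>a\<close> to 1, so the only moving entry of the projection is b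
    = -g(r + t) \<theta>.\<close>
  define \<gamma> :: "real \<Rightarrow> 'm cotangent_pair" where
    "\<gamma> t = (((1, 0), (1, - (?g (r + t) *\<^sub>R \<theta>))), (((r + t) *\<^sub>R \<theta>, q (r + t)), (- (?g (r + t) *\<^sub>R \<theta>), 1 / q (r + t))))" for t
  have C: "\<gamma> t \<in> ?C" if "t \<in> {-r<..<r}" for t
  proof -
    have "r + t > 0" using that by simp
    moreover from this have "q (r + t) > 0" by (rule q_pos)
    moreover have "sgn ((r + t) *\<^sub>R \<theta>) = \<theta>" using \<open>r + t > 0\<close> \<theta> by (simp add: sgn_div_norm)
    ultimately show ?thesis
      unfolding \<gamma>_def mem_canonical_relation using \<theta> by auto
  qed
  have nz: "q x \<noteq> 0" if "x > 0" for x using q_pos[OF that] by simp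
  have sm: "smooth_on {-r<..<r} \<gamma>"
    unfolding \<gamma>_def
    by (intro smooth_on_Pair smooth_on_const smooth_on_minus smooth_on_scaleR smooth_on_divide smooth_on_add
        smooth_on_id smooth_on_compose[OF smooth_q] smooth_on_compose[OF smooth_on_deriv[OF open_greaterThan smooth_q]])
      (auto simp: nz)
  then have "(\<gamma> has_vector_derivative vector_derivative \<gamma> (at 0)) (at 0)"
    using smooth_on_differentiable[OF sm, of 0] r by (simp add: vector_derivative_works)
  then obtain v where v: "(\<gamma> has_vector_derivative v) (at 0)" ..
  then have "v \<in> tangent_space ?C (\<gamma> 0)"
    unfolding tangent_space_def using r C sm by blast
  moreover have "frechet_derivative fst (at p) = fst" for p :: "'m cotangent_pair"
    using bounded_linear_imp_has_derivative[OF bounded_linear_fst] frechet_derivative_at by metis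
  ultimately have "fst v = 0 \<longrightarrow> v = 0"
    using B C[of 0] r unfolding semi_global_Bolker_def immersion_on_def by simp
  moreover have "fst v = 0"
  proof -
    have "smooth_on {0<..} ?g"
      by (intro smooth_on_divide smooth_on_deriv smooth_q) (auto simp: nz)
    then have "(?g has_real_derivative 0) (at r)"
      using smooth_on_differentiable[of _ ?g r] r DERIV_deriv_iff_real_differentiable[of ?g r] zero by auto
    then have "((\<lambda>t. ?g (r + t)) has_real_derivative 0) (at 0)"
      using DERIV_shift[of ?g 0 0 r] by (simp add: add.commute)
    then have "((\<lambda>t. ?g (r + t) *\<^sub>R \<theta>) has_vector_derivative 0 *\<^sub>R \<theta>) (at 0)"
      by (intro bounded_linear.has_vector_derivative[OF bounded_linear_scaleR_left])
        (simp add: has_real_derivative_iff_has_vector_derivative)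
    then have "((\<lambda>t. fst (\<gamma> t)) has_vector_derivative ((0, 0), (0, - (0 *\<^sub>R \<theta>)))) (at 0)"
      unfolding \<gamma>_def fst_conv
      by (intro has_vector_derivative_Pair has_vector_derivative_const has_vector_derivative_minus)
    moreover have "((\<lambda>t. fst (\<gamma> t)) has_vector_derivative fst v) (at 0)"
      by (rule bounded_linear.has_vector_derivative[OF bounded_linear_fst v])
    ultimately have "fst v = ((0, 0), (0, - (0 *\<^sub>R \<theta>)))" by (metis vector_derivative_at)
    then show ?thesis by (simp add: zero_prod_def)
  qed
  \<comment> \<open>The point \<open>x'\<close> moves with unit speed, so \<open>v\<close> is a
    nonzero tangent vector although its projection vanishes.\<close>
  moreover have "fst (fst (snd v)) = \<theta>"
  proof -
    have "((\<lambda>t. fst (fst (snd (\<gamma> t)))) has_vector_derivative \<theta>) (at 0)"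
      unfolding \<gamma>_def by (auto intro!: derivative_eq_intros)
    moreover have "((\<lambda>t. fst (fst (snd (\<gamma> t)))) has_vector_derivative fst (fst (snd v))) (at 0)"
      by (intro bounded_linear.has_vector_derivative[OF bounded_linear_fst]
          bounded_linear.has_vector_derivative[OF bounded_linear_snd] v)
    ultimately show ?thesis by (metis vector_derivative_at)
  qed
  ultimately show False using \<theta> by auto
qed

text \<open>Injectivity and immersivity have the same two stages: first the radius is controlled
  through \<open>slope_sq\<close>, then everything else through \<open>recover\<close>. For points
  the first stage uses injectivity of \<open>g\<close>, for tangent vectors it uses
  \<open>g' \<noteq> 0\<close> at a single radius.\<close>

lemma deriv_nonzero_imp_Bolker:
  assumes q': "\<forall>r>0. deriv q r > 0"
    and g': "\<And>r. r > 0 \<Longrightarrow> deriv (\<lambda>r. deriv q r / q r) r \<noteq> 0"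
  shows "semi_global_Bolker (canonical_relation (W_dom :: ((real \<times> (real^'m)) \<times> (real^'m) \<times> real) set) (cone_phase q))"
proof -
  let ?g = "\<lambda>r. deriv q r / q r"
  let ?C = "canonical_relation (W_dom :: ((real \<times> (real^'m)) \<times> (real^'m) \<times> real) set) (cone_phase q)"
  let ?r = "\<lambda>p :: 'm cotangent_pair. norm (fst (fst (snd p)) - snd (fst (fst p)))"
  have nz: "q x \<noteq> 0" "deriv q x \<noteq> 0" if "x > 0" for x using q_pos[OF that] q'[rule_format, OF that] by simp_all
  have "smooth_on {0<..} ?g"
    by (intro smooth_on_divide smooth_on_deriv smooth_q) (auto simp: nz)
  then have dg: "(?g has_real_derivative deriv ?g r) (at r)" if "r > 0" for r
    using smooth_on_differentiable[of _ ?g r] that DERIV_deriv_iff_real_differentiable[of ?g r] by auto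
  have no_eq: False if "0 < a" "a < b" "?g a = ?g b" for a b
  proof -
    have "\<exists>z. a < z \<and> z < b \<and> (\<lambda>h. deriv ?g z * h) = (\<lambda>v. 0)"
    proof (rule Rolle_deriv[OF that(2,3)])
      show "continuous_on {a..b} ?g"
        by (rule DERIV_continuous_on[where D = "deriv ?g"]) (use dg that in \<open>auto intro: has_field_derivative_at_within\<close>)
      show "(?g has_derivative (\<lambda>h. deriv ?g z * h)) (at z)" if "a < z" "z < b" for z
        using dg[of z] that \<open>0 < a\<close> unfolding has_field_derivative_def by auto
    qed
    then obtain z where "a < z" "deriv ?g z * 1 = 0" by metis
    then show False using g'[of z] that(1) by simp
  qed
  then have inj_g: "a = b" if "a > 0" "b > 0" "?g a = ?g b" for a b
    using that by (metis linorder_neqE_linordered_idom)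
  have "inj_on fst ?C"
  proof (rule inj_onI)
    fix p p' assume p: "p \<in> ?C" "p' \<in> ?C" "fst p = fst p'"
    note 1 = canonical_relation_recover[OF p(1) q' refl]
    note 2 = canonical_relation_recover[OF p(2) q' refl]
    have "(?g (?r p))\<^sup>2 = (?g (?r p'))\<^sup>2" using 1(4) 2(4) p(3) by simp
    \<comment> \<open>Only the squares are known to agree; positivity removes the ambiguity of
      sign.\<close>
    moreover have "?g (?r p) > 0" "?g (?r p') > 0" using q' q_pos 1(1) 2(1) by auto
    ultimately have "?g (?r p) = ?g (?r p')" by (simp add: power2_eq_iff_nonneg)
    then have "?r p = ?r p'" by (rule inj_g[OF 1(1) 2(1)])
    then have "snd p = snd p'" using 1(5) 2(5) p(3) by simp
    then show "p = p'" using p(3) by (simp add: prod_eq_iff)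
  qed
  moreover have "immersion_on ?C fst"
    unfolding immersion_on_def
  proof (intro conjI ballI impI)
    interpret smooth_graph canonical_proj canonical_map "canonical_domain :: 'm cotangent_pair set"
      by (rule smooth_graph_canonical)
    show "\<exists>d. smooth_submanifold d ?C"
      unfolding canonical_relation_eq using smooth_submanifold_graph by blast
    show "\<exists>U. open U \<and> ?C \<subseteq> U \<and> smooth_on U (fst :: 'm cotangent_pair \<Rightarrow> _)"
      using smooth_on_linear[OF bounded_linear_fst open_UNIV] by blast
    fix p v assume p: "p \<in> ?C" and v: "v \<in> tangent_space ?C p" and "frechet_derivative fst (at p) v = 0"
    moreover have "frechet_derivative fst (at p) = fst"
      using bounded_linear_imp_has_derivative[OF bounded_linear_fst] frechet_derivative_at by metis
    ultimately have v0: "fst v = 0" by simp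
    obtain \<gamma> e where e: "e > 0" and \<gamma>C: "\<And>t. t \<in> {-e<..<e} \<Longrightarrow> \<gamma> t \<in> ?C" and \<gamma>0: "\<gamma> 0 = p"
      and d\<gamma>: "(\<gamma> has_vector_derivative v) (at (0::real))"
      using v unfolding tangent_space_def by blast
    define u where "u t = fst (\<gamma> t)" for t
    define r where "r t = ?r (\<gamma> t)" for t
    note rec = canonical_relation_recover[OF p q' refl]
    have du: "(u has_derivative (\<lambda>h. 0)) (at 0)"
      using bounded_linear.has_vector_derivative[OF bounded_linear_fst d\<gamma>] v0
      by (simp add: u_def[abs_def] has_vector_derivative_def)
    have r0: "r 0 > 0" using rec(1) by (simp add: r_def \<gamma>0)
    have K: "(?g (r t))\<^sup>2 = slope_sq (u t)" and H: "snd (\<gamma> t) = recover (u t) (r t)" if "t \<in> {-e<..<e}" for t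
      using canonical_relation_recover(4,5)[OF \<gamma>C[OF that] q' refl] by (simp_all add: u_def r_def)
    have "((\<lambda>t. fst (fst (snd (\<gamma> t))) - snd (fst (fst (\<gamma> t)))) has_derivative
        (\<lambda>h. fst (fst (snd (h *\<^sub>R v))) - snd (fst (fst (h *\<^sub>R v))))) (at 0)"
      using d\<gamma> unfolding has_vector_derivative_def
      by (intro has_derivative_diff has_derivative_fst has_derivative_snd)
    then have "((\<lambda>t. norm (fst (fst (snd (\<gamma> t))) - snd (fst (fst (\<gamma> t))))) has_derivative
        (\<lambda>h. (fst (fst (snd (h *\<^sub>R v))) - snd (fst (fst (h *\<^sub>R v)))) \<bullet>
          sgn (fst (fst (snd (\<gamma> 0))) - snd (fst (fst (\<gamma> 0)))))) (at 0)"
      by (rule has_derivative_compose[OF _ has_derivative_norm]) (use r0 in \<open>auto simp: r_def\<close>)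
    \<comment> \<open>The norm is differentiated away from its zero, since
      \<open>r 0 > 0\<close>.\<close>
    then have "r differentiable (at 0)"
      unfolding r_def[abs_def] differentiable_def by blast
    then obtain \<rho> where dr: "(r has_real_derivative \<rho>) (at 0)"
      using real_differentiableE by blast
    \<comment> \<open>Two computations of one derivative: the chain rule gives 2 g g' times the
      speed of the radius, while \<open>slope_sq (u t)\<close> has derivative 0 because
      \<open>u\<close> is stationary. As g and g' are nonzero, the radius is stationary too.\<close>
    have "((\<lambda>t. (?g (r t))\<^sup>2) has_real_derivative 2 * ?g (r 0) * (deriv ?g (r 0) * \<rho>)) (at 0)"
      using DERIV_power[OF DERIV_chain2[OF dg[OF r0] dr], of 2] by (simp add: mult_ac)
    moreover have "((\<lambda>t. (?g (r t))\<^sup>2) has_real_derivative 0) (at 0)"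
    proof -
      have "slope_sq differentiable (at (u 0))"
        using rec(2,3) by (intro smooth_on_differentiable[OF smooth_on_slope_sq]) (auto simp: u_def \<gamma>0)
      then obtain K' where K': "(slope_sq has_derivative K') (at (u 0))" by (auto simp: differentiable_def)
      have "((\<lambda>t. slope_sq (u t)) has_derivative (\<lambda>h. K' 0)) (at 0)"
        by (rule has_derivative_compose[OF du K'])
      then have "((\<lambda>t. slope_sq (u t)) has_real_derivative 0) (at 0)"
        using linear_0[OF has_derivative_linear[OF K']] by (simp add: has_field_derivative_def lambda_zero)
      moreover have "\<forall>\<^sub>F t in nhds 0. t \<in> {-e<..<e}" using e by (intro eventually_nhds_in_open) auto
      then have "\<forall>\<^sub>F t in nhds 0. slope_sq (u t) = (?g (r t))\<^sup>2" by eventually_elim (use K in auto)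
      ultimately show ?thesis by (subst (asm) DERIV_cong_ev) auto
    qed
    ultimately have "2 * ?g (r 0) * (deriv ?g (r 0) * \<rho>) = 0" by (rule DERIV_unique)
    then have "\<rho> = 0" using g'[OF r0] nz[OF r0] by simp
    then have dur: "((\<lambda>t. (u t, r t)) has_derivative (\<lambda>h. 0)) (at 0)"
      using has_derivative_Pair[OF du] dr by (fastforce simp: has_field_derivative_def lambda_zero zero_prod_def)
    have "(\<lambda>z. recover (fst z) (snd z)) differentiable (at (u 0, r 0))"
      using rec(2,3) r0 q'
      by (intro smooth_on_differentiable[OF smooth_on_recover]) (auto simp: u_def \<gamma>0 less_imp_neq[symmetric])
    then obtain H' where H': "((\<lambda>z. recover (fst z) (snd z)) has_derivative H') (at (u 0, r 0))"
      by (auto simp: differentiable_def)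
    have "((\<lambda>t. recover (u t) (r t)) has_derivative (\<lambda>h. H' 0)) (at 0)"
      using has_derivative_compose[OF dur H'] by simp
    then have "((\<lambda>t. recover (u t) (r t)) has_vector_derivative 0) (at 0)"
      using linear_0[OF has_derivative_linear[OF H']] by (simp add: has_vector_derivative_def)
    then have "((\<lambda>t. snd (\<gamma> t)) has_vector_derivative 0) (at 0)"
      by (rule has_vector_derivative_transform_within_open[of _ _ _ "{-e<..<e}"]) (use e H in auto)
    moreover have "((\<lambda>t. snd (\<gamma> t)) has_vector_derivative snd v) (at 0)"
      by (rule bounded_linear.has_vector_derivative[OF bounded_linear_snd d\<gamma>])
    ultimately have "snd v = 0" by (metis vector_derivative_at)
    with v0 show "v = 0" by (simp add: prod_eq_iff)
  qed
  ultimately show ?thesis by (simp add: semi_global_Bolker_def)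
qed

end

section \<open>Integrals of compactly supported functions\<close>

lemma integral_compact_support:
  fixes f :: "'a::euclidean_space \<Rightarrow> 'b::{banach, second_countable_topology}"
  assumes "compact K" "continuous_on K f" "\<And>x. x \<notin> K \<Longrightarrow> f x = 0"
  shows "integrable lborel f"
proof -
  have "f = (\<lambda>x. indicator K x *\<^sub>R f x)"
    using assms(3) by (auto simp: indicator_def)
  then show ?thesis using borel_integrable_compact[OF assms(1,2)] by simp
qed

lemma integrable_lborel_prod:
  fixes f :: "'a::euclidean_space \<times> 'b::euclidean_space \<Rightarrow> 'c::{banach, second_countable_topology}"
  assumes "integrable lborel f"
  shows "integrable lborel (\<lambda>x. LINT y|lborel. f (x, y))"
    and "(LINT p|lborel. f p) = (LINT x|lborel. LINT y|lborel. f (x, y))"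
  using lborel_pair.integrable_fst'[of f] lborel_pair.integral_fst'[of f] assms by (simp_all add: lborel_prod)

lemma integral_derivative_compact_support:
  fixes F :: "real \<Rightarrow> complex"
  assumes "\<And>x. (F has_vector_derivative F' x) (at x)" "continuous_on UNIV F'"
    and "a \<le> b" "\<And>x. x \<notin> {a<..<b} \<Longrightarrow> F x = 0" "\<And>x. x \<notin> {a..b} \<Longrightarrow> F' x = 0"
  shows "(LINT x|lborel. F' x) = 0"
proof -
  have "F' = (\<lambda>x. indicator {a..b} x *\<^sub>R F' x)" using assms(5) by (auto simp: indicator_def)
  moreover have "(LINT x|lborel. indicator {a..b} x *\<^sub>R F' x) = F b - F a"
    using assms by (intro integral_FTC_atLeastAtMost)
      (auto intro: has_vector_derivative_at_within continuous_on_subset)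
  ultimately show ?thesis using assms(4)[of a] assms(4)[of b] by simp
qed

lemma has_vector_derivative_exp_i:
  "((\<lambda>\<sigma>. exp (\<i> * complex_of_real (\<sigma> * s))) has_vector_derivative
     \<i> * complex_of_real s * exp (\<i> * complex_of_real (\<sigma> * s))) (at \<sigma>)"
proof -
  have "((\<lambda>z. exp (\<i> * (z * complex_of_real s))) has_field_derivative
     \<i> * complex_of_real s * exp (\<i> * (complex_of_real \<sigma> * complex_of_real s))) (at (complex_of_real \<sigma>))"
    by (auto intro!: derivative_eq_intros)
  from has_vector_derivative_real_field[OF this] show ?thesis by simp
qed

section \<open>Fourier inversion at the origin\<close>

text \<open>Two derivatives are carried along because two integrations by parts give decay like 1 /
  (1 + s^2), which is integrable. Vanishing off the open interval includes the end points, so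
  boundary terms at -N and N disappear.\<close>

locale fourier_bump =
  fixes \<rho> \<rho>1 \<rho>2 :: "real \<Rightarrow> complex" and N :: real
  assumes N: "N > 0"
    and d1: "\<And>x. (\<rho> has_vector_derivative \<rho>1 x) (at x)" and d2: "\<And>x. (\<rho>1 has_vector_derivative \<rho>2 x) (at x)"
    and cont2: "continuous_on UNIV \<rho>2"
    and supp: "\<And>x. x \<notin> {-N<..<N} \<Longrightarrow> \<rho> x = 0" "\<And>x. x \<notin> {-N<..<N} \<Longrightarrow> \<rho>1 x = 0" "\<And>x. x \<notin> {-N<..<N} \<Longrightarrow> \<rho>2 x = 0"
begin

definition fourier :: "real \<Rightarrow> complex" where
  "fourier s = (LINT \<sigma>|lborel. \<rho> \<sigma> * exp (\<i> * complex_of_real (\<sigma> * s)))"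

lemma cont: "continuous_on S \<rho>" "continuous_on S \<rho>1"
  by (rule continuous_on_vector_derivative[OF has_vector_derivative_at_within[OF d1]],
      rule continuous_on_vector_derivative[OF has_vector_derivative_at_within[OF d2]])

lemma integrable_weighted:
  assumes "continuous_on UNIV h" "\<And>x. x \<notin> {-N<..<N} \<Longrightarrow> f x = 0" "continuous_on UNIV f"
  shows "integrable lborel (\<lambda>x::real. f x * h x :: complex)"
  by (rule integral_compact_support[of "{-N..N}"])
    (use assms in \<open>auto intro!: continuous_intros intro: continuous_on_subset\<close>)

lemma integral_by_parts_compact_support:
  assumes d: "\<And>x. (f has_vector_derivative f' x) (at x)" and c: "continuous_on UNIV f'"
    and s: "\<And>x. x \<notin> {-N<..<N} \<Longrightarrow> f x = 0" "\<And>x. x \<notin> {-N<..<N} \<Longrightarrow> f' x = 0"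
    and dh: "\<And>x. (h has_vector_derivative h' x) (at x)" and ch': "continuous_on UNIV h'"
  shows "(LINT \<sigma>|lborel. f \<sigma> * h' \<sigma>) = - (LINT \<sigma>|lborel. f' \<sigma> * h \<sigma> :: complex)"
proof -
  have cf: "continuous_on UNIV f"
    by (rule continuous_on_vector_derivative[OF has_vector_derivative_at_within[OF d]])
  have ch: "continuous_on UNIV h"
    by (rule continuous_on_vector_derivative[OF has_vector_derivative_at_within[OF dh]])
  have "(LINT \<sigma>|lborel. f \<sigma> * h' \<sigma> + f' \<sigma> * h \<sigma>) = 0"
    by (rule integral_derivative_compact_support[OF has_vector_derivative_mult[OF d dh], where a = "-N" and b = N])
      (use N s in \<open>auto intro!: continuous_intros cf c ch ch'\<close>)
  moreover have "integrable lborel (\<lambda>\<sigma>. f \<sigma> * h' \<sigma>)" "integrable lborel (\<lambda>\<sigma>. f' \<sigma> * h \<sigma>)"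
    by (auto intro!: integrable_weighted c cf ch ch' s)
  ultimately show ?thesis by (simp add: add_eq_0_iff2)
qed

lemma integral_exp_by_parts:
  assumes d: "\<And>x. (f has_vector_derivative f' x) (at x)" and c: "continuous_on UNIV f'"
    and s: "\<And>x. x \<notin> {-N<..<N} \<Longrightarrow> f x = 0" "\<And>x. x \<notin> {-N<..<N} \<Longrightarrow> f' x = 0"
  shows "(LINT \<sigma>|lborel. f' \<sigma> * exp (\<i> * complex_of_real (\<sigma> * s))) =
    - (\<i> * complex_of_real s) * (LINT \<sigma>|lborel. f \<sigma> * exp (\<i> * complex_of_real (\<sigma> * s)))"
proof -
  let ?e = "\<lambda>\<sigma>. exp (\<i> * complex_of_real (\<sigma> * s))"
  have A: "(LINT \<sigma>|lborel. f \<sigma> * (\<i> * complex_of_real s * ?e \<sigma>)) = - (LINT \<sigma>|lborel. f' \<sigma> * ?e \<sigma>)"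
    by (rule integral_by_parts_compact_support[OF d c s has_vector_derivative_exp_i]) (auto intro!: continuous_intros)
  have B: "(LINT \<sigma>|lborel. f \<sigma> * (\<i> * complex_of_real s * ?e \<sigma>)) = (\<i> * complex_of_real s) * (LINT \<sigma>|lborel. f \<sigma> * ?e \<sigma>)"
    by (subst integral_mult_right_zero[symmetric]) (simp add: mult_ac)
  show ?thesis
    using arg_cong[OF trans[OF A[symmetric] B], of uminus] by (simp only: minus_minus mult_minus_left)
qed

text \<open>Up to sign, s^2 times the transform is the transform of the second derivative. Adding
  the trivial bounds for both transforms produces the weight 1 + s^2.\<close>

lemma norm_fourier_bound:
  "cmod (fourier s) \<le> ((LINT \<sigma>|lborel. cmod (\<rho> \<sigma>)) + (LINT \<sigma>|lborel. cmod (\<rho>2 \<sigma>))) * inverse (1 + s\<^sup>2)"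
proof -
  have b: "cmod (LINT \<sigma>|lborel. f \<sigma> * exp (\<i> * complex_of_real (\<sigma> * s))) \<le> (LINT \<sigma>|lborel. cmod (f \<sigma>))" for f :: "real \<Rightarrow> complex"
    using integral_norm_bound[of lborel "\<lambda>\<sigma>. f \<sigma> * exp (\<i> * complex_of_real (\<sigma> * s))"] by (simp add: norm_mult)
  have "(LINT \<sigma>|lborel. \<rho>2 \<sigma> * exp (\<i> * complex_of_real (\<sigma> * s))) = - (complex_of_real s)\<^sup>2 * fourier s"
    using integral_exp_by_parts[OF d1 cont(2) supp(1,2), of s] integral_exp_by_parts[OF d2 cont2 supp(2,3), of s]
    by (simp add: fourier_def power2_eq_square algebra_simps)
  then have "s\<^sup>2 * cmod (fourier s) \<le> (LINT \<sigma>|lborel. cmod (\<rho>2 \<sigma>))"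
    using b[of \<rho>2] by (simp add: norm_mult norm_power)
  moreover have "cmod (fourier s) \<le> (LINT \<sigma>|lborel. cmod (\<rho> \<sigma>))"
    using b[of \<rho>] by (simp add: fourier_def)
  ultimately have "(1 + s\<^sup>2) * cmod (fourier s) \<le> (LINT \<sigma>|lborel. cmod (\<rho> \<sigma>)) + (LINT \<sigma>|lborel. cmod (\<rho>2 \<sigma>))"
    by (simp add: algebra_simps)
  moreover have "1 + s\<^sup>2 > 0" by (simp add: add_pos_nonneg)
  ultimately show ?thesis by (metis divide_inverse pos_le_divide_eq mult.commute)
qed

lemma borel_measurable_fourier [measurable]: "fourier \<in> borel_measurable borel"
proof -
  have [measurable]: "\<rho> \<in> borel_measurable borel"
    using cont(1) by (rule borel_measurable_continuous_onI)
  have "fourier \<in> borel_measurable lborel"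
    unfolding fourier_def[abs_def] by measurable
  then show ?thesis by simp
qed

lemma integrable_fourier: "integrable lborel fourier"
proof (rule Bochner_Integration.integrable_bound)
  have "integrable lborel (\<lambda>x::real. inverse (1 + x\<^sup>2))"
    using integrable_inverse_1_plus_square by (simp add: set_integrable_def)
  then show "integrable lborel (\<lambda>s. ((LINT \<sigma>|lborel. cmod (\<rho> \<sigma>)) + (LINT \<sigma>|lborel. cmod (\<rho>2 \<sigma>))) * inverse (1 + s\<^sup>2))"
    by (rule integrable_mult_right)
  show "AE s in lborel. norm (fourier s) \<le> norm (((LINT \<sigma>|lborel. cmod (\<rho> \<sigma>)) + (LINT \<sigma>|lborel. cmod (\<rho>2 \<sigma>))) * inverse (1 + s\<^sup>2))"
    using norm_fourier_bound by (intro AE_I2) (metis abs_ge_self order_trans real_norm_def)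
qed simp

lemma integral_exp_i_interval:
  assumes "T \<ge> 0"
  shows "(LINT s|lborel. indicator {-T..T} s *\<^sub>R exp (\<i> * complex_of_real (\<sigma> * s))) = complex_of_real (2 * T * sinc (T * \<sigma>))"
proof (cases "\<sigma> = 0")
  case True
  have "(LINT s|lborel. indicator {-T..T} s *\<^sub>R (1::complex)) = complex_of_real T - complex_of_real (-T)"
    using assms by (intro integral_FTC_atLeastAtMost) (auto intro!: derivative_eq_intros)
  then show ?thesis using True by simp
next
  case False
  have d: "((\<lambda>s. exp (\<i> * complex_of_real (\<sigma> * s)) / (\<i> * complex_of_real \<sigma>)) has_vector_derivative
     exp (\<i> * complex_of_real (\<sigma> * s))) (at s)" for s
    using has_vector_derivative_divide[OF has_vector_derivative_exp_i[of \<sigma> s], of "\<i> * complex_of_real \<sigma>"] False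
    by (simp add: mult.commute)
  have "(LINT s|lborel. indicator {-T..T} s *\<^sub>R exp (\<i> * complex_of_real (\<sigma> * s))) =
    exp (\<i> * complex_of_real (\<sigma> * T)) / (\<i> * complex_of_real \<sigma>) - exp (\<i> * complex_of_real (\<sigma> * (- T))) / (\<i> * complex_of_real \<sigma>)"
    using assms by (intro integral_FTC_atLeastAtMost has_vector_derivative_at_within[OF d] continuous_intros) auto
  also have "\<dots> = complex_of_real (2 * T * sinc (T * \<sigma>))"
  proof -
    have "exp (\<i> * complex_of_real (\<sigma> * T)) - exp (\<i> * complex_of_real (\<sigma> * (- T))) = 2 * \<i> * complex_of_real (sin (\<sigma> * T))"
      unfolding cis_conv_exp[symmetric] by (simp add: complex_eq_iff)
    moreover have "2 * T * sinc (T * \<sigma>) = 2 * sin (\<sigma> * T) / \<sigma>"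
      using False by (auto simp: mult.commute)
    ultimately show ?thesis using False by (simp add: diff_divide_distrib[symmetric])
  qed
  finally show ?thesis .
qed

lemma integral_fourier: "(LINT s|lborel. fourier s) = 2 * pi * \<rho> 0"
proof -
  have [measurable]: "\<rho> \<in> borel_measurable borel" "\<rho>1 \<in> borel_measurable borel"
    by (rule borel_measurable_continuous_onI[OF cont(1)], rule borel_measurable_continuous_onI[OF cont(2)])
  have truncated: "(LINT s|lborel. indicator {-T..T} s *\<^sub>R fourier s) =
      - (LINT \<sigma>|lborel. \<rho>1 \<sigma> * complex_of_real (2 * Si (T * \<sigma>)))" if T: "T \<ge> 0" for T
  proof -
    let ?k = "\<lambda>(s, \<sigma>). indicator {-T..T} s *\<^sub>R (\<rho> \<sigma> * exp (\<i> * complex_of_real (\<sigma> * s)))"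
    \<comment> \<open>The support of \<rho> lies in [-N, N], so the integrand on the strip equals
      the one on a compact box; this justifies Fubini.\<close>
    have "integrable lborel (\<lambda>p. indicator ({-T..T} \<times> {-N..N}) p *\<^sub>R (\<rho> (snd p) * exp (\<i> * complex_of_real (snd p * fst p))))"
      by (intro borel_integrable_compact compact_Times continuous_intros
          continuous_on_compose2[OF cont(1)[of UNIV]]) auto
    moreover have "indicator ({-T..T} \<times> {-N..N}) p *\<^sub>R (\<rho> (snd p) * exp (\<i> * complex_of_real (snd p * fst p))) = ?k p" for p
      using supp(1)[of "snd p"] by (cases p; cases "snd p \<in> {-N..N}") (auto simp: indicator_times)
    ultimately have int: "integrable (lborel \<Otimes>\<^sub>M lborel) ?k" by (simp only: lborel_prod)
    have "(LINT s|lborel. indicator {-T..T} s *\<^sub>R fourier s) = (LINT s|lborel. LINT \<sigma>|lborel. ?k (s, \<sigma>))"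
      by (simp add: fourier_def)
    also have "\<dots> = (LINT \<sigma>|lborel. LINT s|lborel. ?k (s, \<sigma>))"
      using lborel_pair.Fubini_integral[of "\<lambda>s \<sigma>. ?k (s, \<sigma>)"] int by simp
    also have "\<dots> = (LINT \<sigma>|lborel. \<rho> \<sigma> * complex_of_real (2 * T * sinc (T * \<sigma>)))"
    proof (rule Bochner_Integration.integral_cong[OF refl])
      fix \<sigma>
      have "(LINT s|lborel. ?k (s, \<sigma>)) = (LINT s|lborel. \<rho> \<sigma> * (indicator {-T..T} s *\<^sub>R exp (\<i> * complex_of_real (\<sigma> * s))))"
        by simp
      also have "\<dots> = \<rho> \<sigma> * (LINT s|lborel. (indicator {-T..T} s *\<^sub>R exp (\<i> * complex_of_real (\<sigma> * s))))"
        by (rule integral_mult_right_zero)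
      finally show "(LINT s|lborel. ?k (s, \<sigma>)) = \<rho> \<sigma> * complex_of_real (2 * T * sinc (T * \<sigma>))"
        by (simp only: integral_exp_i_interval[OF T])
    qed
    also have "\<dots> = - (LINT \<sigma>|lborel. \<rho>1 \<sigma> * complex_of_real (2 * Si (T * \<sigma>)))"
    proof -
      \<comment> \<open>The Dirichlet kernel 2 T sinc(T \<sigma>) is the \<sigma>-derivative of 2
        Si(T \<sigma>). Integrating by parts replaces it by a kernel bounded uniformly in T.\<close>
      have dS: "((\<lambda>\<sigma>. complex_of_real (2 * Si (T * \<sigma>))) has_vector_derivative complex_of_real (2 * T * sinc (T * \<sigma>))) (at \<sigma>)" for \<sigma>
      proof -
        have "((\<lambda>\<sigma>. 2 * Si (T * \<sigma>)) has_real_derivative 2 * (sinc (T * \<sigma>) * T)) (at \<sigma>)"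
          by (intro DERIV_cmult DERIV_chain2[OF DERIV_Si]) (auto intro!: derivative_eq_intros)
        then have "((\<lambda>\<sigma>. 2 * Si (T * \<sigma>)) has_vector_derivative 2 * T * sinc (T * \<sigma>)) (at \<sigma>)"
          by (simp add: has_real_derivative_iff_has_vector_derivative mult_ac)
        from bounded_linear.has_vector_derivative[OF bounded_linear_of_real this] show ?thesis .
      qed
      show ?thesis
        by (rule integral_by_parts_compact_support[OF d1 cont(2) supp(1,2) dS])
          (assumption | intro continuous_on_of_real continuous_on_mult continuous_on_const continuous_on_sinc continuous_on_id)+
    qed
    finally show ?thesis .
  qed
  have 1: "((\<lambda>T. LINT s|lborel. indicator {-T..T} s *\<^sub>R fourier s) \<longlongrightarrow> (LINT s|lborel. fourier s)) at_top"
  proof (rule integral_dominated_convergence_at_top)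
    show "integrable lborel (\<lambda>s. norm (fourier s))" using integrable_fourier by (rule integrable_norm)
    show "AE s in lborel. ((\<lambda>T. indicator {-T..T} s *\<^sub>R fourier s) \<longlongrightarrow> fourier s) at_top"
    proof (intro AE_I2 tendsto_eventually)
      fix s :: real
      show "\<forall>\<^sub>F T in at_top. indicator {-T..T} s *\<^sub>R fourier s = fourier s"
        using eventually_ge_at_top[of "\<bar>s\<bar>"] by eventually_elim (auto simp: indicator_def)
    qed
    show "\<forall>\<^sub>F T in at_top. AE s in lborel. norm (indicator {-T..T} s *\<^sub>R fourier s) \<le> norm (fourier s)"
      by (intro always_eventually allI AE_I2) (auto simp: indicator_def)
  qed auto
  obtain B where B: "\<And>T. \<bar>Si T\<bar> \<le> B" using bounded_Si by blast
  \<comment> \<open>Pointwise 2 Si(T \<sigma>) tends to pi sgn \<sigma>, and the bound B on Si makes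
    2 B times the modulus of \<rho>' a dominating function.\<close>
  have 2: "((\<lambda>T. LINT \<sigma>|lborel. \<rho>1 \<sigma> * complex_of_real (2 * Si (T * \<sigma>))) \<longlongrightarrow> (LINT \<sigma>|lborel. \<rho>1 \<sigma> * complex_of_real (pi * sgn \<sigma>))) at_top"
  proof (rule integral_dominated_convergence_at_top)
    show "integrable lborel (\<lambda>\<sigma>. cmod (\<rho>1 \<sigma> * complex_of_real (2 * B)))"
      by (rule integrable_norm[OF integrable_weighted[OF continuous_on_const supp(2) cont(2)]])
    show "AE \<sigma> in lborel. ((\<lambda>T. \<rho>1 \<sigma> * complex_of_real (2 * Si (T * \<sigma>))) \<longlongrightarrow> \<rho>1 \<sigma> * complex_of_real (pi * sgn \<sigma>)) at_top"
    proof (rule AE_I2, rule tendsto_mult[OF tendsto_const tendsto_of_real])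
      fix \<sigma> :: real
      consider "\<sigma> > 0" | "\<sigma> = 0" | "\<sigma> < 0" by linarith
      then show "((\<lambda>T. 2 * Si (T * \<sigma>)) \<longlongrightarrow> pi * sgn \<sigma>) at_top"
      proof cases
        case 1
        have "((\<lambda>T. 2 * Si (T * \<sigma>)) \<longlongrightarrow> 2 * (pi / 2)) at_top"
          by (intro tendsto_intros filterlim_compose[OF Si_at_top] filterlim_at_top_mult_tendsto_pos[OF tendsto_const 1] filterlim_ident)
        then show ?thesis using 1 by simp
      next
        case 2
        then show ?thesis by (simp add: Si_def zero_ereal_def[symmetric])
      next
        case 3
        have "((\<lambda>T. - (2 * Si (T * (- \<sigma>)))) \<longlongrightarrow> - (2 * (pi / 2))) at_top"
          using 3 by (intro tendsto_intros filterlim_compose[OF Si_at_top] filterlim_at_top_mult_tendsto_pos[OF tendsto_const] filterlim_ident) auto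
        moreover have "\<forall>\<^sub>F T in at_top. - (2 * Si (T * (- \<sigma>))) = 2 * Si (T * \<sigma>)"
          using eventually_ge_at_top[of 0]
        proof eventually_elim
          case (elim T)
          then have "T * (- \<sigma>) \<ge> 0" using 3 by (intro mult_nonneg_nonneg) auto
          from Si_neg[OF this] show ?case by simp
        qed
        ultimately show ?thesis using 3 by (auto intro: Lim_transform_eventually)
      qed
    qed
    show "\<forall>\<^sub>F T in at_top. AE \<sigma> in lborel. norm (\<rho>1 \<sigma> * complex_of_real (2 * Si (T * \<sigma>))) \<le> cmod (\<rho>1 \<sigma> * complex_of_real (2 * B))"
    proof (intro always_eventually allI AE_I2)
      fix T \<sigma> :: real
      have "\<bar>2 * Si (T * \<sigma>)\<bar> \<le> \<bar>2 * B\<bar>" using B[of "T * \<sigma>"] by linarith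
      then show "norm (\<rho>1 \<sigma> * complex_of_real (2 * Si (T * \<sigma>))) \<le> cmod (\<rho>1 \<sigma> * complex_of_real (2 * B))"
        unfolding norm_mult norm_of_real by (rule mult_left_mono) simp
    qed
  qed auto
  have "(LINT \<sigma>|lborel. \<rho>1 \<sigma> * complex_of_real (pi * sgn \<sigma>)) = - 2 * pi * \<rho> 0"
  proof -
    have i: "integrable lborel (\<lambda>\<sigma>. indicator {a..b} \<sigma> *\<^sub>R \<rho>1 \<sigma>)" for a b
      by (rule borel_integrable_compact[OF compact_Icc cont(2)])
    have f: "(LINT \<sigma>|lborel. indicator {a..b} \<sigma> *\<^sub>R \<rho>1 \<sigma>) = \<rho> b - \<rho> a" if "a \<le> b" for a b
      by (rule integral_FTC_atLeastAtMost[OF that has_vector_derivative_at_within[OF d1] cont(2)])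
    \<comment> \<open>Splitting at 0: the right half contributes -\<rho>(0) and the left half,
      subtracted, another -\<rho>(0). The outer ends give nothing since \<rho> vanishes at -N and
      N.\<close>
    have "(LINT \<sigma>|lborel. \<rho>1 \<sigma> * complex_of_real (pi * sgn \<sigma>)) =
      (LINT \<sigma>|lborel. pi * (indicator {0..N} \<sigma> *\<^sub>R \<rho>1 \<sigma> - indicator {-N..0} \<sigma> *\<^sub>R \<rho>1 \<sigma>))"
      by (rule Bochner_Integration.integral_cong[OF refl])
        (use supp(2) N in \<open>force simp: indicator_def sgn_if\<close>)
    also have "\<dots> = pi * ((LINT \<sigma>|lborel. indicator {0..N} \<sigma> *\<^sub>R \<rho>1 \<sigma>) - (LINT \<sigma>|lborel. indicator {-N..0} \<sigma> *\<^sub>R \<rho>1 \<sigma>))"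
      by (simp only: integral_mult_right_zero Bochner_Integration.integral_diff[OF i i])
    also have "\<dots> = - 2 * pi * \<rho> 0"
      using N supp(1)[of N] supp(1)[of "-N"] by (simp add: f algebra_simps)
    finally show ?thesis .
  qed
  with tendsto_minus[OF 2] have "((\<lambda>T. - (LINT \<sigma>|lborel. \<rho>1 \<sigma> * complex_of_real (2 * Si (T * \<sigma>)))) \<longlongrightarrow> 2 * pi * \<rho> 0) at_top"
    by simp
  moreover have "\<forall>\<^sub>F T in at_top. (LINT s|lborel. indicator {-T..T} s *\<^sub>R fourier s) = - (LINT \<sigma>|lborel. \<rho>1 \<sigma> * complex_of_real (2 * Si (T * \<sigma>)))"
    using eventually_ge_at_top[of 0] by eventually_elim (rule truncated)
  ultimately have "((\<lambda>T. LINT s|lborel. indicator {-T..T} s *\<^sub>R fourier s) \<longlongrightarrow> 2 * pi * \<rho> 0) at_top"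
    by (simp add: tendsto_cong)
  with 1 show ?thesis using tendsto_unique trivial_limit_at_top_linorder by blast
qed

end

lemma fourier_bump_test_function:
  assumes "\<rho> \<in> test_functions (UNIV :: real set)"
  obtains N where "fourier_bump \<rho> (iter_deriv [1] \<rho>) (iter_deriv [1, 1] \<rho>) N"
proof -
  from assms obtain K where s: "smooth_on UNIV \<rho>" and K: "compact K" "\<And>x. x \<notin> K \<Longrightarrow> \<rho> x = 0"
    by (auto simp: test_functions_def)
  obtain N where N: "N > 0" "\<And>x. x \<in> K \<Longrightarrow> norm x < N"
    using K(1) compact_imp_bounded bounded_pos_less by metis
  \<comment> \<open>The complement of the compact set is open, so all derivatives vanish there
    together with the function.\<close>
  have zero: "iter_deriv vs \<rho> x = 0" if "x \<in> - K" for vs x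
  proof -
    have "iter_deriv vs \<rho> x = iter_deriv vs (\<lambda>_. 0) x"
      by (rule iter_deriv_cong_on[of "- K"]) (use K that in \<open>auto simp: open_Compl compact_imp_closed\<close>)
    moreover have "iter_deriv vs (\<lambda>_::real. 0 :: complex) = (\<lambda>_. 0)" by (induction vs) auto
    ultimately show ?thesis by simp
  qed
  have notK: "x \<in> - K" if "x \<notin> {-N<..<N}" for x
    using N(2)[of x] that by auto
  have d: "(f has_vector_derivative frechet_derivative f (at x) 1) (at x)" if "smooth_on UNIV f" for f :: "real \<Rightarrow> complex" and x
  proof -
    have f: "(f has_derivative frechet_derivative f (at x)) (at x)"
      using smooth_on_differentiable[OF that] frechet_derivative_works by blast
    have "frechet_derivative f (at x) = (\<lambda>h. h *\<^sub>R frechet_derivative f (at x) 1)"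
    proof
      show "frechet_derivative f (at x) h = h *\<^sub>R frechet_derivative f (at x) 1" for h
        using linear_scale[OF has_derivative_linear[OF f], of h 1] by simp
    qed
    then show ?thesis unfolding has_vector_derivative_def by (rule has_derivative_eq_rhs[OF f])
  qed
  have sm: "smooth_on UNIV (iter_deriv vs \<rho>)" if "vs \<in> lists Basis" for vs
    by (rule smooth_on_iter_deriv[OF s that])
  have "fourier_bump \<rho> (iter_deriv [1] \<rho>) (iter_deriv [1, 1] \<rho>) N"
  proof (rule fourier_bump.intro)
    show "(\<rho> has_vector_derivative iter_deriv [1] \<rho> x) (at x)" for x using d[OF s] by simp
    show "(iter_deriv [1] \<rho> has_vector_derivative iter_deriv [1, 1] \<rho> x) (at x)" for x using d[OF sm[of "[1]"]] by simp
    show "continuous_on UNIV (iter_deriv [1, 1] \<rho>)" by (intro smooth_on_imp_continuous_on sm) simp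
  qed (use N zero notK zero[of _ "[]"] in \<open>auto simp del: iter_deriv.simps(2)\<close>)
  then show ?thesis by (rule that)
qed

section \<open>Continuous functions of compact support\<close>

text \<open>Continuity is required only on \<open>K\<close>, not globally: the surface density is
  uncontrolled at the vertex, which the supports avoid. The notion passes to slices, as iterated
  integration requires.\<close>

definition compactly_supported :: "('a::euclidean_space \<Rightarrow> complex) \<Rightarrow> bool" where
  "compactly_supported f \<longleftrightarrow> (\<exists>K. compact K \<and> continuous_on K f \<and> (\<forall>x. x \<notin> K \<longrightarrow> f x = 0))"

lemma compactly_supported_integrable: "compactly_supported f \<Longrightarrow> integrable lborel f"
  unfolding compactly_supported_def using integral_compact_support by metis

lemma compact_slice:
  fixes K :: "('a::euclidean_space \<times> 'b::euclidean_space) set"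
  assumes "compact K"
  shows "compact {y. (x, y) \<in> K}"
proof -
  have "closed {y. (x, y) \<in> K}"
    using continuous_closed_vimage[of K "Pair x"] compact_imp_closed[OF assms]
    by (simp add: vimage_def continuous_intros)
  moreover have "compact (snd ` K)"
    by (rule compact_continuous_image[OF continuous_on_snd[OF continuous_on_id] assms])
  ultimately have "compact (snd ` K \<inter> {y. (x, y) \<in> K})"
    by (intro compact_Int_closed)
  also have "snd ` K \<inter> {y. (x, y) \<in> K} = {y. (x, y) \<in> K}" by force
  finally show ?thesis .
qed

lemma compactly_supported_slice:
  assumes "compactly_supported f"
  shows "compactly_supported (\<lambda>y. f (x, y))"
proof -
  obtain K where K: "compact K" "continuous_on K f" "\<forall>x. x \<notin> K \<longrightarrow> f x = 0"
    using assms unfolding compactly_supported_def by blast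
  have "continuous_on {y. (x, y) \<in> K} (\<lambda>y. f (x, y))"
    by (rule continuous_on_compose2[OF K(2)]) (auto intro!: continuous_intros)
  then show ?thesis
    unfolding compactly_supported_def using compact_slice[OF K(1)] K(3) by blast
qed

lemma test_functionE:
  assumes "u \<in> test_functions \<Omega>"
  obtains K where "compact K" "K \<subseteq> \<Omega>" "\<And>x. x \<notin> K \<Longrightarrow> u x = 0" "continuous_on UNIV u"
  using assms unfolding test_functions_def using smooth_on_imp_continuous_on by blast

lemma compact_support_bounded:
  fixes u :: "'a::euclidean_space \<Rightarrow> complex"
  assumes "compact K" "\<And>x. x \<notin> K \<Longrightarrow> u x = 0" "continuous_on UNIV u"
  obtains B where "B \<ge> 0" "\<And>x. cmod (u x) \<le> B"
proof -
  have "bounded (u ` K)"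
    using assms by (intro compact_imp_bounded compact_continuous_image) (auto intro: continuous_on_subset)
  then obtain B where "\<And>x. x \<in> K \<Longrightarrow> cmod (u x) \<le> B" "B > 0"
    unfolding bounded_pos by blast
  then have "B \<ge> 0" "cmod (u x) \<le> B" for x
    using assms(2)[of x] by (cases "x \<in> K"; auto)+
  then show ?thesis using that by blast
qed

lemma dominated_convergence_at_right:
  fixes f :: "'a \<Rightarrow> 'b::{banach, second_countable_topology}" and s :: "real \<Rightarrow> 'a \<Rightarrow> 'b"
  assumes "f \<in> borel_measurable M" "\<And>t. s t \<in> borel_measurable M" "integrable M w"
    and "\<And>x. ((\<lambda>t. s t x) \<longlongrightarrow> f x) (at_right a)" "\<And>t x. norm (s t x) \<le> w x"
  shows "((\<lambda>t. integral\<^sup>L M (s t)) \<longlongrightarrow> integral\<^sup>L M f) (at_right a)"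
  unfolding tendsto_at_iff_sequentially
proof (intro allI impI)
  fix X :: "nat \<Rightarrow> real" assume X: "\<forall>i. X i \<in> {a<..} - {a}" "X \<longlonglongrightarrow> a"
  show "((\<lambda>t. integral\<^sup>L M (s t)) \<circ> X) \<longlonglongrightarrow> integral\<^sup>L M f"
    unfolding comp_def
  proof (rule integral_dominated_convergence[where w = w])
    show "AE x in M. (\<lambda>i. s (X i) x) \<longlonglongrightarrow> f x"
      using assms(4) X unfolding tendsto_at_iff_sequentially comp_def by (intro AE_I2) blast
  qed (use assms in auto)
qed

section \<open>The symbol\<close>

text \<open>Translation carries the derivatives at one point exactly to those at the other, so even
  the choice made by \<open>frechet_derivative\<close> agrees. The rule can therefore be iterated
  without tracking differentiability.\<close>

lemma frechet_derivative_shift: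
  assumes "\<And>p. f (p + h) = f p"
  shows "frechet_derivative f (at (p + h)) = frechet_derivative f (at p)"
proof -
  have 1: "(g has_derivative D) (at p)" if "(g has_derivative D) (at (p + k))" "\<And>p. g (p + k) = g p" for g D p k
  proof -
    have "((\<lambda>x. x + k) has_derivative (\<lambda>h. h)) (at p)" by (auto intro!: derivative_eq_intros)
    from has_derivative_compose[OF this that(1)] show ?thesis by (simp add: that(2))
  qed
  have inv: "f (p + - h) = f p" for p using assms[of "p + - h"] by simp
  have "(f has_derivative D) (at (p + h)) \<longleftrightarrow> (f has_derivative D) (at p)" for D
    using 1[of f D p h, OF _ assms] 1[of f D "p + h" "- h", OF _ inv] by auto
  then show ?thesis by (simp add: frechet_derivative_def)
qed

lemma iter_deriv_shift:
  assumes "\<And>p. f (p + h) = f p"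
  shows "iter_deriv vs f (p + h) = iter_deriv vs f p"
proof (induction vs arbitrary: p)
  case (Cons v vs)
  then show ?case using frechet_derivative_shift[of "iter_deriv vs f" h p] by simp
qed (use assms in simp)

lemma frechet_derivative_invariant_direction:
  assumes "\<And>p t. f (p + t *\<^sub>R v) = f p" "f differentiable (at p)"
  shows "frechet_derivative f (at p) v = 0"
proof -
  have F: "(f has_derivative frechet_derivative f (at p)) (at p)"
    using assms(2) frechet_derivative_works by blast
  have "((\<lambda>t::real. p + t *\<^sub>R v) has_derivative (\<lambda>t. t *\<^sub>R v)) (at 0)"
    by (auto intro!: derivative_eq_intros)
  from has_derivative_compose[OF this, of f "frechet_derivative f (at p)"] F
  have "((\<lambda>t::real. f p) has_derivative (\<lambda>t. frechet_derivative f (at p) (t *\<^sub>R v))) (at 0)"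
    by (simp add: assms(1))
  then have "(\<lambda>t::real. frechet_derivative f (at p) (t *\<^sub>R v)) = (\<lambda>t. 0)"
    by (rule has_derivative_unique) simp
  from fun_cong[OF this, of 1] show ?thesis by simp
qed

lemma iter_deriv_zero: "iter_deriv vs (\<lambda>_. 0) = (\<lambda>_. 0)"
  by (induction vs) auto

text \<open>Any frequency derivative annihilates the function, which settles nonempty
  \<open>\<alpha>\<close> with constant 0. Otherwise the derivative is invariant under shifts in
  \<sigma>, so its values at frequency 0 over the compact set give a uniform bound.\<close>

lemma symbol_order_0_const_frequency:
  fixes b :: "'y::euclidean_space \<times> 'x::euclidean_space \<Rightarrow> complex"
  assumes W: "open W" and b: "smooth_on W b"
  shows "symbol W 0 (\<lambda>(y, x, \<sigma> :: 's::euclidean_space). b (y, x))"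
proof -
  let ?a = "\<lambda>(y, x, \<sigma> :: 's). b (y, x)"
  let ?S = "{(y, x, \<sigma> :: 's). (y, x) \<in> W}"
  have S: "?S = (\<lambda>p. (fst p, fst (snd p))) -` W" by auto
  have oS: "open ?S" unfolding S by (intro open_vimage W continuous_intros)
  have "smooth_on ?S (\<lambda>p. b (fst p, fst (snd p)))"
    by (intro smooth_on_compose[OF b] smooth_on_Pair smooth_on_fst smooth_on_snd smooth_on_id oS) auto
  moreover have a_eq: "(\<lambda>p. b (fst p, fst (snd p))) = ?a" by auto
  ultimately have sm: "smooth_on ?S ?a" by simp
  have "\<exists>C. \<forall>y x \<sigma>. (y, x) \<in> K \<longrightarrow>
         cmod (iter_deriv (map (\<lambda>b. (b, 0, 0)) \<gamma> @ map (\<lambda>b. (0, b, 0)) \<beta> @ map (\<lambda>b. (0, 0, b)) \<alpha>) ?a (y, x, \<sigma>))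
           \<le> C * (1 + norm \<sigma>) powr (0 - real (length \<alpha>))"
    if K: "compact K" "K \<subseteq> W" and l: "\<alpha> \<in> lists Basis" "\<beta> \<in> lists Basis" "\<gamma> \<in> lists Basis" for K \<alpha> \<beta> \<gamma>
  \<comment> \<open>The list ends with the frequency directions and its last entry is differentiated
    first, hence the split at the end.\<close>
  proof (cases \<alpha> rule: rev_cases)
    case Nil
    let ?vs = "map (\<lambda>b. (b, 0, 0)) \<gamma> @ map (\<lambda>b. (0, b, 0)) \<beta> :: ('y \<times> 'x \<times> 's) list"
    have "?vs \<in> lists Basis" using l by (auto simp: Basis_prod_def zero_prod_def)
    then have "continuous_on ?S (iter_deriv ?vs ?a)"
      by (intro smooth_on_imp_continuous_on smooth_on_iter_deriv sm)
    then have "continuous_on K (\<lambda>p. iter_deriv ?vs ?a (fst p, snd p, 0))"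
      by (rule continuous_on_compose2[of ?S "iter_deriv ?vs ?a" K "\<lambda>p. (fst p, snd p, 0)"])
        (use K(2) in \<open>auto intro!: continuous_intros\<close>)
    then have "bounded ((\<lambda>p. iter_deriv ?vs ?a (fst p, snd p, 0)) ` K)"
      using K(1) by (intro compact_imp_bounded compact_continuous_image)
    then obtain C where C: "\<And>p. p \<in> K \<Longrightarrow> cmod (iter_deriv ?vs ?a (fst p, snd p, 0)) \<le> C"
      unfolding bounded_iff by blast
    have "cmod (iter_deriv ?vs ?a (y, x, \<sigma>)) \<le> C * (1 + norm \<sigma>) powr 0" if "(y, x) \<in> K" for y x \<sigma>
    proof -
      have "iter_deriv ?vs ?a (y, x, \<sigma>) = iter_deriv ?vs ?a (y, x, 0)"
        using iter_deriv_shift[of ?a "(0, 0, \<sigma>)" ?vs "(y, x, 0)"] by (simp add: split_def)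
      then show ?thesis using C[OF that] by (simp add: add_nonneg_eq_0_iff)
    qed
    then show ?thesis unfolding Nil by (intro exI[of _ C]) simp
  next
    case (snoc \<alpha>' c)
    have zero: "frechet_derivative ?a (at p) (0, 0, c) = 0" if "p \<in> ?S" for p
      by (rule frechet_derivative_invariant_direction[OF _ smooth_on_differentiable[OF sm that]])
        (simp add: split_def)
    have "iter_deriv (map (\<lambda>b. (b, 0, 0)) \<gamma> @ map (\<lambda>b. (0, b, 0)) \<beta> @ map (\<lambda>b. (0, 0, b)) \<alpha>) ?a (y, x, \<sigma>) = 0"
      if "(y, x) \<in> K" for y x \<sigma>
    proof -
      let ?vs = "map (\<lambda>b. (b, 0, 0)) \<gamma> @ map (\<lambda>b. (0, b, 0)) \<beta> @ map (\<lambda>b. (0, 0, b)) \<alpha>' :: ('y \<times> 'x \<times> 's) list"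
      have "iter_deriv ?vs (\<lambda>p. frechet_derivative ?a (at p) (0, 0, c)) (y, x, \<sigma>) = iter_deriv ?vs (\<lambda>_. 0) (y, x, \<sigma>)"
        by (rule iter_deriv_cong_on[OF oS zero]) (use that K in auto)
      then show ?thesis
        using iter_deriv_snoc[of ?vs "(0, 0, c)" ?a] by (simp add: snoc iter_deriv_zero)
    qed
    then show ?thesis by (intro exI[of _ 0]) simp
  qed
  then show ?thesis unfolding symbol_def using sm by blast
qed

section \<open>Surface density and amplitude\<close>

context cone_profile
begin

text \<open>Off the vertex this is the area density of the surface over \<open>x'\<close>, and
  equally the norm of the x-gradient of \<Psi>. Its value at the vertex carries no
  information.\<close>

definition weight :: "real \<times> 'v::euclidean_space \<Rightarrow> 'v \<Rightarrow> real" where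
  "weight y x' = sqrt (1 + (fst y * deriv q (norm (x' - snd y)))\<^sup>2)"

lemma weight_ge_1: "weight y x' \<ge> 1"
  by (simp add: weight_def)

lemma sqrt_grad_height:
  fixes x' :: "real^'m"
  assumes "x' \<noteq> x\<^sub>0"
  shows "sqrt (1 + (norm (grad (\<lambda>x'. E * q (norm (x' - x\<^sub>0))) x'))\<^sup>2) = weight (E, x\<^sub>0) x'"
proof -
  have "height (E, x\<^sub>0) = (\<lambda>x'. E * q (norm (x' - x\<^sub>0)))" by (auto simp: height_def)
  then have "grad (\<lambda>x'. E * q (norm (x' - x\<^sub>0))) x' = (E * deriv q (norm (x' - x\<^sub>0))) *\<^sub>R sgn (x' - x\<^sub>0)"
    using grad_eq[OF height_GDERIV_snd[of x' "(E, x\<^sub>0)"]] assms by simp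
  then show ?thesis using assms by (simp add: weight_def norm_sgn abs_mult power_mult_distrib)
qed

lemma smooth_on_weight:
  fixes f :: "'a::euclidean_space \<Rightarrow> real \<times> 'v::euclidean_space"
  assumes "open S" "smooth_on S f" "smooth_on S g" "\<And>p. p \<in> S \<Longrightarrow> g p \<noteq> snd (f p)"
  shows "smooth_on S (\<lambda>p. weight (f p) (g p))"
  unfolding weight_def
  by (intro smooth_on_compose[OF smooth_on_sqrt] smooth_on_add smooth_on_const smooth_on_power smooth_on_mult
      smooth_on_fst smooth_on_compose[OF smooth_on_deriv[OF open_greaterThan smooth_q]] smooth_on_norm
      smooth_on_diff smooth_on_snd assms) (use assms(4) in \<open>auto simp: add_pos_nonneg\<close>)

text \<open>The factor 1 / (2 pi) comes from writing the delta distribution at \<Psi> as 1 / (2 pi)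
  times the integral of exp(i \<sigma> \<Psi>) over \<sigma>.\<close>

definition amplitude :: "(real \<times> (real^'m)) \<times> ((real^'m) \<times> real) \<times> real \<Rightarrow> complex" where
  "amplitude = (\<lambda>(y, x, \<sigma>). complex_of_real (weight y (fst x) / (2 * pi)))"

lemma open_W_dom: "open (W_dom :: ((real \<times> (real^'m)) \<times> (real^'m) \<times> real) set)"
proof -
  have "open {p :: (real \<times> (real^'m)) \<times> (real^'m) \<times> real. 0 < fst (fst p) \<and> 0 < snd (snd p) \<and> fst (snd p) \<noteq> snd (fst p)}"
    by (intro open_Collect_conj open_Collect_less open_Collect_neq continuous_intros)
  also have "\<dots> = W_dom" by (auto simp: W_dom_def)
  finally show ?thesis .
qed

lemma symbol_amplitude:
  "symbol (W_dom :: ((real \<times> (real^'m)) \<times> (real^'m) \<times> real) set) 0 amplitude"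
proof -
  have "smooth_on (W_dom :: ((real \<times> (real^'m)) \<times> (real^'m) \<times> real) set)
      (\<lambda>p. complex_of_real (weight (fst p) (fst (snd p)) / (2 * pi)))"
    by (intro smooth_on_of_real smooth_on_divide smooth_on_weight smooth_on_const smooth_on_fst smooth_on_snd
        smooth_on_id open_W_dom) (auto simp: W_dom_def)
  from symbol_order_0_const_frequency[OF open_W_dom this] show ?thesis
    by (simp add: amplitude_def)
qed

text \<open>The density is at least 1, so 1 / (2 pi) is a lower bound on every compact set; the
  frequency threshold 1 is arbitrary.\<close>

lemma elliptic_symbol_amplitude:
  "elliptic_symbol (W_dom :: ((real \<times> (real^'m)) \<times> (real^'m) \<times> real) set) 0 amplitude"
proof -
  have "cmod (amplitude (y, x, \<sigma>)) \<ge> 1 / (2 * pi) * (1 + norm \<sigma>) powr 0" for y :: "real \<times> (real^'m)" and x \<sigma>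
    using weight_ge_1[of y "fst x"] by (simp add: amplitude_def powr_zero_eq_one add_nonneg_eq_0_iff norm_divide divide_right_mono)
  then show ?thesis
    unfolding elliptic_symbol_def using symbol_amplitude
    by (intro conjI allI impI exI[of _ "1 / (2 * pi)"] exI[of _ 1]) auto
qed

section \<open>The Schwartz kernel\<close>

definition lift :: "(real \<times> 'v) \<times> 'v \<Rightarrow> (real \<times> 'v::euclidean_space) \<times> ('v \<times> real)" where
  "lift z = (fst z, (snd z, height (fst z) (snd z)))"

text \<open>The distribution given by the delta of \<Psi> times the norm of its x-gradient:
  \<open>lift\<close> parametrises the zero set of \<Psi> by \<open>(y, x')\<close>, and
  \<open>weight\<close> is the density in these coordinates.\<close>

definition kernel :: "((real \<times> (real^'m)) \<times> ((real^'m) \<times> real) \<Rightarrow> complex) \<Rightarrow> complex" where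
  "kernel u = (LINT z|lborel. complex_of_real (weight (fst z) (snd z)) * u (lift z))"

lemma continuous_on_height:
  assumes "continuous_on S f" "continuous_on S g"
  shows "continuous_on S (\<lambda>p. height (f p) (g p))"
  unfolding height_def
  by (intro continuous_intros continuous_on_compose2[OF continuous_q] assms) auto

lemma continuous_on_lift: "continuous_on S lift"
  unfolding lift_def[abs_def] by (intro continuous_intros continuous_on_height)

lemma continuous_on_weight:
  fixes S :: "((real \<times> 'v::euclidean_space) \<times> 'v) set"
  assumes "\<And>z. z \<in> S \<Longrightarrow> snd z \<noteq> snd (fst z)"
  shows "continuous_on S (\<lambda>z. weight (fst z) (snd z))"
proof -
  have o: "open {z :: (real \<times> 'v) \<times> 'v. snd z \<noteq> snd (fst z)}"
    by (intro open_Collect_neq continuous_intros)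
  have "continuous_on {z :: (real \<times> 'v) \<times> 'v. snd z \<noteq> snd (fst z)} (\<lambda>z. weight (fst z) (snd z))"
    by (intro smooth_on_imp_continuous_on smooth_on_weight smooth_on_fst smooth_on_snd smooth_on_id o) auto
  then show ?thesis using assms by (elim continuous_on_subset) auto
qed

text \<open>Compactness: the preimage is closed and contained in the projection of \<open>K\<close>
  to \<open>(y, x')\<close>. The vertex is excluded because the height is 0 there while
  \<open>K\<close> lies in \<open>x\<^sub>n > 0\<close>, so the density is continuous on the
  preimage.\<close>

lemma compact_lift_vimage:
  fixes K :: "((real \<times> (real^'m)) \<times> ((real^'m) \<times> real)) set"
  assumes "compact K" "K \<subseteq> Y_dom \<times> X_dom"
  shows "compact (lift -` K)" "\<And>z. z \<in> lift -` K \<Longrightarrow> snd z \<noteq> snd (fst z)"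
proof -
  have "closed (lift -` K)"
    using assms(1) continuous_on_lift[of UNIV]
    by (intro continuous_closed_vimage) (auto simp: compact_imp_closed continuous_on_eq_continuous_at)
  moreover have "compact ((\<lambda>p. (fst p, fst (snd p))) ` K)"
    by (intro compact_continuous_image continuous_intros assms)
  ultimately have "compact ((\<lambda>p. (fst p, fst (snd p))) ` K \<inter> lift -` K)"
    by (intro compact_Int_closed)
  also have "(\<lambda>p. (fst p, fst (snd p))) ` K \<inter> lift -` K = lift -` K"
    by (force simp: lift_def)
  finally show "compact (lift -` K)" .
next
  fix z assume "z \<in> lift -` K"
  then have "height (fst z) (snd z) > 0" using assms(2) by (auto simp: lift_def X_dom_def)
  then show "snd z \<noteq> snd (fst z)" by (auto simp: height_def q_0)
qed

lemma kernel_integrable: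
  assumes "compact K" "K \<subseteq> Y_dom \<times> X_dom" "\<And>x. x \<notin> K \<Longrightarrow> u x = 0" "continuous_on UNIV u"
  shows "integrable lborel (\<lambda>z. complex_of_real (weight (fst z) (snd z)) * u (lift z))"
proof (rule integral_compact_support[OF compact_lift_vimage(1)[OF assms(1,2)]])
  show "continuous_on (lift -` K) (\<lambda>z. complex_of_real (weight (fst z) (snd z)) * u (lift z))"
    by (intro continuous_intros continuous_on_weight compact_lift_vimage(2)[OF assms(1,2)]
        continuous_on_compose2[OF assms(4)] continuous_on_lift) auto
qed (use assms(3) in auto)

text \<open>A distribution of order 0: the constant is the integral of the density over the preimage
  of \<open>K\<close>, and no derivatives enter (\<open>k = 0\<close>).\<close>

lemma distribution_kernel: "distribution_on (Y_dom \<times> X_dom) kernel"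
  unfolding distribution_on_def
proof (intro conjI ballI allI impI)
  fix u v :: "(real \<times> (real^'m)) \<times> ((real^'m) \<times> real) \<Rightarrow> complex"
  assume "u \<in> test_functions (Y_dom \<times> X_dom)" "v \<in> test_functions (Y_dom \<times> X_dom)"
  then show "kernel (\<lambda>x. u x + v x) = kernel u + kernel v"
    unfolding kernel_def by (elim test_functionE) (simp add: distrib_left kernel_integrable)
next
  fix u :: "(real \<times> (real^'m)) \<times> ((real^'m) \<times> real) \<Rightarrow> complex" and c
  show "kernel (\<lambda>x. c * u x) = c * kernel u"
    unfolding kernel_def by (subst integral_mult_right_zero[symmetric]) (simp add: mult_ac)
next
  fix K :: "((real \<times> (real^'m)) \<times> ((real^'m) \<times> real)) set"
  assume K: "compact K \<and> K \<subseteq> Y_dom \<times> X_dom"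
  note K' = compact_lift_vimage[of K]
  let ?w = "\<lambda>z. indicator (lift -` K) z *\<^sub>R weight (fst z) (snd z)"
  have w: "integrable lborel ?w"
    using K by (intro borel_integrable_compact continuous_on_weight K') auto
  have "cmod (kernel u) \<le> (LINT z|lborel. ?w z) * B"
    if u: "u \<in> test_functions (Y_dom \<times> X_dom)" and z: "\<forall>x. x \<notin> K \<longrightarrow> u x = 0" and B: "\<And>x. cmod (u x) \<le> B" for u B
  proof -
    have "continuous_on UNIV u" using u by (elim test_functionE)
    then have i: "integrable lborel (\<lambda>z. complex_of_real (weight (fst z) (snd z)) * u (lift z))"
      using K z by (intro kernel_integrable) auto
    have "cmod (kernel u) \<le> (LINT z|lborel. cmod (complex_of_real (weight (fst z) (snd z)) * u (lift z)))"
      unfolding kernel_def by (rule integral_norm_bound)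
    also have "\<dots> \<le> (LINT z|lborel. ?w z * B)"
    proof (rule integral_mono)
      fix z :: "(real \<times> (real^'m)) \<times> (real^'m)"
      show "cmod (complex_of_real (weight (fst z) (snd z)) * u (lift z)) \<le> ?w z * B"
      proof (cases "lift z \<in> K")
        case True
        then show ?thesis using B[of "lift z"] weight_ge_1[of "fst z" "snd z"]
          by (simp add: norm_mult mult_left_mono)
      next
        case False
        then have "u (lift z) = 0" using \<open>\<forall>x. x \<notin> K \<longrightarrow> u x = 0\<close> by blast
        then show ?thesis using False by simp
      qed
    qed (use i w in auto)
    also have "\<dots> = (LINT z|lborel. ?w z) * B" by (rule integral_mult_left_zero)
    finally show ?thesis .
  qed
  then show "\<exists>C k. \<forall>u\<in>test_functions (Y_dom \<times> X_dom). \<forall>B.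
         (\<forall>x. x \<notin> K \<longrightarrow> u x = 0) \<and>
         (\<forall>vs\<in>lists Basis. length vs \<le> k \<longrightarrow> (\<forall>x. cmod (iter_deriv vs u x) \<le> B)) \<longrightarrow>
         cmod (kernel u) \<le> C * B"
    by (intro exI[of _ "LINT z|lborel. ?w z"] exI[of _ 0]) auto
qed

lemma cone_radon_eq:
  fixes f :: "(real^'m) \<times> real \<Rightarrow> complex"
  assumes f: "f \<in> test_functions X_dom"
  shows "cone_radon q f y = (LINT x'|lborel. complex_of_real (weight y x') * f (x', height y x'))"
proof -
  obtain K where K: "compact K" "K \<subseteq> X_dom" "\<And>x. x \<notin> K \<Longrightarrow> f x = 0" and c: "continuous_on UNIV f"
    using f by (rule test_functionE) blast
  let ?F = "\<lambda>x'. complex_of_real (weight y x') * f (x', height y x')"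
  obtain E x\<^sub>0 where y: "y = (E, x\<^sub>0)" by (cases y)
  have "(x\<^sub>0, height y x\<^sub>0) \<notin> K" using K(2) by (auto simp: height_def y q_0 X_dom_def)
  then have F0: "?F x\<^sub>0 = 0" using K(3) by simp
  have eq: "indicator (- {x\<^sub>0}) x' *\<^sub>R (complex_of_real (sqrt (1 + (norm (grad (\<lambda>x'. E * q (norm (x' - x\<^sub>0))) x'))\<^sup>2)) *
      f (x', E * q (norm (x' - x\<^sub>0)))) = ?F x'" for x'
    using F0 by (cases "x' = x\<^sub>0") (simp_all add: sqrt_grad_height y height_def)
  have "continuous_on (- {x\<^sub>0}) ((\<lambda>z. weight (fst z) (snd z)) \<circ> Pair y)"
    by (intro continuous_on_compose continuous_on_weight continuous_intros) (auto simp: y)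
  then have cw: "continuous_on (- {x\<^sub>0}) (weight y)" by (simp add: comp_def)
  have "(\<lambda>x'. indicator (- {x\<^sub>0}) x' *\<^sub>R ?F x') \<in> borel_measurable borel"
    by (intro borel_measurable_continuous_on_indicator continuous_intros cw continuous_on_compose2[OF c] continuous_on_height) auto
  moreover have "(\<lambda>x'. indicator (- {x\<^sub>0}) x' *\<^sub>R ?F x') = ?F"
    using F0 by (auto simp: indicator_def fun_eq_iff)
  ultimately have m: "?F \<in> borel_measurable lborel" by simp
  show ?thesis
    unfolding cone_radon_def graph_surface_integral_def set_lebesgue_integral_def y prod.case
    using integral_completion[OF m] by (simp add: eq y)
qed

lemma schwartz_kernel_cone:
  "schwartz_kernel (Y_dom :: (real \<times> (real^'m)) set) X_dom (cone_radon q) kernel"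
  unfolding schwartz_kernel_def
proof (intro conjI ballI)
  show "distribution_on ((Y_dom :: (real \<times> (real^'m)) set) \<times> X_dom) kernel" by (rule distribution_kernel)
next
  fix f :: "(real^'m) \<times> real \<Rightarrow> complex" and v :: "real \<times> (real^'m) \<Rightarrow> complex"
  assume f: "f \<in> test_functions X_dom" and v: "v \<in> test_functions Y_dom"
  obtain Kf where Kf: "compact Kf" "Kf \<subseteq> X_dom" "\<And>x. x \<notin> Kf \<Longrightarrow> f x = 0" and cf: "continuous_on UNIV f"
    using f by (rule test_functionE) blast
  obtain Kv where Kv: "compact Kv" "Kv \<subseteq> Y_dom" "\<And>x. x \<notin> Kv \<Longrightarrow> v x = 0" and cv: "continuous_on UNIV v"
    using v by (rule test_functionE) blast
  let ?u = "\<lambda>(y, x). v y * f x"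
  let ?F = "\<lambda>z. complex_of_real (weight (fst z) (snd z)) * ?u (lift z)"
  have int: "integrable lborel ?F"
  proof (rule kernel_integrable)
    show "compact (Kv \<times> Kf)" "Kv \<times> Kf \<subseteq> Y_dom \<times> X_dom" using Kf Kv by (auto intro: compact_Times)
    show "continuous_on UNIV ?u"
      unfolding split_def by (intro continuous_intros continuous_on_compose2[OF cf] continuous_on_compose2[OF cv]) auto
    show "?u p = 0" if "p \<notin> Kv \<times> Kf" for p
      using that Kf(3)[of "snd p"] Kv(3)[of "fst p"] by (cases p) auto
  qed
  have inner: "cone_radon q f y * v y = (LINT x'|lborel. ?F (y, x'))" for y
    unfolding cone_radon_eq[OF f] integral_mult_left_zero[symmetric]
    by (simp add: lift_def mult_ac)
  \<comment> \<open>Off \<open>Y_dom\<close> the factor \<open>v\<close> is 0, so the restriction of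
    the outer integral has no effect.\<close>
  have ind: "indicator Y_dom y *\<^sub>R (cone_radon q f y * v y) = (LINT x'|lborel. ?F (y, x'))" for y
    using Kv(2) Kv(3)[of y] by (subst inner[symmetric]) (auto simp: indicator_def)
  have I: "integrable lborel (\<lambda>y. LINT x'|lborel. ?F (y, x'))"
    by (rule integrable_lborel_prod(1)[OF int])
  show "set_integrable lebesgue Y_dom (\<lambda>y. cone_radon q f y * v y)"
    unfolding set_integrable_def ind using I integrable_completion[OF borel_measurable_integrable[OF I]] by simp
  show "(LINT y:Y_dom|lebesgue. cone_radon q f y * v y) = kernel ?u"
    unfolding set_lebesgue_integral_def ind kernel_def integrable_lborel_prod(2)[OF int]
    by (rule integral_completion[OF borel_measurable_integrable[OF I]])
qed


section \<open>The oscillatory integral\<close>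

lemma W_dom_subset: "W_dom \<subseteq> (Y_dom :: (real \<times> (real^'m)) set) \<times> X_dom"
  by (auto simp: W_dom_def Y_dom_def X_dom_def)

definition integrand ::
  "((real \<times> (real^'m)) \<times> ((real^'m) \<times> real) \<Rightarrow> complex) \<Rightarrow> (real \<Rightarrow> complex) \<Rightarrow> real \<Rightarrow>
     (real \<times> (real^'m)) \<times> ((real^'m) \<times> real) \<times> real \<Rightarrow> complex" where
  "integrand u \<rho> \<epsilon> = (\<lambda>(y, x, \<sigma>). exp (\<i> * complex_of_real (cone_phase q (y, x, \<sigma>))) *
     amplitude (y, x, \<sigma>) * \<rho> (\<epsilon> *\<^sub>R \<sigma>) * u (y, x))"

context
  fixes u :: "(real \<times> (real^'m)) \<times> ((real^'m) \<times> real) \<Rightarrow> complex" and K and \<rho> N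
  assumes K: "compact K" "K \<subseteq> W_dom" "\<And>x. x \<notin> K \<Longrightarrow> u x = 0" and cu: "continuous_on UNIV u"
    and bump: "fourier_bump \<rho> (iter_deriv [1] \<rho>) (iter_deriv [1, 1] \<rho>) N" and \<rho>0: "\<rho> 0 = 1"
begin

interpretation fourier_bump \<rho> "iter_deriv [1] \<rho>" "iter_deriv [1, 1] \<rho>" N by (rule bump)

definition base :: "((real \<times> (real^'m)) \<times> (real^'m)) set" where
  "base = (\<lambda>p. (fst p, fst (snd p))) ` K"

lemma compact_base: "compact base"
  unfolding base_def by (intro compact_continuous_image continuous_intros K)

lemma base_neq: "z \<in> base \<Longrightarrow> snd z \<noteq> snd (fst z)"
  using K(2) by (auto simp: base_def W_dom_def)

lemma u_base: "(y, x') \<notin> base \<Longrightarrow> u (y, (x', t)) = 0"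
  using K(3)[of "(y, (x', t))"] image_eqI[of "(y, x')" "\<lambda>p. (fst p, fst (snd p))" "(y, (x', t))" K]
  by (auto simp: base_def)

text \<open>The density alone need not be integrable. Cutting it off to the compact set
  \<open>base\<close> makes it so and changes no product with \<open>u\<close>, which vanishes over
  the complement.\<close>

definition base_weight :: "(real \<times> (real^'m)) \<times> (real^'m) \<Rightarrow> complex" where
  "base_weight z = indicator base z *\<^sub>R complex_of_real (weight (fst z) (snd z) / (2 * pi))"

lemma integrable_base_weight: "integrable lborel base_weight"
  unfolding base_weight_def[abs_def]
  by (intro borel_integrable_compact compact_base continuous_intros continuous_on_weight base_neq) auto

text \<open>The integral across the surface after the substitution \<open>x\<^sub>n\<close> = height
  + \<epsilon> s. The fast variable s carries the transform of the cutoff, and \<epsilon> survives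
  only in the argument of \<open>u\<close>.\<close>

definition transversal :: "real \<Rightarrow> (real \<times> (real^'m)) \<times> (real^'m) \<Rightarrow> complex" where
  "transversal \<epsilon> z = (LINT s|lborel. fourier s * u (fst z, (snd z, height (fst z) (snd z) + \<epsilon> * s)))"

lemma continuous_on_shifted: "continuous_on S (\<lambda>p. u (fst (fst p), (snd (fst p), height (fst (fst p)) (snd (fst p)) + \<epsilon> * snd p)))"
  by (intro continuous_on_compose2[OF cu] continuous_intros continuous_on_height) auto

lemma borel_measurable_transversal: "transversal \<epsilon> \<in> borel_measurable borel"
proof -
  have m: "(\<lambda>p. u (fst (fst p), (snd (fst p), height (fst (fst p)) (snd (fst p)) + \<epsilon> * snd p))) \<in> borel_measurable borel"
    by (rule borel_measurable_continuous_onI[OF continuous_on_shifted])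
  have "(\<lambda>p. fourier (snd p) * u (fst (fst p), (snd (fst p), height (fst (fst p)) (snd (fst p)) + \<epsilon> * snd p)))
      \<in> borel_measurable (lborel \<Otimes>\<^sub>M lborel)"
    unfolding lborel_prod
    by (intro borel_measurable_times measurable_compose[OF _ borel_measurable_fourier])
      (use m in \<open>auto intro!: borel_measurable_continuous_onI continuous_intros\<close>)
  then have "transversal \<epsilon> \<in> borel_measurable lborel"
    unfolding transversal_def[abs_def]
    by (intro lborel.borel_measurable_lebesgue_integral) (simp add: split_def)
  then show ?thesis by simp
qed

lemma transversal_limit: "((\<lambda>\<epsilon>. transversal \<epsilon> z) \<longlongrightarrow> 2 * pi * u (lift z)) (at_right 0)"
proof -
  obtain B where B: "B \<ge> 0" "\<And>x. cmod (u x) \<le> B" using compact_support_bounded[OF K(1,3) cu] by blast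
  have m: "(\<lambda>s. u (fst z, (snd z, height (fst z) (snd z) + \<epsilon> * s))) \<in> borel_measurable borel" for \<epsilon>
    by (intro borel_measurable_continuous_onI continuous_on_compose2[OF cu] continuous_intros) auto
  have "((\<lambda>\<epsilon>. transversal \<epsilon> z) \<longlongrightarrow> (LINT s|lborel. fourier s * u (lift z))) (at_right 0)"
    unfolding transversal_def
  proof (rule dominated_convergence_at_right)
    show "integrable lborel (\<lambda>s. norm (fourier s) * B)"
      using integrable_fourier by (intro integrable_mult_left integrable_norm)
    show "norm (fourier s * u (fst z, (snd z, height (fst z) (snd z) + t * s))) \<le> norm (fourier s) * B" for t s
      unfolding norm_mult by (intro mult_left_mono B) simp
    fix s
    have "continuous_on UNIV (\<lambda>\<epsilon>. u (fst z, (snd z, height (fst z) (snd z) + \<epsilon> * s)))"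
      by (intro continuous_on_compose2[OF cu] continuous_intros) auto
    then have "((\<lambda>\<epsilon>. u (fst z, (snd z, height (fst z) (snd z) + \<epsilon> * s))) \<longlongrightarrow> u (fst z, (snd z, height (fst z) (snd z) + 0 * s))) (at 0)"
      unfolding continuous_on_def by (metis UNIV_I)
    then have "((\<lambda>\<epsilon>. u (fst z, (snd z, height (fst z) (snd z) + \<epsilon> * s))) \<longlongrightarrow> u (lift z)) (at_right 0)"
      unfolding lift_def by (simp add: filterlim_at_split)
    then show "((\<lambda>\<epsilon>. fourier s * u (fst z, (snd z, height (fst z) (snd z) + \<epsilon> * s))) \<longlongrightarrow> fourier s * u (lift z)) (at_right 0)"
      by (rule tendsto_mult_left)
  qed (use m in simp_all)
  then show ?thesis by (simp add: integral_fourier \<rho>0)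
qed

text \<open>The bound is uniform in \<epsilon> as well as in the base point; this is the domination
  needed for the outer limit.\<close>

lemma transversal_bound:
  obtains C where "\<And>\<epsilon> z. cmod (transversal \<epsilon> z) \<le> C"
proof -
  obtain B where B: "B \<ge> 0" "\<And>x. cmod (u x) \<le> B" using compact_support_bounded[OF K(1,3) cu] by blast
  have "cmod (transversal \<epsilon> z) \<le> (LINT s|lborel. norm (fourier s) * B)" for \<epsilon> z
  proof -
    have "cmod (transversal \<epsilon> z) \<le> (LINT s|lborel. cmod (fourier s * u (fst z, (snd z, height (fst z) (snd z) + \<epsilon> * s))))"
      unfolding transversal_def by (rule integral_norm_bound)
    also have "\<dots> \<le> (LINT s|lborel. norm (fourier s) * B)"
    proof (rule integral_mono')
      show "integrable lborel (\<lambda>s. norm (fourier s) * B)"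
        using integrable_fourier by (intro integrable_mult_left integrable_norm)
    qed (simp_all add: norm_mult mult_left_mono B)
    finally show ?thesis .
  qed
  then show ?thesis by (rule that)
qed

lemma integral_base_limit:
  "((\<lambda>\<epsilon>. LINT z|lborel. base_weight z * transversal \<epsilon> z) \<longlongrightarrow> kernel u) (at_right 0)"
proof -
  obtain C where C: "\<And>\<epsilon> z. cmod (transversal \<epsilon> z) \<le> C" using transversal_bound by blast
  have "((\<lambda>\<epsilon>. LINT z|lborel. base_weight z * transversal \<epsilon> z) \<longlongrightarrow> (LINT z|lborel. base_weight z * (2 * pi * u (lift z)))) (at_right 0)"
  proof (rule dominated_convergence_at_right)
    show "integrable lborel (\<lambda>z. norm (base_weight z) * C)"
      using integrable_base_weight by (intro integrable_mult_left integrable_norm)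
    show "norm (base_weight z * transversal t z) \<le> norm (base_weight z) * C" for t z
      unfolding norm_mult by (intro mult_left_mono C) simp
    show "((\<lambda>t. base_weight z * transversal t z) \<longlongrightarrow> base_weight z * (2 * pi * u (lift z))) (at_right 0)" for z
      by (intro tendsto_mult_left transversal_limit)
    have "(\<lambda>z. u (lift z)) \<in> borel_measurable borel"
      by (intro borel_measurable_continuous_onI continuous_on_compose2[OF cu] continuous_on_lift) auto
    then show "(\<lambda>z. base_weight z * (2 * pi * u (lift z))) \<in> borel_measurable lborel"
      using borel_measurable_integrable[OF integrable_base_weight] by simp
    show "(\<lambda>z. base_weight z * transversal t z) \<in> borel_measurable lborel" for t
      using borel_measurable_integrable[OF integrable_base_weight] borel_measurable_transversal[of t] by simp
  qed
  \<comment> \<open>The 2 pi of Fourier inversion cancels against the amplitude; the indicator may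
    go because \<open>u (lift z)\<close> vanishes off \<open>base\<close>.\<close>
  also have "(\<lambda>z. base_weight z * (2 * pi * u (lift z))) = (\<lambda>z. complex_of_real (weight (fst z) (snd z)) * u (lift z))"
    using u_base by (auto simp: base_weight_def lift_def indicator_def fun_eq_iff)
  finally show ?thesis by (simp add: kernel_def)
qed

text \<open>For positive \<epsilon> the cutoff confines \<sigma> to the interval of radius N /
  \<epsilon>, while \<open>u\<close> confines the base point to \<open>K\<close>.\<close>

lemma compactly_supported_integrand:
  assumes "\<epsilon> > 0"
  shows "compactly_supported (integrand u \<rho> \<epsilon>)"
  unfolding compactly_supported_def
proof (intro exI conjI allI impI)
  let ?L = "(\<lambda>(p, \<sigma>). (fst p, snd p, \<sigma>)) ` (K \<times> {-(N/\<epsilon>)..N/\<epsilon>})"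
  have L: "(y, x, \<sigma>) \<in> ?L \<longleftrightarrow> (y, x) \<in> K \<and> \<sigma> \<in> {-(N/\<epsilon>)..N/\<epsilon>}" for y x \<sigma>
    by force
  show "compact ?L"
    unfolding split_def by (intro compact_continuous_image compact_Times K continuous_intros) auto
  have "continuous_on ?L (\<lambda>p. weight (fst p) (fst (fst (snd p))))"
  proof -
    have "continuous_on ?L ((\<lambda>z. weight (fst z) (snd z)) \<circ> (\<lambda>p. (fst p, fst (fst (snd p)))))"
      by (intro continuous_on_compose continuous_on_weight continuous_intros)
        (use K(2) in \<open>auto simp: W_dom_def\<close>)
    then show ?thesis by (simp add: comp_def)
  qed
  then have "continuous_on ?L (\<lambda>p. exp (\<i> * complex_of_real (snd (snd p) * (snd (fst (snd p)) - height (fst p) (fst (fst (snd p)))))) *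
      complex_of_real (weight (fst p) (fst (fst (snd p))) / (2 * pi)) * \<rho> (\<epsilon> * snd (snd p)) * u (fst p, fst (snd p)))"
    by (intro continuous_intros continuous_on_height continuous_on_compose2[OF cont(1)[of UNIV]]
        continuous_on_compose2[OF cu]) auto
  then show "continuous_on ?L (integrand u \<rho> \<epsilon>)"
    by (simp add: integrand_def amplitude_def cone_phase_eq split_def)
  fix p assume p: "p \<notin> ?L"
  obtain y x \<sigma> where eq: "p = (y, x, \<sigma>)" by (cases p)
  consider "(y, x) \<notin> K" | "\<sigma> \<notin> {-(N/\<epsilon>)..N/\<epsilon>}" using p unfolding eq L by blast
  then show "integrand u \<rho> \<epsilon> p = 0"
  proof cases
    case 1
    then show ?thesis using K(3) by (simp add: integrand_def eq)
  next
    case 2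
    then have "\<epsilon> * \<sigma> \<notin> {-N<..<N}" using assms by (auto simp: field_simps)
    then show ?thesis using supp(1) by (simp add: integrand_def eq)
  qed
qed

lemma integral_frequency:
  assumes "\<epsilon> > 0"
  shows "(LINT \<sigma>|lborel. \<rho> (\<epsilon> * \<sigma>) * exp (\<i> * complex_of_real (\<sigma> * t))) = complex_of_real (1 / \<epsilon>) * fourier (t / \<epsilon>)"
  using assms
  by (subst lborel_integral_real_affine[of "1 / \<epsilon>" _ 0]) (simp_all add: fourier_def scaleR_conv_of_real mult_ac)

lemma integral_fibre:
  assumes \<epsilon>: "\<epsilon> > 0"
  shows "(LINT xn|lborel. LINT \<sigma>|lborel. integrand u \<rho> \<epsilon> (y, (x', xn), \<sigma>)) = base_weight (y, x') * transversal \<epsilon> (y, x')"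
proof -
  let ?h = "height y x'" and ?c = "complex_of_real (weight y x' / (2 * pi))"
  have "(LINT \<sigma>|lborel. integrand u \<rho> \<epsilon> (y, (x', xn), \<sigma>)) = ?c * u (y, (x', xn)) * (complex_of_real (1 / \<epsilon>) * fourier ((xn - ?h) / \<epsilon>))" for xn
    unfolding integral_frequency[OF \<epsilon>, symmetric]
    by (subst integral_mult_right_zero[symmetric])
      (simp add: integrand_def amplitude_def cone_phase_eq mult_ac)
  then have "(LINT xn|lborel. LINT \<sigma>|lborel. integrand u \<rho> \<epsilon> (y, (x', xn), \<sigma>)) =
      (LINT xn|lborel. ?c * u (y, (x', xn)) * (complex_of_real (1 / \<epsilon>) * fourier ((xn - ?h) / \<epsilon>)))"
    by simp
  \<comment> \<open>The Jacobian \<epsilon> of \<open>x\<^sub>n\<close> = height + \<epsilon> s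
    cancels the 1 / \<epsilon> produced by scaling the frequency.\<close>
  also have "\<dots> = \<epsilon> *\<^sub>R (LINT s|lborel. ?c * u (y, (x', ?h + \<epsilon> * s)) * (complex_of_real (1 / \<epsilon>) * fourier s))"
    using \<epsilon> by (subst lborel_integral_real_affine[of \<epsilon> _ ?h]) simp_all
  also have "\<dots> = (LINT s|lborel. ?c * (fourier s * u (y, (x', ?h + \<epsilon> * s))))"
    using \<epsilon> by (subst integral_scaleR_right[symmetric]) (simp add: scaleR_conv_of_real mult_ac)
  also have "\<dots> = ?c * transversal \<epsilon> (y, x')"
    unfolding transversal_def by (subst integral_mult_right_zero) simp
  also have "\<dots> = base_weight (y, x') * transversal \<epsilon> (y, x')"
  proof (cases "(y, x') \<in> base")
    case False
    then have "transversal \<epsilon> (y, x') = 0" by (simp add: transversal_def u_base)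
    then show ?thesis by simp
  qed (simp add: base_weight_def)
  finally show ?thesis .
qed

text \<open>The nested product is peeled from the outside until the fibre integral over
  \<open>x\<^sub>n\<close> and \<sigma> is innermost, then \<open>y\<close> and \<open>x'\<close>
  are recombined. Recombination needs integrability of the fibre integrals, which follows from the
  bound on \<open>transversal\<close>.\<close>

lemma integral_integrand:
  assumes \<epsilon>: "\<epsilon> > 0"
  shows "(LINT p|lborel. integrand u \<rho> \<epsilon> p) = (LINT z|lborel. base_weight z * transversal \<epsilon> z)"
proof -
  note cs = compactly_supported_integrand[OF \<epsilon>]
  note cs1 = compactly_supported_slice[OF cs]
  obtain C where C: "\<And>\<epsilon> z. cmod (transversal \<epsilon> z) \<le> C" using transversal_bound by blast
  have int: "integrable lborel (\<lambda>z. base_weight z * transversal \<epsilon> z)"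
  proof (rule Bochner_Integration.integrable_bound)
    show "integrable lborel (\<lambda>z. norm (base_weight z) * C)"
      using integrable_base_weight by (intro integrable_mult_left integrable_norm)
    show "AE z in lborel. norm (base_weight z * transversal \<epsilon> z) \<le> norm (norm (base_weight z) * C)"
      using C by (intro AE_I2) (auto simp: norm_mult abs_mult intro!: mult_left_mono intro: order_trans[OF _ abs_ge_self])
    show "(\<lambda>z. base_weight z * transversal \<epsilon> z) \<in> borel_measurable lborel"
      using borel_measurable_integrable[OF integrable_base_weight] borel_measurable_transversal[of \<epsilon>] by simp
  qed
  have "(LINT p|lborel. integrand u \<rho> \<epsilon> p) = (LINT y|lborel. LINT r|lborel. integrand u \<rho> \<epsilon> (y, r))"
    by (rule integrable_lborel_prod(2)[OF compactly_supported_integrable[OF cs]])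
  also have "\<dots> = (LINT y|lborel. LINT x|lborel. LINT \<sigma>|lborel. integrand u \<rho> \<epsilon> (y, x, \<sigma>))"
    by (simp only: integrable_lborel_prod(2)[OF compactly_supported_integrable[OF cs1]])
  also have "\<dots> = (LINT y|lborel. LINT x'|lborel. LINT xn|lborel. LINT \<sigma>|lborel. integrand u \<rho> \<epsilon> (y, (x', xn), \<sigma>))"
    by (simp only: integrable_lborel_prod(2)[OF integrable_lborel_prod(1)[OF compactly_supported_integrable[OF cs1]]])
  also have "\<dots> = (LINT y|lborel. LINT x'|lborel. base_weight (y, x') * transversal \<epsilon> (y, x'))"
    by (simp only: integral_fibre[OF \<epsilon>])
  also have "\<dots> = (LINT z|lborel. base_weight z * transversal \<epsilon> z)"
    by (rule integrable_lborel_prod(2)[OF int, symmetric])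
  finally show ?thesis .
qed

text \<open>The restriction removes the hyperplane \<sigma> = 0, which is null, and base points
  outside \<open>W_dom\<close>, where \<open>u\<close> vanishes.\<close>

lemma integral_phase_domain:
  assumes \<epsilon>: "\<epsilon> > 0"
  shows "(LINT p:phase_domain W_dom|lebesgue. integrand u \<rho> \<epsilon> p) = (LINT p|lborel. integrand u \<rho> \<epsilon> p)"
proof -
  have m: "integrand u \<rho> \<epsilon> \<in> borel_measurable lborel"
    by (rule borel_measurable_integrable[OF compactly_supported_integrable[OF compactly_supported_integrand[OF \<epsilon>]]])
  let ?H = "{p :: (real \<times> (real^'m)) \<times> ((real^'m) \<times> real) \<times> real. snd (snd p) = 0}"
  have "negligible {p :: (real \<times> (real^'m)) \<times> ((real^'m) \<times> real) \<times> real. (0, 0, 1) \<bullet> p = 0}"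
    by (rule negligible_hyperplane) (simp add: prod_eq_iff)
  also have "{p :: (real \<times> (real^'m)) \<times> ((real^'m) \<times> real) \<times> real. (0, 0, 1) \<bullet> p = 0} = ?H"
    by (auto simp: inner_prod_def)
  finally have "?H \<in> null_sets lebesgue" by (simp add: negligible_iff_null_sets)
  then have ae: "AE p in lebesgue. p \<notin> ?H" by (rule AE_not_in)
  have "(LINT p:phase_domain W_dom|lebesgue. integrand u \<rho> \<epsilon> p) = (LINT p|lebesgue. integrand u \<rho> \<epsilon> p)"
    unfolding set_lebesgue_integral_def
  proof (rule integral_cong_AE)
    have "phase_domain (W_dom :: ((real \<times> (real^'m)) \<times> (real^'m) \<times> real) set) \<in> sets (borel :: ((real \<times> (real^'m)) \<times> ((real^'m) \<times> real) \<times> real) measure)"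
      using open_phase_domain_W by (rule borel_open)
    with m have "(\<lambda>p. indicator (phase_domain W_dom) p *\<^sub>R integrand u \<rho> \<epsilon> p) \<in> borel_measurable lborel"
      by (intro borel_measurable_scaleR borel_measurable_indicator) auto
    then show "(\<lambda>p. indicator (phase_domain W_dom) p *\<^sub>R integrand u \<rho> \<epsilon> p) \<in> borel_measurable lebesgue"
      by (rule measurable_completion)
    show "integrand u \<rho> \<epsilon> \<in> borel_measurable lebesgue" by (rule measurable_completion[OF m])
    show "AE p in lebesgue. indicator (phase_domain W_dom) p *\<^sub>R integrand u \<rho> \<epsilon> p = integrand u \<rho> \<epsilon> p"
      using ae
    proof eventually_elim
      case (elim p)
      obtain y x \<sigma> where p: "p = (y, x, \<sigma>)" by (cases p)
      show ?case
      proof (cases "(y, x) \<in> W_dom")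
        case True
        then show ?thesis using elim by (simp add: p phase_domain_def)
      next
        case False
        then have "u (y, x) = 0" using K by blast
        then show ?thesis by (simp add: integrand_def p)
      qed
    qed
  qed
  then show ?thesis using integral_completion[OF m] by simp
qed

lemma oscillatory_limit:
  "((\<lambda>\<epsilon>. LINT p:phase_domain W_dom|lebesgue. integrand u \<rho> \<epsilon> p) \<longlongrightarrow> kernel u) (at_right 0)"
proof (rule Lim_transform_eventually[OF integral_base_limit])
  show "\<forall>\<^sub>F \<epsilon> in at_right 0. (LINT z|lborel. base_weight z * transversal \<epsilon> z) = (LINT p:phase_domain W_dom|lebesgue. integrand u \<rho> \<epsilon> p)"
    using eventually_at_right_less[of "0::real"]
    by eventually_elim (simp add: integral_phase_domain integral_integrand)
qed

end

lemma oscillatory_integral_cone: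
  assumes u: "u \<in> test_functions (W_dom :: ((real \<times> (real^'m)) \<times> (real^'m) \<times> real) set)"
  shows "oscillatory_integral W_dom (cone_phase q) amplitude u (kernel u)"
  unfolding oscillatory_integral_def
proof (intro ballI impI)
  fix \<rho> :: "real \<Rightarrow> complex"
  assume \<rho>: "\<rho> \<in> test_functions UNIV" and one: "\<exists>U. open U \<and> 0 \<in> U \<and> (\<forall>\<sigma>\<in>U. \<rho> \<sigma> = 1)"
  obtain K where K: "compact K" "K \<subseteq> W_dom" "\<And>x. x \<notin> K \<Longrightarrow> u x = 0" and cu: "continuous_on UNIV u"
    using u by (rule test_functionE) blast
  obtain N where "fourier_bump \<rho> (iter_deriv [1] \<rho>) (iter_deriv [1, 1] \<rho>) N"
    using fourier_bump_test_function[OF \<rho>] by blast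
  moreover have "\<rho> 0 = 1" using one by blast
  ultimately have "((\<lambda>\<epsilon>. LINT p:phase_domain W_dom|lebesgue. integrand u \<rho> \<epsilon> p) \<longlongrightarrow> kernel u) (at_right 0)"
    using oscillatory_limit[OF K cu] by blast
  then show "((\<lambda>\<epsilon>. LINT p:phase_domain W_dom|lebesgue.
          (case p of (y, x, \<sigma>) \<Rightarrow>
             exp (\<i> * complex_of_real (cone_phase q p)) * amplitude p * \<rho> (\<epsilon> *\<^sub>R \<sigma>) * u (y, x)))
        \<longlongrightarrow> kernel u) (at_right 0)"
    by (simp add: integrand_def split_def)
qed

lemma elliptic_FIO_cone:
  "elliptic_FIO (Y_dom :: (real \<times> (real^'m)) set) X_dom W_dom (cone_phase q) (- real CARD('m) / 2) (cone_radon q)"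
proof -
  have oY: "open (Y_dom :: (real \<times> (real^'m)) set)"
  proof -
    have "open {y :: real \<times> (real^'m). 0 < fst y}" by (intro open_Collect_less continuous_intros)
    also have "\<dots> = Y_dom" by (auto simp: Y_dom_def)
    finally show ?thesis .
  qed
  have oX: "open (X_dom :: ((real^'m) \<times> real) set)"
  proof -
    have "open {x :: (real^'m) \<times> real. 0 < snd x}" by (intro open_Collect_less continuous_intros)
    also have "\<dots> = X_dom" by (auto simp: X_dom_def)
    finally show ?thesis .
  qed
  \<comment> \<open>The complement of the zero set of \<Psi>, to which the kernel is blind. It
    contains the excluded points of \<open>Y_dom \<times> X_dom\<close>, all over the vertex, since
    there the height is 0 and \<open>x\<^sub>n\<close> is positive.\<close>
  define V where "V = {p :: (real \<times> (real^'m)) \<times> (real^'m) \<times> real. snd (snd p) \<noteq> height (fst p) (fst (snd p))}"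
  have "open V" unfolding V_def by (intro open_Collect_neq continuous_intros continuous_on_height)
  moreover have "Y_dom \<times> X_dom - W_dom \<subseteq> V"
    by (auto simp: V_def W_dom_def Y_dom_def X_dom_def height_def q_0)
  moreover have "kernel u = 0" if u: "u \<in> test_functions (V \<inter> (Y_dom \<times> X_dom))" for u
  proof -
    obtain K where "compact K" "K \<subseteq> V \<inter> (Y_dom \<times> X_dom)" "\<And>x. x \<notin> K \<Longrightarrow> u x = 0" "continuous_on UNIV u"
      using u by (rule test_functionE) blast
    moreover have "lift z \<notin> V" for z by (simp add: lift_def V_def)
    ultimately have "u (lift z) = 0" for z by blast
    then show ?thesis by (simp add: kernel_def)
  qed
  ultimately have "fourier_integral_operator (Y_dom :: (real \<times> (real^'m)) set) X_dom W_dom (cone_phase q) amplitude 0 (cone_radon q)"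
    unfolding fourier_integral_operator_def
    using oY oX open_W_dom W_dom_subset phase_function_cone clean_cone nondegenerate_cone symbol_amplitude
      schwartz_kernel_cone oscillatory_integral_cone by blast
  then show ?thesis
    unfolding elliptic_FIO_def using elliptic_symbol_amplitude
    by (intro exI[of _ 0] exI[of _ amplitude]) (simp add: field_simps)
qed

end

theorem theorem3p1:
  fixes n :: nat and q g :: "real \<Rightarrow> real"
    and R :: "((real^'m) \<times> real \<Rightarrow> complex) \<Rightarrow> real \<times> (real^'m) \<Rightarrow> complex"
    and \<Phi> :: "(real \<times> (real^'m)) \<times> ((real^'m) \<times> real) \<times> real \<Rightarrow> real"
  assumes "n \<ge> 2" and "CARD('m) = n - 1"
    and "continuous_on {0..} q" and "smooth_on {0<..} q"
    and "q 0 = 0" and "\<forall>r>0. q r > 0"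
    and R: "R = cone_radon q" and \<Phi>: "\<Phi> = cone_phase q"
    and g: "\<forall>r>0. g r = deriv q r / q r"
  shows "elliptic_FIO Y_dom X_dom W_dom \<Phi> ((1 - real n) / 2) R \<and>
    ((\<forall>r>0. g r > 0) \<longrightarrow>
      (semi_global_Bolker (canonical_relation W_dom \<Phi>) \<longleftrightarrow> (\<forall>r>0. deriv g r \<noteq> 0)) \<and>
      ((\<forall>r>0. deriv g r \<noteq> 0) \<longleftrightarrow> (\<forall>r>0. q r * deriv (deriv q) r - (deriv q r)\<^sup>2 \<noteq> 0)))"
proof -
  interpret cone_profile q
    by unfold_locales (use assms in auto)
  have "- real CARD('m) / 2 = (1 - real n) / 2" using assms(1,2) by simp
  then have FIO: "elliptic_FIO Y_dom X_dom W_dom \<Phi> ((1 - real n) / 2) R"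
    using elliptic_FIO_cone unfolding R \<Phi> by metis
  \<comment> \<open>Since \<open>g\<close> is prescribed only for positive arguments, its derivative
    is compared with that of the quotient through a neighbourhood inside the half-line.\<close>
  have dg: "deriv g r = deriv (\<lambda>r. deriv q r / q r) r" if "r > 0" for r
  proof (rule deriv_cong_ev)
    show "\<forall>\<^sub>F x in nhds r. g x = deriv q x / q x"
      using eventually_nhds_in_open[OF open_greaterThan, of r 0] that g by (auto elim: eventually_mono)
  qed simp
  have g': "deriv g r = (q r * deriv (deriv q) r - (deriv q r)\<^sup>2) / (q r)\<^sup>2" if r: "r > 0" for r
  proof -
    have "(deriv q has_real_derivative deriv (deriv q) r) (at r)"
      using smooth_on_differentiable[OF smooth_on_deriv[OF open_greaterThan smooth_q]] r
      by (simp add: DERIV_deriv_iff_real_differentiable)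
    from DERIV_divide[OF this q_DERIV[OF r]] q_pos[OF r]
    have "deriv (\<lambda>r. deriv q r / q r) r = (deriv (deriv q) r * q r - deriv q r * deriv q r) / (q r * q r)"
      by (intro DERIV_imp_deriv) auto
    then show ?thesis by (simp add: dg[OF r] power2_eq_square mult.commute)
  qed
  have iff: "(\<forall>r>0. deriv g r \<noteq> 0) \<longleftrightarrow> (\<forall>r>0. q r * deriv (deriv q) r - (deriv q r)\<^sup>2 \<noteq> 0)"
    using g' q_pos by (metis divide_eq_0_iff less_irrefl power_eq_0_iff)
  have "semi_global_Bolker (canonical_relation W_dom \<Phi>) \<longleftrightarrow> (\<forall>r>0. deriv g r \<noteq> 0)" if pos: "\<forall>r>0. g r > 0"
  proof
    assume "semi_global_Bolker (canonical_relation W_dom \<Phi>)"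
    then show "\<forall>r>0. deriv g r \<noteq> 0"
      using Bolker_imp_deriv_nonzero dg unfolding \<Phi> by metis
  next
    assume nz: "\<forall>r>0. deriv g r \<noteq> 0"
    \<comment> \<open>Positivity of \<open>g\<close> passes to \<open>deriv q\<close> because
      \<open>q\<close> is positive; the sufficiency direction divides by it.\<close>
    have "deriv q r > 0" if "r > 0" for r
      using pos g q_pos that by (metis zero_less_divide_iff order_less_asym)
    then show "semi_global_Bolker (canonical_relation W_dom \<Phi>)"
      unfolding \<Phi> using nz dg by (intro deriv_nonzero_imp_Bolker) auto
  qed
  with FIO iff show ?thesis by blast
qed

end
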